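(* Let $1<p<\infty$ and consider the bounded linear operator $A=T(a)+H(b)$ on $H^p$ with $a,b\in L^\infty$. Then, for any compact operator $K$ on $H^p$, $$\max\Big\{\|a\|_\infty,\tfrac{1}{1+c_p}\|H(b)+K\|\Big\}\le\|A+K\|\le c_p\|a\|_\infty+\|H(b)+K\|,$$ where $c_p=\|P\|_{B(L^p)}$ is the norm of the Riesz projection $P$ on $L^p$.
   Context: $L^p$ is the Lebesgue space of the unit circle $\mathbb{T}$ with normalized Lebesgue measure, $H^p=\{f\in L^p:\hat f_n=0\text{ for }n<0\}$ with the $L^p$-norm, where $\hat f_n$ are Fourier coefficients. $P:L^p\to H^p$ is the Riesz projection. The flip is $(Jf)(t)=\bar t f(\bar t)$, $t\in\mathbb{T}$. For $a,b\in L^\infty$, $T(a)f=P(af)$ and $H(b)f=P(b\,Jf)$ for $f\in H^p$. *)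

theory Defs
  imports "HOL-Probability.Probability"
begin

section \<open>Normalized Lebesgue measure on the unit circle\<close>

definition circle :: "complex measure" where
  "circle = distr (uniform_measure lborel {-pi..pi}) (restrict_space borel (sphere 0 1)) cis"

lemma space_circle [simp]: "space circle = sphere 0 1"
  by (simp add: circle_def space_restrict_space)

lemma sets_circle [measurable_cong]: "sets circle = sets (restrict_space borel (sphere 0 1))"
  by (simp add: circle_def)

lemma borel_measurable_circleI: "f \<in> borel_measurable borel \<Longrightarrow> f \<in> borel_measurable circle"
  by (simp add: measurable_cong_sets[OF sets_circle refl] measurable_restrict_space1)

lemma cis_measurable_circle:
  "cis \<in> uniform_measure lborel {-pi..pi} \<rightarrow>\<^sub>M restrict_space borel (sphere 0 1)"
  by (intro measurable_restrict_space2)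
     (auto intro!: borel_measurable_continuous_onI continuous_intros
           simp: measurable_cong_sets[OF sets_uniform_measure refl])

lemma prob_space_circle: "prob_space circle"
  unfolding circle_def
  by (intro prob_space.prob_space_distr prob_space_uniform_measure cis_measurable_circle) auto

lemma distr_circle_cnj: "distr circle circle cnj = circle"
proof -
  let ?C = "restrict_space borel (sphere 0 1) :: complex measure"
  let ?U = "uniform_measure lborel {-pi..pi}"
  have cnj: "cnj \<in> ?C \<rightarrow>\<^sub>M ?C"
    by (intro measurable_restrict_space3)
       (auto intro!: borel_measurable_continuous_onI continuous_intros)
  have um: "uminus \<in> ?U \<rightarrow>\<^sub>M ?U"
    by (simp add: measurable_cong_sets[OF sets_uniform_measure sets_uniform_measure])
  have U: "distr ?U ?U uminus = ?U"
  proof (rule measure_eqI)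
    fix A assume "A \<in> sets (distr ?U ?U uminus)"
    then have A [measurable]: "A \<in> sets borel" by simp
    have vA: "uminus -` A \<in> sets borel"
      using measurable_sets[OF borel_measurable_uminus[OF measurable_ident_sets[OF refl]] A] by simp
    have "emeasure (distr ?U ?U uminus) A = emeasure ?U (uminus -` A)"
      using um by (subst emeasure_distr) (auto simp: A)
    also have "\<dots> = emeasure lborel ({-pi..pi} \<inter> uminus -` A) / emeasure lborel {-pi..pi}"
      using vA by simp
    also have "{-pi..pi} \<inter> uminus -` A = uminus -` ({-pi..pi} \<inter> A)" by auto
    also have "emeasure lborel (uminus -` ({-pi..pi} \<inter> A))
        = emeasure (distr lborel borel uminus) ({-pi..pi} \<inter> A)"
      by (subst emeasure_distr) auto
    also have "\<dots> / emeasure lborel {-pi..pi} = emeasure ?U A"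
      by (simp add: lborel_distr_uminus)
    finally show "emeasure (distr ?U ?U uminus) A = emeasure ?U A" .
  qed simp
  have "distr circle circle cnj = distr (distr ?U ?C cis) ?C cnj"
    by (rule distr_cong) (auto simp: circle_def)
  also have "\<dots> = distr ?U ?C (cnj \<circ> cis)"
    by (rule distr_distr[OF cnj cis_measurable_circle])
  also have "cnj \<circ> cis = cis \<circ> uminus"
    by (auto simp: cis_cnj)
  also have "distr ?U ?C (cis \<circ> uminus) = distr (distr ?U ?U uminus) ?C cis"
    by (rule distr_distr[OF cis_measurable_circle um, symmetric])
  also have "\<dots> = circle" by (simp add: U circle_def)
  finally show ?thesis .
qed

lemma cnj_measurable_circle [measurable]: "cnj \<in> circle \<rightarrow>\<^sub>M circle"
  unfolding measurable_cong_sets[OF sets_circle sets_circle]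
  by (intro measurable_restrict_space3)
     (auto intro!: borel_measurable_continuous_onI continuous_intros)

lemma AE_circle_cnj: "AE t in circle. P t \<Longrightarrow> AE t in circle. P (cnj t)"
  by (rule AE_distrD[OF cnj_measurable_circle]) (subst distr_circle_cnj)


section \<open>Measurable functions on the circle modulo almost everywhere equality\<close>

definition ae_eq :: "(complex \<Rightarrow> complex) \<Rightarrow> (complex \<Rightarrow> complex) \<Rightarrow> bool" where
  "ae_eq f g \<longleftrightarrow> f \<in> borel_measurable circle \<and> g \<in> borel_measurable circle \<and>
     (AE t in circle. f t = g t)"

quotient_type circle_fun = "complex \<Rightarrow> complex" / partial: ae_eq
proof (rule part_equivpI)
  show "\<exists>f. ae_eq f f" by (auto simp: ae_eq_def intro!: exI[of _ "\<lambda>_. 0"])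
  show "symp ae_eq" by (auto simp: symp_def ae_eq_def eq_commute)
  show "transp ae_eq" by (auto simp: transp_def ae_eq_def elim: eventually_elim2)
qed

instantiation circle_fun :: comm_ring_1
begin

lift_definition zero_circle_fun :: circle_fun is "\<lambda>_. 0" by (simp add: ae_eq_def)
lift_definition one_circle_fun :: circle_fun is "\<lambda>_. 1" by (simp add: ae_eq_def)
lift_definition plus_circle_fun :: "circle_fun \<Rightarrow> circle_fun \<Rightarrow> circle_fun"
  is "\<lambda>f g t. f t + g t" by (auto simp: ae_eq_def elim: eventually_elim2)
lift_definition minus_circle_fun :: "circle_fun \<Rightarrow> circle_fun \<Rightarrow> circle_fun"
  is "\<lambda>f g t. f t - g t" by (auto simp: ae_eq_def elim: eventually_elim2)
lift_definition uminus_circle_fun :: "circle_fun \<Rightarrow> circle_fun"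
  is "\<lambda>f t. - f t" by (auto simp: ae_eq_def elim: eventually_mono)
lift_definition times_circle_fun :: "circle_fun \<Rightarrow> circle_fun \<Rightarrow> circle_fun"
  is "\<lambda>f g t. f t * g t" by (auto simp: ae_eq_def elim: eventually_elim2)

instance
proof
  show "(0::circle_fun) \<noteq> 1"
    by transfer (simp add: ae_eq_def prob_space.AE_False[OF prob_space_circle])
qed (transfer, force simp: ae_eq_def algebra_simps)+

end

lift_definition cscale :: "complex \<Rightarrow> circle_fun \<Rightarrow> circle_fun" is "\<lambda>c f t. c * f t"
  by (auto simp: ae_eq_def elim: eventually_mono)


section \<open>Lebesgue and Hardy spaces\<close>

lift_definition abs_power_integrable :: "real \<Rightarrow> circle_fun \<Rightarrow> bool"
  is "\<lambda>p f. integrable circle (\<lambda>t. cmod (f t) powr p)"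
proof -
  fix p f g assume "ae_eq f g"
  then show "integrable circle (\<lambda>t. cmod (f t) powr p) = integrable circle (\<lambda>t. cmod (g t) powr p)"
    by (intro integrable_cong_AE) (auto simp: ae_eq_def elim: eventually_mono)
qed

definition Lp :: "real \<Rightarrow> circle_fun set" where
  "Lp p = {f. abs_power_integrable p f}"

lift_definition Lp_norm :: "real \<Rightarrow> circle_fun \<Rightarrow> real"
  is "\<lambda>p f. (LINT t|circle. cmod (f t) powr p) powr (1 / p)"
  by (intro arg_cong2[where f = "(powr)"] integral_cong_AE refl)
     (auto simp: ae_eq_def elim: eventually_mono)

lift_definition ess_bound :: "circle_fun \<Rightarrow> ereal"
  is "\<lambda>f. esssup circle (\<lambda>t. ereal (cmod (f t)))"
  by (intro esssup_AE_cong) (auto simp: ae_eq_def elim: eventually_mono)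

definition Linf :: "circle_fun set" where
  "Linf = {f. ess_bound f < \<infinity>}"

definition Linf_norm :: "circle_fun \<Rightarrow> real" where
  "Linf_norm f = real_of_ereal (ess_bound f)"

lift_definition fourier_coeff :: "circle_fun \<Rightarrow> int \<Rightarrow> complex"
  is "\<lambda>f n. LINT t|circle. f t * t powi (- n)"
proof (rule ext)
  fix f g n assume "ae_eq f g"
  moreover have "(\<lambda>t::complex. t powi (- n)) \<in> borel_measurable circle"
    by (cases "n \<le> 0") (auto simp: power_int_def intro!: borel_measurable_circleI)
  ultimately show "(LINT t|circle. f t * t powi (- n)) = (LINT t|circle. g t * t powi (- n))"
    by (intro integral_cong_AE) (auto simp: ae_eq_def elim: eventually_mono)
qed

definition Hp :: "real \<Rightarrow> circle_fun set" where
  "Hp p = {f \<in> Lp p. \<forall>n<0. fourier_coeff f n = 0}"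


section \<open>Operators\<close>

text \<open>
  Operators are total functions on \<^typ>\<open>circle_fun\<close>, of which only the restriction to
  the space \<open>X\<close> (here \<open>L\<^sup>p\<close> or \<open>H\<^sup>p\<close>, both with the \<open>L\<^sup>p\<close>-norm) is
  relevant. As for \<^const>\<open>onorm\<close>, the norm is a real supremum and is meaningful for
  bounded operators only.
\<close>

definition op_norm :: "real \<Rightarrow> circle_fun set \<Rightarrow> (circle_fun \<Rightarrow> circle_fun) \<Rightarrow> real" where
  "op_norm p X A = (SUP f \<in> {f \<in> X. Lp_norm p f \<le> 1}. Lp_norm p (A f))"

definition linear_on_Hp :: "real \<Rightarrow> (circle_fun \<Rightarrow> circle_fun) \<Rightarrow> bool" where
  "linear_on_Hp p A \<longleftrightarrow>
     A ` Hp p \<subseteq> Hp p \<and>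
     (\<forall>f \<in> Hp p. \<forall>g \<in> Hp p. A (f + g) = A f + A g) \<and>
     (\<forall>c. \<forall>f \<in> Hp p. A (cscale c f) = cscale c (A f))"

definition Hp_topology :: "real \<Rightarrow> circle_fun topology" where
  "Hp_topology p = Metric_space.mtopology (Hp p) (\<lambda>f g. Lp_norm p (f - g))"

definition compact_operator :: "real \<Rightarrow> (circle_fun \<Rightarrow> circle_fun) \<Rightarrow> bool" where
  "compact_operator p K \<longleftrightarrow>
     linear_on_Hp p K \<and>
     compactin (Hp_topology p)
       (Hp_topology p closure_of (K ` {f \<in> Hp p. Lp_norm p f \<le> 1}))"

text \<open>
  The Riesz projection maps \<open>\<Sum>n. f\<^sub>n t\<^sup>n\<close> to \<open>\<Sum>n\<ge>0. f\<^sub>n t\<^sup>n\<close>. That the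
  description below is satisfiable for all \<open>f\<close> in \<open>L\<^sup>p\<close>, \<open>1 < p < \<infinity>\<close>, is M. Riesz's
  theorem.
\<close>

definition riesz :: "real \<Rightarrow> circle_fun \<Rightarrow> circle_fun" where
  "riesz p f = (THE g. g \<in> Hp p \<and> (\<forall>n\<ge>0. fourier_coeff g n = fourier_coeff f n))"

lift_definition flip :: "circle_fun \<Rightarrow> circle_fun" is "\<lambda>f t. cnj t * f (cnj t)"
proof -
  fix f g assume fg: "ae_eq f g"
  then have [measurable]: "f \<in> borel_measurable circle" "g \<in> borel_measurable circle"
    by (auto simp: ae_eq_def)
  have [measurable]: "cnj \<in> borel_measurable circle"
    by (intro borel_measurable_circleI borel_measurable_continuous_onI continuous_intros)
  have "AE t in circle. f (cnj t) = g (cnj t)"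
    using fg by (intro AE_circle_cnj) (simp add: ae_eq_def)
  then show "ae_eq (\<lambda>t. cnj t * f (cnj t)) (\<lambda>t. cnj t * g (cnj t))"
    by (auto simp: ae_eq_def elim: eventually_mono)
qed

definition toeplitz :: "real \<Rightarrow> circle_fun \<Rightarrow> circle_fun \<Rightarrow> circle_fun" where
  "toeplitz p a f = riesz p (a * f)"

definition hankel :: "real \<Rightarrow> circle_fun \<Rightarrow> circle_fun \<Rightarrow> circle_fun" where
  "hankel p b f = riesz p (b * flip f)"

end

theory Submission
  imports Defs "HOL-Complex_Analysis.Conformal_Mappings"
begin

text \<open>
  Write \<open>B = H(b) + K\<close> and \<open>D = T(a) + B\<close>. The upper bound is the triangle inequality together
  with \<open>\<parallel>T(a)\<parallel> \<le> c\<^sub>p \<parallel>a\<parallel>\<^sub>\<infinity>\<close>. For the lower bound it is enough to show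
  \<open>\<parallel>a\<parallel>\<^sub>\<infinity> \<le> \<parallel>D\<parallel>\<close>, since then \<open>\<parallel>B\<parallel> \<le> \<parallel>D\<parallel> + \<parallel>T(a)\<parallel> \<le> (1 + c\<^sub>p) \<parallel>D\<parallel>\<close>.

  The inequality \<open>\<parallel>a\<parallel>\<^sub>\<infinity> \<le> \<parallel>D\<parallel>\<close> comes from pushing a trigonometric polynomial \<open>q\<close> to high
  frequencies. For large \<open>n\<close> the function \<open>t\<^sup>n q\<close> is in \<open>H\<^sup>p\<close> and has the norm of \<open>q\<close>, and
  \<open>D (t\<^sup>n q) = P (t\<^sup>n a q) + P (t\<^sup>-\<^sup>n b Jq) + K (t\<^sup>n q)\<close>.
  The first summand differs from \<open>t\<^sup>n a q\<close> by a null sequence and the second one is a null sequence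
  (\<open>riesz_tpow_limit\<close>); the third one is a null sequence because \<open>K\<close> is compact
  (\<open>compact_operator_vanishes\<close>). Hence \<open>\<parallel>a q\<parallel> \<le> \<parallel>D\<parallel> \<parallel>q\<parallel>\<close>, by density the same holds
  for every element of \<open>L\<^sup>p\<close>, and indicator functions of sets where \<open>\<bar>a\<bar>\<close> is large
  finish the argument (\<open>Linf_norm_le_of_multiplier\<close>).

  All of this rests on M. Riesz's theorem that \<open>P\<close> exists and is bounded on \<open>L\<^sup>p\<close>. It is proved first
  for trigonometric polynomials (\<open>riesz_trig\<close>). For \<open>1 < p \<le> 2\<close> and a positive trigonometric
  polynomial \<open>h\<close> the function \<open>F = 2 P h - h\<^sub>0\<close> is a polynomial in \<open>z\<close> with positive real part
  \<open>h\<close>, and integrating Calderon's inequality \<open>\<bar>F\<bar>\<^sup>p \<le> \<alpha> (Re F)\<^sup>p - \<beta> Re (F\<^sup>p)\<close>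
  with constants \<open>\<alpha>, \<beta> \<ge> 0\<close> gives a bound for \<open>\<parallel>F\<parallel>\<close> in terms of \<open>\<parallel>h\<parallel>\<close>: the last term may be dropped, since \<open>F\<^sup>p\<close> is holomorphic with nonnegative mean. A general polynomial is, up to a
  uniformly small error, a combination of four positive ones; for \<open>p > 2\<close> duality applies. The step to
  \<open>L\<^sup>p\<close> uses the density of trigonometric polynomials (\<open>trig_dense\<close>) and the completeness of
  \<open>L\<^sup>p\<close> (\<open>Lp_complete\<close>), and \<open>P\<close> is well defined because a function in \<open>L\<^sup>p\<close> is determined by
  its Fourier coefficients (\<open>fourier_unique_zero\<close>).
\<close>

section \<open>Hoelder and Minkowski inequalities\<close>

lemma powr_convex_combination:
  fixes x y p s :: real
  assumes "1 \<le> p" "0 \<le> x" "0 \<le> y" "0 \<le> s" "s \<le> 1"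
  shows "((1 - s) * x + s * y) powr p \<le> (1 - s) * x powr p + s * y powr p"
proof -
  have small: "(s * y) powr p \<le> s * y powr p" if "0 \<le> s" "s \<le> 1" "0 \<le> y" for s y :: real
  proof (cases "s = 0")
    case False
    then have "s powr p \<le> s powr 1"
      using that assms(1) by (intro powr_mono') auto
    then show ?thesis using that by (simp add: powr_mult mult_right_mono)
  qed simp
  show ?thesis
  proof (cases "x = 0 \<or> y = 0")
    case True
    then show ?thesis using small[of "1 - s" x] small[of s y] assms by auto
  next
    case False
    then show ?thesis
      using convex_onD[OF powr_convex[OF assms(1)], of s x y] assms by auto
  qed
qed

lemma powr_sum_bound:
  fixes x y p :: real
  assumes "1 \<le> p" "0 \<le> x" "0 \<le> y"
  shows "(x + y) powr p \<le> 2 powr (p - 1) * (x powr p + y powr p)"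
proof -
  have "(x + y) powr p = (2 * ((1 - 1/2) * x + 1/2 * y)) powr p"
    by simp
  also have "\<dots> = 2 powr p * ((1 - 1/2) * x + 1/2 * y) powr p"
    using assms by (intro powr_mult)
  also have "\<dots> \<le> 2 powr p * ((1 - 1/2) * x powr p + 1/2 * y powr p)"
    using assms by (intro mult_left_mono powr_convex_combination) auto
  also have "\<dots> = 2 powr (p - 1) * (x powr p + y powr p)"
    by (simp add: powr_diff algebra_simps)
  finally show ?thesis .
qed

lemma powr_integrable_add:
  fixes f g :: "'a \<Rightarrow> complex"
  assumes "1 \<le> p" and [measurable]: "f \<in> borel_measurable M" "g \<in> borel_measurable M"
    and "integrable M (\<lambda>x. cmod (f x) powr p)" "integrable M (\<lambda>x. cmod (g x) powr p)"
  shows "integrable M (\<lambda>x. cmod (f x + g x) powr p)"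
proof (rule Bochner_Integration.integrable_bound)
  show "integrable M (\<lambda>x. 2 powr (p - 1) * (cmod (f x) powr p + cmod (g x) powr p))"
    using assms by (intro integrable_mult_right Bochner_Integration.integrable_add) auto
  have "cmod (f x + g x) powr p \<le> 2 powr (p - 1) * (cmod (f x) powr p + cmod (g x) powr p)" for x
  proof -
    have "cmod (f x + g x) powr p \<le> (cmod (f x) + cmod (g x)) powr p"
      using assms by (intro powr_mono2 norm_triangle_ineq) auto
    then show ?thesis using powr_sum_bound[OF assms(1), of "cmod (f x)" "cmod (g x)"] by simp
  qed
  then show "AE x in M. norm (cmod (f x + g x) powr p)
      \<le> norm (2 powr (p - 1) * (cmod (f x) powr p + cmod (g x) powr p))"
    by auto
qed measurable

text \<open>Dividing by a number \<open>A\<close> strictly above the norm, instead of by the norm itself, spares a case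
  distinction for functions of norm zero in the proofs of the two inequalities below.\<close>

lemma powr_le_of_root_less:
  fixes I A p :: real
  assumes "0 < p" "0 \<le> I" "I powr (1 / p) < A"
  shows "I / A powr p \<le> 1"
proof -
  have A: "0 < A" using assms(3) powr_ge_zero[of I "1/p"] by linarith
  have "(I powr (1 / p)) powr p \<le> A powr p"
    using assms by (intro powr_mono2) auto
  then have "I \<le> A powr p" using assms by (simp add: powr_powr)
  then show ?thesis using A by simp
qed

text \<open>Write \<open>\<bar>f\<bar> + \<bar>g\<bar>\<close> as \<open>A + B\<close> times a convex combination of \<open>\<bar>f\<bar> / A\<close> and \<open>\<bar>g\<bar> / B\<close>,
  where \<open>A\<close> and \<open>B\<close> are slightly larger than the two norms, and use the convexity of \<open>x\<^sup>p\<close>.\<close>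

lemma minkowski:
  fixes f g :: "'a \<Rightarrow> complex"
  assumes p: "1 \<le> p" and [measurable]: "f \<in> borel_measurable M" "g \<in> borel_measurable M"
    and int: "integrable M (\<lambda>x. cmod (f x) powr p)" "integrable M (\<lambda>x. cmod (g x) powr p)"
  shows "(LINT x|M. cmod (f x + g x) powr p) powr (1 / p)
    \<le> (LINT x|M. cmod (f x) powr p) powr (1 / p) + (LINT x|M. cmod (g x) powr p) powr (1 / p)"
    (is "?S \<le> ?a + ?b")
proof (rule field_le_epsilon)
  fix e :: real assume e: "0 < e"
  define A B where "A = ?a + e / 2" and "B = ?b + e / 2"
  have A: "0 < A" "?a < A" and B: "0 < B" "?b < B"
    using e unfolding A_def B_def by (auto intro: add_nonneg_pos)
  let ?s = "B / (A + B)"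
  have s: "0 \<le> ?s" "?s \<le> 1" "1 - ?s = A / (A + B)"
    using A B by (auto simp: field_simps)
  have ptw: "cmod (f x + g x) powr p
      \<le> (A + B) powr p * ((1 - ?s) * (cmod (f x) powr p / A powr p) + ?s * (cmod (g x) powr p / B powr p))"
    for x
  proof -
    have "(A + B) * ((1 - ?s) * (cmod (f x) / A) + ?s * (cmod (g x) / B)) = cmod (f x) + cmod (g x)"
      using A B unfolding s(3) distrib_left by simp
    then have "cmod (f x + g x) \<le> (A + B) * ((1 - ?s) * (cmod (f x) / A) + ?s * (cmod (g x) / B))"
      using norm_triangle_ineq[of "f x" "g x"] by simp
    then have "cmod (f x + g x) powr p
        \<le> ((A + B) * ((1 - ?s) * (cmod (f x) / A) + ?s * (cmod (g x) / B))) powr p"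
      using p by (intro powr_mono2) auto
    also have "\<dots> = (A + B) powr p * ((1 - ?s) * (cmod (f x) / A) + ?s * (cmod (g x) / B)) powr p"
      using A B s by (intro powr_mult)
    also have "\<dots> \<le> (A + B) powr p *
        ((1 - ?s) * (cmod (f x) / A) powr p + ?s * (cmod (g x) / B) powr p)"
      using p A B s(1,2) by (intro mult_left_mono powr_convex_combination) auto
    finally show ?thesis using A B by (simp add: powr_divide)
  qed
  have "(LINT x|M. cmod (f x + g x) powr p)
      \<le> (LINT x|M. (A + B) powr p * ((1 - ?s) * (cmod (f x) powr p / A powr p) + ?s * (cmod (g x) powr p / B powr p)))"
    using int by (intro integral_mono powr_integrable_add p ptw) auto
  also have "\<dots> = (A + B) powr p * ((1 - ?s) * ((LINT x|M. cmod (f x) powr p) / A powr p)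
      + ?s * ((LINT x|M. cmod (g x) powr p) / B powr p))"
    using int by simp
  also have "\<dots> \<le> (A + B) powr p * ((1 - ?s) * 1 + ?s * 1)"
    using p A B s by (intro mult_left_mono add_mono powr_le_of_root_less) auto
  finally have "(LINT x|M. cmod (f x + g x) powr p) \<le> (A + B) powr p" by simp
  then have "?S \<le> ((A + B) powr p) powr (1 / p)"
    using p by (intro powr_mono2) auto
  also have "\<dots> = A + B" using p A B by (simp add: powr_powr)
  finally show "?S \<le> ?a + ?b + e" by (simp add: A_def B_def)
qed

text \<open>Integrate Young's inequality for \<open>\<bar>f\<bar> / A\<close> and \<open>\<bar>g\<bar> / B\<close> with \<open>A\<close> and \<open>B\<close> slightly larger
  than the two norms, and let them tend to the norms.\<close>

lemma hoelder:
  fixes f g :: "'a \<Rightarrow> complex"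
  assumes pq: "1 < p" "1 < q" "1 / p + 1 / q = 1"
    and [measurable]: "f \<in> borel_measurable M" "g \<in> borel_measurable M"
    and int: "integrable M (\<lambda>x. cmod (f x) powr p)" "integrable M (\<lambda>x. cmod (g x) powr q)"
  shows "integrable M (\<lambda>x. f x * g x)"
    and "cmod (LINT x|M. f x * g x)
      \<le> (LINT x|M. cmod (f x) powr p) powr (1 / p) * (LINT x|M. cmod (g x) powr q) powr (1 / q)"
proof -
  have young: "cmod (f x * g x) \<le> A * B * (cmod (f x) powr p / A powr p / p + cmod (g x) powr q / B powr q / q)"
    if "0 < A" "0 < B" for A B x
    using Youngs_inequality[OF pq, of "cmod (f x) / A" "cmod (g x) / B"] that
    by (simp add: powr_divide norm_mult field_simps)
  show prod: "integrable M (\<lambda>x. f x * g x)"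
  proof (rule Bochner_Integration.integrable_bound)
    show "integrable M (\<lambda>x. cmod (f x) powr p / p + cmod (g x) powr q / q)" using int by auto
    show "AE x in M. norm (f x * g x) \<le> norm (cmod (f x) powr p / p + cmod (g x) powr q / q)"
      using young[of 1 1] pq by auto
  qed measurable
  let ?a = "(LINT x|M. cmod (f x) powr p) powr (1 / p)"
  let ?b = "(LINT x|M. cmod (g x) powr q) powr (1 / q)"
  have le: "cmod (LINT x|M. f x * g x) \<le> (?a + e) * (?b + e)" if e: "0 < e" for e
  proof -
    define A B where "A = ?a + e" and "B = ?b + e"
    have A: "0 < A" "?a < A" and B: "0 < B" "?b < B"
      using e unfolding A_def B_def by (auto intro: add_nonneg_pos)
    have "cmod (LINT x|M. f x * g x) \<le> (LINT x|M. cmod (f x * g x))" by (rule integral_norm_bound)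
    also have "\<dots> \<le> (LINT x|M. A * B * (cmod (f x) powr p / A powr p / p + cmod (g x) powr q / B powr q / q))"
      using int prod A B by (intro integral_mono young integrable_norm) auto
    also have "\<dots> = A * B * ((LINT x|M. cmod (f x) powr p) / A powr p / p
        + (LINT x|M. cmod (g x) powr q) / B powr q / q)"
      using int by simp
    also have "\<dots> \<le> A * B * (1 / p + 1 / q)"
      using pq A B by (intro mult_left_mono add_mono divide_right_mono powr_le_of_root_less) auto
    finally show ?thesis using pq by (simp add: A_def B_def)
  qed
  have "((\<lambda>e. (?a + e) * (?b + e)) \<longlongrightarrow> (?a + 0) * (?b + 0)) (at_right 0)"
    by (intro tendsto_intros)
  then show "cmod (LINT x|M. f x * g x) \<le> ?a * ?b"
    by (intro tendsto_lowerbound[where F = "at_right (0::real)"])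
       (auto simp: eventually_at_right_field intro!: exI[of _ 1] le)
qed

section \<open>The spaces \<open>L\<^sup>p\<close> of classes of functions\<close>

interpretation circle: prob_space circle by (rule prob_space_circle)

lemma prob_sphere [simp]: "measure circle (sphere 0 1) = 1"
  using circle.prob_space by simp

text \<open>Every element of the quotient type is the class of a measurable
  function, so that all operations can be computed on representatives.\<close>

abbreviation cf :: "(complex \<Rightarrow> complex) \<Rightarrow> circle_fun" where "cf \<equiv> abs_circle_fun"

lemma ae_eq_refl_iff: "ae_eq f f \<longleftrightarrow> f \<in> borel_measurable circle"
  by (auto simp: ae_eq_def)

lemma cf_cases:
  obtains f where "f \<in> borel_measurable circle" "x = cf f"
proof -
  show thesis
    using Quotient_rep_reflp[OF Quotient_circle_fun, of x] Quotient_abs_rep[OF Quotient_circle_fun, of x]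
      that[of "rep_circle_fun x"] by (simp add: ae_eq_refl_iff)
qed

lemma cf_eq_iff:
  assumes "f \<in> borel_measurable circle" "g \<in> borel_measurable circle"
  shows "cf f = cf g \<longleftrightarrow> (AE t in circle. f t = g t)"
  using assms Quotient_rel[OF Quotient_circle_fun, of f g] by (simp add: ae_eq_def)

lemma
  assumes [measurable]: "f \<in> borel_measurable circle" and [measurable]: "g \<in> borel_measurable circle"
  shows cf_add: "cf f + cf g = cf (\<lambda>t. f t + g t)"
    and cf_diff: "cf f - cf g = cf (\<lambda>t. f t - g t)"
    and cf_mult: "cf f * cf g = cf (\<lambda>t. f t * g t)"
  using plus_circle_fun.abs_eq[of f g] minus_circle_fun.abs_eq[of f g] times_circle_fun.abs_eq[of f g]
  by (simp_all add: ae_eq_refl_iff)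

lemma
  assumes [measurable]: "f \<in> borel_measurable circle"
  shows cscale_cf: "cscale c (cf f) = cf (\<lambda>t. c * f t)"
    and flip_cf: "flip (cf f) = cf (\<lambda>t. cnj t * f (cnj t))"
    and cf_in_Lp_iff: "cf f \<in> Lp p \<longleftrightarrow> integrable circle (\<lambda>t. cmod (f t) powr p)"
    and Lp_norm_cf: "Lp_norm p (cf f) = (LINT t|circle. cmod (f t) powr p) powr (1 / p)"
    and ess_bound_cf: "ess_bound (cf f) = esssup circle (\<lambda>t. ereal (cmod (f t)))"
    and fourier_coeff_cf: "fourier_coeff (cf f) n = (LINT t|circle. f t * t powi (- n))"
  using cscale.abs_eq[of f c] flip.abs_eq[of f]
    abs_power_integrable.abs_eq[of f p] Lp_norm.abs_eq[of f p] ess_bound.abs_eq[of f]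
    fourier_coeff.abs_eq[of f]
  by (simp_all add: ae_eq_refl_iff Lp_def)

lemma cf_zero: "0 = cf (\<lambda>_. 0)"
  by (simp add: zero_circle_fun_def)

lemma cscale_add: "cscale c (x + y) = cscale c x + cscale c y"
  and cscale_diff: "cscale c (x - y) = cscale c x - cscale c y"
  and cscale_add_left: "cscale (c + d) x = cscale c x + cscale d x"
  and cscale_cscale: "cscale c (cscale d x) = cscale (c * d) x"
  and cscale_one [simp]: "cscale 1 x = x"
  and cscale_zero_left [simp]: "cscale 0 x = 0"
  and cscale_zero [simp]: "cscale c 0 = 0"
  and mult_cscale: "x * cscale c y = cscale c (x * y)"
  and cscale_minus_one: "cscale (-1) x = - x"
  by (transfer, force simp: ae_eq_def algebra_simps)+

lemma cscale_sum: "cscale c (\<Sum>i\<in>I. f i) = (\<Sum>i\<in>I. cscale c (f i))"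
  by (induction I rule: infinite_finite_induct) (auto simp: cscale_add)

lemma Lp_norm_nonneg [simp]: "0 \<le> Lp_norm p x"
  by (cases x rule: cf_cases) (simp add: Lp_norm_cf)

lemma Lp_norm_powr_cf:
  assumes "0 < p" "f \<in> borel_measurable circle"
  shows "Lp_norm p (cf f) powr p = (LINT t|circle. cmod (f t) powr p)"
  using assms by (simp add: Lp_norm_cf powr_powr)

lemma Lp_zero [simp]: "0 \<in> Lp p" and Lp_norm_zero [simp]: "Lp_norm p 0 = 0"
  by (simp_all add: cf_zero cf_in_Lp_iff Lp_norm_cf)

lemma Lp_add: "1 \<le> p \<Longrightarrow> x \<in> Lp p \<Longrightarrow> y \<in> Lp p \<Longrightarrow> x + y \<in> Lp p"
  by (cases x rule: cf_cases; cases y rule: cf_cases)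
     (auto simp: cf_add cf_in_Lp_iff intro: powr_integrable_add)

lemma Lp_norm_triangle:
  "1 \<le> p \<Longrightarrow> x \<in> Lp p \<Longrightarrow> y \<in> Lp p \<Longrightarrow> Lp_norm p (x + y) \<le> Lp_norm p x + Lp_norm p y"
  by (cases x rule: cf_cases; cases y rule: cf_cases)
     (auto simp: cf_add cf_in_Lp_iff Lp_norm_cf intro: minkowski)

lemma Lp_cscale: "x \<in> Lp p \<Longrightarrow> cscale c x \<in> Lp p"
  by (cases x rule: cf_cases) (auto simp: cscale_cf cf_in_Lp_iff norm_mult powr_mult)

lemma Lp_norm_cscale: "0 < p \<Longrightarrow> Lp_norm p (cscale c x) = cmod c * Lp_norm p x"
  by (cases x rule: cf_cases)
     (auto simp: cscale_cf Lp_norm_cf norm_mult powr_mult powr_powr)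

lemma Lp_uminus: "x \<in> Lp p \<Longrightarrow> - x \<in> Lp p"
  using Lp_cscale[of x p "-1"] by (simp add: cscale_minus_one)

lemma Lp_norm_uminus: "0 < p \<Longrightarrow> Lp_norm p (- x) = Lp_norm p x"
  using Lp_norm_cscale[of p "-1" x] by (simp add: cscale_minus_one)

lemma Lp_diff: "1 \<le> p \<Longrightarrow> x \<in> Lp p \<Longrightarrow> y \<in> Lp p \<Longrightarrow> x - y \<in> Lp p"
  using Lp_add[of p x "- y"] Lp_uminus by simp

lemma Lp_norm_diff_le:
  "1 \<le> p \<Longrightarrow> x \<in> Lp p \<Longrightarrow> y \<in> Lp p \<Longrightarrow> Lp_norm p (x - y) \<le> Lp_norm p x + Lp_norm p y"
  using Lp_norm_triangle[of p x "- y"] Lp_norm_uminus[of p y] Lp_uminus by simp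

lemma Lp_norm_minus_commute: "0 < p \<Longrightarrow> Lp_norm p (x - y) = Lp_norm p (y - x)"
  using Lp_norm_uminus[of p "x - y"] by simp

lemma Lp_norm_triangle_diff:
  "1 \<le> p \<Longrightarrow> x \<in> Lp p \<Longrightarrow> y \<in> Lp p \<Longrightarrow> z \<in> Lp p \<Longrightarrow> Lp_norm p (x - z) \<le> Lp_norm p (x - y) + Lp_norm p (y - z)"
  using Lp_norm_triangle[of p "x - y" "y - z"] Lp_diff by simp

lemma Lp_sum: "1 \<le> p \<Longrightarrow> (\<And>i. i \<in> I \<Longrightarrow> f i \<in> Lp p) \<Longrightarrow> (\<Sum>i\<in>I. f i) \<in> Lp p"
  by (induction I rule: infinite_finite_induct) (auto intro: Lp_add)

lemma Lp_norm_sum: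
  "1 \<le> p \<Longrightarrow> (\<And>i. i \<in> I \<Longrightarrow> f i \<in> Lp p) \<Longrightarrow> Lp_norm p (\<Sum>i\<in>I. f i) \<le> (\<Sum>i\<in>I. Lp_norm p (f i))"
proof (induction I rule: infinite_finite_induct)
  case (insert i I)
  then have "Lp_norm p (f i + sum f I) \<le> Lp_norm p (f i) + Lp_norm p (sum f I)"
    by (intro Lp_norm_triangle Lp_sum) auto
  with insert show ?case by fastforce
qed auto

lemma Lp_norm_eq_zero_iff:
  assumes "1 \<le> p" "x \<in> Lp p"
  shows "Lp_norm p x = 0 \<longleftrightarrow> x = 0"
proof (cases x rule: cf_cases)
  case (1 f)
  note [measurable] = 1(1)
  have "Lp_norm p x = 0 \<longleftrightarrow> (LINT t|circle. cmod (f t) powr p) = 0"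
    using 1 by (simp add: Lp_norm_cf)
  also have "\<dots> \<longleftrightarrow> (AE t in circle. cmod (f t) powr p = 0)"
    using assms 1 by (intro integral_nonneg_eq_0_iff_AE) (auto simp: cf_in_Lp_iff)
  also have "\<dots> \<longleftrightarrow> x = 0" using 1 by (simp add: cf_zero cf_eq_iff)
  finally show ?thesis .
qed

text \<open>Estimates for bounded functions, for products with bounded functions and for dominated sequences
  are all instances of this comparison.\<close>

lemma cf_Lp_mono:
  assumes "0 < p" and [measurable]: "f \<in> borel_measurable circle" "g \<in> borel_measurable circle"
    and "AE t in circle. cmod (f t) \<le> cmod (g t)" "cf g \<in> Lp p"
  shows "cf f \<in> Lp p" "Lp_norm p (cf f) \<le> Lp_norm p (cf g)"
proof -
  have le: "AE t in circle. cmod (f t) powr p \<le> cmod (g t) powr p"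
    using assms(4) by eventually_elim (use assms in \<open>auto intro: powr_mono2\<close>)
  have g: "integrable circle (\<lambda>t. cmod (g t) powr p)" using assms by (simp add: cf_in_Lp_iff)
  have f: "integrable circle (\<lambda>t. cmod (f t) powr p)"
    using le by (intro Bochner_Integration.integrable_bound[OF g]) auto
  then show "cf f \<in> Lp p" by (simp add: cf_in_Lp_iff)
  show "Lp_norm p (cf f) \<le> Lp_norm p (cf g)"
    unfolding Lp_norm_cf[OF assms(2)] Lp_norm_cf[OF assms(3)]
    using assms(1) f g le by (intro powr_mono2 integral_mono_AE) auto
qed

lemma const_Lp: "cf (\<lambda>_. c) \<in> Lp p" and Lp_norm_const: "0 < p \<Longrightarrow> Lp_norm p (cf (\<lambda>_. c)) = cmod c"
  by (simp_all add: cf_in_Lp_iff Lp_norm_cf powr_powr)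

lemma bounded_Lp:
  assumes "0 < p" and [measurable]: "f \<in> borel_measurable circle"
    and "AE t in circle. cmod (f t) \<le> B"
  shows "cf f \<in> Lp p" "Lp_norm p (cf f) \<le> \<bar>B\<bar>"
proof -
  have "AE t in circle. cmod (f t) \<le> cmod (complex_of_real B)"
    using assms(3) by eventually_elim simp
  from cf_Lp_mono[OF assms(1,2) _ this const_Lp] Lp_norm_const[OF assms(1), of B]
  show "cf f \<in> Lp p" "Lp_norm p (cf f) \<le> \<bar>B\<bar>" by auto
qed

lemma Linf_norm_AE:
  assumes "f \<in> borel_measurable circle" "cf f \<in> Linf"
  shows "AE t in circle. cmod (f t) \<le> Linf_norm (cf f)" and "0 \<le> Linf_norm (cf f)"
    and "ess_bound (cf f) = ereal (Linf_norm (cf f))"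
proof -
  have AE: "AE t in circle. ereal (cmod (f t)) \<le> ess_bound (cf f)"
    unfolding ess_bound_cf[OF assms(1)] by (rule esssup_AE)
  then have "\<exists>t. ereal (cmod (f t)) \<le> ess_bound (cf f)"
    using circle.AE_E_prob by (metis (mono_tags, lifting) AE_E2 circle.AE_False eventually_mono)
  then have ge: "0 \<le> ess_bound (cf f)" by (metis ereal_less_eq(5) norm_ge_zero order_trans)
  moreover have "ess_bound (cf f) < \<infinity>" using assms(2) by (simp add: Linf_def)
  ultimately show eq: "ess_bound (cf f) = ereal (Linf_norm (cf f))"
    unfolding Linf_norm_def by (cases "ess_bound (cf f)") auto
  show "AE t in circle. cmod (f t) \<le> Linf_norm (cf f)" using AE unfolding eq by simp
  show "0 \<le> Linf_norm (cf f)" using ge unfolding eq by simp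
qed

lemma Linf_norm_nonneg: "a \<in> Linf \<Longrightarrow> 0 \<le> Linf_norm a"
  by (cases a rule: cf_cases) (simp add: Linf_norm_AE)

lemma Linf_mult_Lp:
  assumes "0 < p" "a \<in> Linf" "x \<in> Lp p"
  shows "a * x \<in> Lp p" "Lp_norm p (a * x) \<le> Linf_norm a * Lp_norm p x"
proof -
  obtain f where f [measurable]: "f \<in> borel_measurable circle" and a: "a = cf f" by (rule cf_cases)
  obtain g where g [measurable]: "g \<in> borel_measurable circle" and x: "x = cf g" by (rule cf_cases)
  let ?B = "Linf_norm a"
  have "AE t in circle. cmod (f t * g t) \<le> cmod (complex_of_real ?B * g t)"
    using Linf_norm_AE(1)[OF f assms(2)[unfolded a]]
    by eventually_elim (simp add: norm_mult mult_right_mono a)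
  from cf_Lp_mono[OF assms(1) _ _ this] assms
  show "a * x \<in> Lp p" "Lp_norm p (a * x) \<le> Linf_norm a * Lp_norm p x"
    using Lp_cscale[of x p ?B] Lp_norm_cscale[of p ?B x] Linf_norm_nonneg[OF assms(2)]
    by (simp_all add: a x cf_mult cscale_cf)
qed

text \<open>The circle has finite measure and \<open>x \<le> 1 + x\<^sup>p\<close> for \<open>x \<ge> 0\<close>.\<close>

lemma Lp_imp_integrable:
  assumes "1 \<le> p" and [measurable]: "f \<in> borel_measurable circle" and "cf f \<in> Lp p"
  shows "integrable circle f"
proof (rule Bochner_Integration.integrable_bound)
  show "integrable circle (\<lambda>t. 1 + cmod (f t) powr p)"
    using assms by (simp add: cf_in_Lp_iff)
  have "cmod (f t) \<le> 1 + cmod (f t) powr p" for t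
  proof (cases "cmod (f t) \<le> 1")
    case False
    then have "cmod (f t) powr 1 \<le> cmod (f t) powr p" using assms by (intro powr_mono) auto
    with False show ?thesis by simp
  qed (simp add: add_increasing2)
  then show "AE t in circle. norm (f t) \<le> norm (1 + cmod (f t) powr p)"
    by (simp add: add_nonneg_nonneg)
qed measurable

section \<open>Integration over the circle\<close>

lemma continuous_circle_measurable:
  "continuous_on (sphere 0 1) f \<Longrightarrow> f \<in> borel_measurable circle"
  unfolding measurable_cong_sets[OF sets_circle refl]
  by (rule borel_measurable_continuous_on_restrict)

lemma integral_circle:
  fixes f :: "complex \<Rightarrow> complex"
  assumes f: "f \<in> borel_measurable circle"
  shows "(LINT t|circle. f t) = (LINT \<theta>:{-pi..pi}|lborel. f (cis \<theta>)) / (2 * pi)"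
proof -
  have f': "f \<in> borel_measurable (restrict_space borel (sphere 0 1))"
    using f by (simp add: measurable_cong_sets[OF sets_circle refl])
  have m: "cis \<in> lborel \<rightarrow>\<^sub>M restrict_space borel (sphere 0 1)"
    using cis_measurable_circle by (simp add: measurable_cong_sets[OF sets_uniform_measure refl])
  have dens: "uniform_measure lborel {-pi..pi} = density lborel (\<lambda>x. ennreal (indicator {-pi..pi} x / (2 * pi)))"
    unfolding uniform_measure_def
    by (intro arg_cong2[where f = density] ext)
       (auto simp: indicator_def divide_ennreal[symmetric] simp flip: ennreal_1)
  have "(LINT t|circle. f t) = (LINT \<theta>|uniform_measure lborel {-pi..pi}. f (cis \<theta>))"
    unfolding circle_def by (rule integral_distr[OF cis_measurable_circle f'])
  also have "\<dots> = (LINT \<theta>|lborel. (indicator {-pi..pi} \<theta> / (2 * pi)) *\<^sub>R f (cis \<theta>))"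
    unfolding dens by (rule integral_density[OF measurable_compose[OF m f']]) auto
  also have "\<dots> = (LINT \<theta>|lborel. (indicator {-pi..pi} \<theta> *\<^sub>R f (cis \<theta>)) * (1 / (2 * pi)))"
    by (intro Bochner_Integration.integral_cong) (auto simp: indicator_def scaleR_conv_of_real)
  finally show ?thesis by (simp add: set_lebesgue_integral_def)
qed

text \<open>Cauchy's integral formula at the centre of the disc. It is applied to \<open>h (- z)\<close>, because
  \<open>circlepath\<close> runs over the angles in \<open>[0, 2 \<pi>]\<close> and the measure is defined through
  \<open>[- \<pi>, \<pi>]\<close>; the change of sign shifts angles by \<open>\<pi>\<close>.\<close>

lemma circle_mean_value:
  assumes cont: "continuous_on (cball 0 1) h" and hol: "h holomorphic_on ball 0 1"
  shows "(LINT t|circle. h t) = h 0"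
proof -
  define k where "k = (\<lambda>z. h (- z))"
  have "((\<lambda>u. k u / (u - 0)) has_contour_integral (2 * of_real pi * \<i> * k 0)) (circlepath 0 1)"
  proof (rule Cauchy_integral_circlepath)
    show "continuous_on (cball 0 1) k" unfolding k_def
      by (rule continuous_on_compose2[OF cont]) (auto intro!: continuous_intros)
    show "k holomorphic_on ball 0 1" unfolding k_def
      by (rule holomorphic_on_compose_gen[of uminus "ball 0 1" h "ball 0 1", unfolded o_def])
         (auto intro!: holomorphic_intros hol)
  qed auto
  then have "((\<lambda>t. k (cis t) / cis t * \<i> * cis t) has_integral (2 * of_real pi * \<i> * h 0)) {0..2 * pi}"
    unfolding circlepath_def by (subst (asm) has_contour_integral_part_circlepath_iff) (auto simp: k_def)
  then have "((\<lambda>t. k (cis t) * \<i>) has_integral (2 * of_real pi * \<i> * h 0)) {0..2 * pi}"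
    by simp
  from has_integral_mult_left[OF this, of "- \<i>"]
  have "((\<lambda>t. k (cis t) * \<i> * - \<i>) has_integral (2 * of_real pi * \<i> * h 0 * - \<i>)) (cbox 0 (2 * pi))"
    by simp
  also have "(\<lambda>t. k (cis t) * \<i> * - \<i>) = (\<lambda>t. k (cis t))" by (simp add: mult.assoc)
  also have "2 * of_real pi * \<i> * h 0 * - \<i> = 2 * of_real pi * h 0"
    by (simp add: mult_ac)
  finally have "((\<lambda>t. k (cis t)) has_integral (2 * of_real pi * h 0)) (cbox 0 (2 * pi))" .
  from has_integral_affinity'[OF this, of 1 pi]
  have "((\<lambda>t. k (cis (t + pi))) has_integral (2 * of_real pi * h 0)) {-pi..pi}"
    by simp
  moreover have "k (cis (t + pi)) = h (cis t)" for t
    by (simp add: k_def cis_mult[symmetric])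
  ultimately have int: "((\<lambda>t. h (cis t)) has_integral (2 * of_real pi * h 0)) {-pi..pi}" by simp
  have cont_sphere: "continuous_on (sphere 0 1) h"
    using cont by (rule continuous_on_subset) auto
  have cc: "continuous_on {-pi..pi} (\<lambda>t. h (cis t))"
    by (rule continuous_on_compose2[OF cont_sphere]) (auto intro!: continuous_intros)
  have "(LINT t|circle. h t) = (LINT \<theta>:{-pi..pi}|lborel. h (cis \<theta>)) / (2 * pi)"
    by (intro integral_circle continuous_circle_measurable cont_sphere)
  also have "(LINT \<theta>:{-pi..pi}|lborel. h (cis \<theta>)) = 2 * of_real pi * h 0"
    using set_borel_integral_eq_integral(2)[OF borel_integrable_atLeastAtMost'[OF cc]] int
    by (simp add: integral_unique)
  finally show ?thesis by simp
qed

lemma continuous_powi_sphere [continuous_intros]: "continuous_on (sphere 0 1) (\<lambda>t::complex. t powi n)"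
  by (intro continuous_intros) auto

lemma powi_measurable_circle [measurable]: "(\<lambda>t::complex. t powi n) \<in> borel_measurable circle"
  by (intro continuous_circle_measurable continuous_intros)

text \<open>Nonnegative powers are covered by the mean value property, negative ones are their conjugates
  on the circle.\<close>

lemma integral_circle_powi: "(LINT t|circle. t powi n) = (if n = 0 then 1 else 0)"
proof -
  have nonneg: "(LINT t|circle. t ^ k) = (if k = 0 then 1 else 0)" for k
    by (subst circle_mean_value) (auto intro!: continuous_intros holomorphic_intros)
  show ?thesis
  proof (cases "0 \<le> n")
    case True
    then show ?thesis using nonneg[of "nat n"] by (simp add: power_int_def)
  next
    case False
    have "(LINT t|circle. t powi n) = (LINT t|circle. cnj (t ^ nat (- n)))"
      using False by (intro Bochner_Integration.integral_cong)
        (auto simp: power_int_def divide_conv_cnj[of _ 1, simplified] field_simps inverse_eq_divide)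
    also have "\<dots> = cnj (LINT t|circle. t ^ nat (- n))" by (rule Bochner_Integration.integral_cnj)
    finally show ?thesis using nonneg[of "nat (- n)"] False by simp
  qed
qed

lemma continuous_circle_bounded:
  assumes "continuous_on (sphere 0 1) f"
  obtains B where "\<And>t::complex. t \<in> sphere 0 1 \<Longrightarrow> cmod (f t) \<le> B"
proof -
  have "bounded (f ` sphere 0 1)"
    by (intro compact_imp_bounded compact_continuous_image assms compact_sphere)
  then show thesis using that unfolding bounded_iff by blast
qed

lemma continuous_circle_integrable:
  fixes f :: "complex \<Rightarrow> complex"
  assumes "continuous_on (sphere 0 1) f"
  shows "integrable circle f"
proof -
  obtain B where "\<And>t. t \<in> sphere 0 1 \<Longrightarrow> cmod (f t) \<le> B"
    using continuous_circle_bounded[OF assms] by blast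
  then show ?thesis
    using continuous_circle_measurable[OF assms]
    by (intro circle.integrable_const_bound[of _ B]) auto
qed

lemma continuous_Lp:
  assumes "0 < p" "continuous_on (sphere 0 1) f"
  shows "cf f \<in> Lp p"
proof -
  obtain B where "\<And>t. t \<in> sphere 0 1 \<Longrightarrow> cmod (f t) \<le> B"
    using continuous_circle_bounded[OF assms(2)] by blast
  then show ?thesis
    using continuous_circle_measurable[OF assms(2)] assms(1) by (intro bounded_Lp(1)[of _ _ B]) auto
qed

section \<open>Trigonometric polynomials\<close>

text \<open>Frequency sets are kept explicit: the analytic part of a trigonometric polynomial is obtained
  by cutting down \<open>S\<close>, with the same coefficients.\<close>

definition tp :: "int set \<Rightarrow> (int \<Rightarrow> complex) \<Rightarrow> complex \<Rightarrow> complex" where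
  "tp S c t = (\<Sum>n\<in>S. c n * t powi n)"

lemma continuous_tp [continuous_intros]: "continuous_on (sphere 0 1) (tp S c)"
  unfolding tp_def by (intro continuous_intros) auto

lemma tp_measurable [measurable]: "tp S c \<in> borel_measurable circle"
  by (intro continuous_circle_measurable continuous_intros)

lemma tp_Lp: "0 < p \<Longrightarrow> cf (tp S c) \<in> Lp p"
  by (intro continuous_Lp continuous_intros)

lemma powi_add_circle: "t \<in> sphere 0 1 \<Longrightarrow> (t::complex) powi (m + n) = t powi m * t powi n"
  by (subst power_int_add) auto

lemma cnj_powi_circle: "t \<in> sphere 0 1 \<Longrightarrow> cnj (t::complex) powi n = t powi (- n)"
  by (simp add: power_int_minus flip: power_int_inverse)
     (metis complex_norm_square inverse_unique mult.commute norm_one of_real_1 one_power2 power_one)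

lemma fourier_coeff_tp:
  assumes "finite S"
  shows "fourier_coeff (cf (tp S c)) n = (if n \<in> S then c n else 0)"
proof -
  have "fourier_coeff (cf (tp S c)) n = (LINT t|circle. tp S c t * t powi (- n))"
    by (simp add: fourier_coeff_cf)
  also have "\<dots> = (LINT t|circle. (\<Sum>m\<in>S. c m * t powi (m - n)))"
    by (intro Bochner_Integration.integral_cong)
       (auto simp: tp_def sum_distrib_right powi_add_circle[of _ _ "-n", simplified] mult.assoc)
  also have "\<dots> = (\<Sum>m\<in>S. LINT t|circle. c m * t powi (m - n))"
    by (intro Bochner_Integration.integral_sum continuous_circle_integrable continuous_intros) auto
  also have "\<dots> = (\<Sum>m\<in>S. if m = n then c n else 0)"
    by (intro sum.cong) (auto simp: integral_circle_powi)
  also have "\<dots> = (if n \<in> S then c n else 0)" using assms by (simp add: sum.delta)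
  finally show ?thesis .
qed

lemma parseval_tp:
  assumes "finite S"
  shows "(LINT t|circle. (cmod (tp S c t))\<^sup>2) = (\<Sum>n\<in>S. (cmod (c n))\<^sup>2)"
proof -
  have "complex_of_real (LINT t|circle. (cmod (tp S c t))\<^sup>2) = (LINT t|circle. tp S c t * cnj (tp S c t))"
    by (simp flip: integral_complex_of_real complex_norm_square)
  also have "\<dots> = (LINT t|circle. (\<Sum>n\<in>S. cnj (c n) * (tp S c t * t powi (- n))))"
    by (intro Bochner_Integration.integral_cong refl)
       (auto simp: tp_def[of _ _ "_"] cnj_powi_circle sum_distrib_left mult_ac)
  also have "\<dots> = (\<Sum>n\<in>S. cnj (c n) * fourier_coeff (cf (tp S c)) n)"
    by (subst Bochner_Integration.integral_sum)
       (auto simp: fourier_coeff_cf intro!: continuous_circle_integrable continuous_intros)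
  also have "\<dots> = (\<Sum>n\<in>S. complex_of_real ((cmod (c n))\<^sup>2))"
    using assms by (intro sum.cong) (auto simp: fourier_coeff_tp complex_norm_square[symmetric] mult.commute)
  finally show ?thesis by (simp only: of_real_sum[symmetric] of_real_eq_iff)
qed

text \<open>Trigonometric polynomials are compared on the circle only; there they form an algebra, and
  \<open>cnj t\<close> counts as one of them.\<close>

definition trig :: "(complex \<Rightarrow> complex) \<Rightarrow> bool" where
  "trig f \<longleftrightarrow> (\<exists>S c. finite S \<and> (\<forall>t\<in>sphere 0 1. f t = tp S c t))"

lemma tp_eq_superset:
  assumes "finite T" "S \<subseteq> T"
  shows "tp S c = tp T (\<lambda>n. if n \<in> S then c n else 0)"
  unfolding tp_def using assms by (intro ext sum.mono_neutral_cong_left) auto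

lemma tp_add: "tp S (\<lambda>n. c n + d n) t = tp S c t + tp S d t"
  and tp_diff: "tp S (\<lambda>n. c n - d n) t = tp S c t - tp S d t"
  and tp_cmult: "tp S (\<lambda>n. a * c n) t = a * tp S c t"
  by (auto simp: tp_def ring_distribs sum.distrib sum_subtractf sum_distrib_left mult.assoc)

lemma trig_add: assumes "trig f" "trig g" shows "trig (\<lambda>t. f t + g t)"
proof -
  from assms obtain S c T d where "finite S" "\<forall>t\<in>sphere 0 1. f t = tp S c t"
    "finite T" "\<forall>t\<in>sphere 0 1. g t = tp T d t" unfolding trig_def by blast
  then show ?thesis unfolding trig_def
    by (intro exI[of _ "S \<union> T"]
          exI[of _ "\<lambda>n. (if n \<in> S then c n else 0) + (if n \<in> T then d n else 0)"])
       (auto simp: tp_add tp_eq_superset[of "S \<union> T" S c] tp_eq_superset[of "S \<union> T" T d])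
qed

lemma trig_cmult: "trig f \<Longrightarrow> trig (\<lambda>t. a * f t)"
  unfolding trig_def using tp_cmult by metis

lemma trig_powi: "trig (\<lambda>t. t powi n)"
  unfolding trig_def by (rule exI[of _ "{n}"], rule exI[of _ "\<lambda>_. 1"]) (simp add: tp_def)

lemma trig_const: "trig (\<lambda>_. a)"
  using trig_cmult[OF trig_powi[of 0], of a] by simp

lemma trig_shift: assumes "trig f" shows "trig (\<lambda>t. t powi m * f t)"
proof -
  from assms obtain S c where S: "finite S" "\<forall>t\<in>sphere 0 1. f t = tp S c t" unfolding trig_def by blast
  have "t powi m * f t = tp ((\<lambda>n. m + n) ` S) (\<lambda>n. c (n - m)) t" if "t \<in> sphere 0 1" for t
    using S(2) that by (auto simp: tp_def sum.reindex sum_distrib_left powi_add_circle mult_ac)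
  then show ?thesis unfolding trig_def using S(1) by blast
qed

lemma trig_sum: "(\<And>i. i \<in> I \<Longrightarrow> trig (f i)) \<Longrightarrow> trig (\<lambda>t. \<Sum>i\<in>I. f i t)"
  by (induction I rule: infinite_finite_induct) (auto intro: trig_add trig_const)

lemma trig_cong: "trig f \<Longrightarrow> (\<And>t. t \<in> sphere 0 1 \<Longrightarrow> g t = f t) \<Longrightarrow> trig g"
  unfolding trig_def by (metis (no_types, lifting))

lemma trig_mult: assumes "trig f" "trig g" shows "trig (\<lambda>t. f t * g t)"
proof -
  from assms obtain S c where S: "finite S" "\<forall>t\<in>sphere 0 1. f t = tp S c t" unfolding trig_def by blast
  have "trig (\<lambda>t. \<Sum>n\<in>S. c n * (t powi n * g t))"
    by (intro trig_sum trig_cmult trig_shift assms)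
  then show ?thesis
    by (rule trig_cong) (use S in \<open>auto simp: tp_def sum_distrib_right mult.assoc\<close>)
qed

text \<open>A linear functional of \<open>t\<close> is a combination of \<open>t\<close> and \<open>cnj t = t\<^sup>-\<^sup>1\<close>; this brings
  the Stone--Weierstrass theorem for real polynomials in two variables to bear on the circle.\<close>

lemma real_polynomial_trig:
  fixes g :: "complex \<Rightarrow> real"
  assumes "real_polynomial_function g"
  shows "trig (\<lambda>t. complex_of_real (g t))"
  using assms
proof induction
  case (linear f)
  then interpret bounded_linear f .
  have eq: "complex_of_real (f t)
      = (of_real (f 1) - \<i> * of_real (f \<i>)) / 2 * t powi 1 + (of_real (f 1) + \<i> * of_real (f \<i>)) / 2 * t powi (-1)"
    if "t \<in> sphere 0 1" for t
  proof -
    have "f t = f (Re t *\<^sub>R 1 + Im t *\<^sub>R \<i>)"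
      by (intro arg_cong[where f = f]) (simp add: complex_eq_iff)
    then have "f t = Re t * f 1 + Im t * f \<i>" by (simp only: add scaleR real_scaleR_def)
    moreover have "t powi (-1) = cnj t"
      using cnj_powi_circle[OF that, of 1] by simp
    moreover have "complex_of_real (Re t) = (t + cnj t) / 2" "complex_of_real (Im t) = (t - cnj t) * - \<i> / 2"
      by (simp_all add: complex_eq_iff)
    ultimately have "complex_of_real (f t)
        = (t + cnj t) / 2 * of_real (f 1) + (t - cnj t) * - \<i> / 2 * of_real (f \<i>)"
      and inv: "t powi (-1) = cnj t"
      by (simp_all only: of_real_add of_real_mult)
    then show ?thesis by (simp only: inv power_int_1_right) (simp add: field_simps)
  qed
  show ?case
    by (rule trig_cong[OF _ eq]) (intro trig_add trig_cmult trig_powi)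
next
  case (const c)
  then show ?case by (rule trig_const)
next
  case (add f g)
  then show ?case using trig_add by simp
next
  case (mult f g)
  then show ?case using trig_mult by simp
qed

lemma real_continuous_trig_approx:
  fixes f :: "complex \<Rightarrow> real"
  assumes "continuous_on (sphere 0 1) f" "0 < e"
  obtains S c g where "finite S" "\<And>t. t \<in> sphere 0 1 \<Longrightarrow> tp S c t = complex_of_real (g t)"
    "\<And>t. t \<in> sphere 0 1 \<Longrightarrow> \<bar>f t - g t\<bar> < e"
proof -
  obtain g where g: "real_polynomial_function g" "\<And>t. t \<in> sphere 0 1 \<Longrightarrow> \<bar>f t - g t\<bar> < e"
    using Stone_Weierstrass_real_polynomial_function[of "sphere 0 1" f e] assms by auto
  obtain S c where "finite S" "\<forall>t\<in>sphere 0 1. complex_of_real (g t) = tp S c t"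
    using real_polynomial_trig[OF g(1)] unfolding trig_def by blast
  with g(2) that show thesis by metis
qed

section \<open>Density of trigonometric polynomials\<close>

text \<open>The \<open>L\<^sup>p\<close>-closure of the trigonometric polynomials. It is shown to be everything by adding,
  one after the other, continuous functions, indicators of closed sets, indicators of Borel sets, simple
  functions and all of \<open>L\<^sup>p\<close>.\<close>

definition trig_closure :: "real \<Rightarrow> circle_fun set" where
  "trig_closure p = {x \<in> Lp p. \<forall>e>0. \<exists>S c. finite S \<and> Lp_norm p (x - cf (tp S c)) < e}"

lemma trig_closureD:
  assumes "x \<in> trig_closure p" "0 < e"
  obtains S c where "finite S" "Lp_norm p (x - cf (tp S c)) < e"
  using assms unfolding trig_closure_def by blast

lemma trig_closure_Lp: "x \<in> trig_closure p \<Longrightarrow> x \<in> Lp p"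
  by (simp add: trig_closure_def)

lemma trig_imp_cf_tp:
  assumes "trig f" obtains S c where "finite S" "cf f = cf (tp S c)" "f \<in> borel_measurable circle"
proof -
  obtain S c where S: "finite S" "\<forall>t\<in>sphere 0 1. f t = tp S c t" using assms unfolding trig_def by blast
  have "f \<in> borel_measurable circle"
    using S(2) tp_measurable[of S c] by (subst measurable_cong) auto
  moreover from this have "cf f = cf (tp S c)" using S by (subst cf_eq_iff) auto
  ultimately show thesis using that S by blast
qed

lemma cf_tp_add: assumes "finite S" "finite T"
  obtains U e where "finite U" "cf (tp S c) + cf (tp T d) = cf (tp U e)"
proof -
  have "trig (tp S c)" "trig (tp T d)" using assms unfolding trig_def by blast+
  then have "trig (\<lambda>t. tp S c t + tp T d t)" by (rule trig_add)
  then obtain U e where "finite U" "cf (\<lambda>t. tp S c t + tp T d t) = cf (tp U e)"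
    by (rule trig_imp_cf_tp)
  then show thesis using that by (simp add: cf_add)
qed

lemma trig_closure_add:
  assumes p: "1 \<le> p" and x: "x \<in> trig_closure p" and y: "y \<in> trig_closure p"
  shows "x + y \<in> trig_closure p"
proof -
  have Lp: "x \<in> Lp p" "y \<in> Lp p" using x y by (auto simp: trig_closure_def)
  show ?thesis unfolding trig_closure_def mem_Collect_eq
  proof (intro conjI allI impI)
    show "x + y \<in> Lp p" using Lp p by (rule_tac Lp_add)
    fix e :: real assume e: "0 < e"
    obtain S c where S: "finite S" "Lp_norm p (x - cf (tp S c)) < e/2" using x e by (elim trig_closureD[of _ _ "e/2"]) auto
    obtain T d where T: "finite T" "Lp_norm p (y - cf (tp T d)) < e/2" using y e by (elim trig_closureD[of _ _ "e/2"]) auto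
    obtain U a where U: "finite U" "cf (tp S c) + cf (tp T d) = cf (tp U a)" using cf_tp_add S T by blast
    have "Lp_norm p ((x - cf (tp S c)) + (y - cf (tp T d))) < e"
      using Lp_norm_triangle[of p "x - cf (tp S c)" "y - cf (tp T d)"] S T Lp p
      by (simp add: Lp_diff tp_Lp)
    moreover have "(x - cf (tp S c)) + (y - cf (tp T d)) = (x + y) - cf (tp U a)"
      by (simp add: U(2)[symmetric])
    ultimately show "\<exists>S c. finite S \<and> Lp_norm p (x + y - cf (tp S c)) < e" using U(1) by metis
  qed
qed

lemma trig_closure_limit:
  assumes p: "1 \<le> p" and x: "x \<in> Lp p" and lim: "\<And>e. 0 < e \<Longrightarrow> \<exists>y\<in>trig_closure p. Lp_norm p (x - y) < e"
  shows "x \<in> trig_closure p"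
  unfolding trig_closure_def mem_Collect_eq
proof (intro conjI allI impI x)
  fix e :: real assume e: "0 < e"
  obtain y where y: "y \<in> trig_closure p" "Lp_norm p (x - y) < e/2" using lim[of "e/2"] e by auto
  obtain S c where S: "finite S" "Lp_norm p (y - cf (tp S c)) < e/2" using y e by (elim trig_closureD[of _ _ "e/2"]) auto
  have "Lp_norm p (x - cf (tp S c)) < e"
    using Lp_norm_triangle_diff[of p x y "cf (tp S c)"] p x y S by (simp add: trig_closure_Lp tp_Lp)
  then show "\<exists>S c. finite S \<and> Lp_norm p (x - cf (tp S c)) < e" using S by blast
qed

lemma cscale_cf_tp: "cscale a (cf (tp S c)) = cf (tp S (\<lambda>n. a * c n))"
  by (simp add: cscale_cf tp_cmult[abs_def])

lemma trig_closure_cscale: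
  assumes p: "1 \<le> p" and x: "x \<in> trig_closure p"
  shows "cscale a x \<in> trig_closure p"
  unfolding trig_closure_def mem_Collect_eq
proof (intro conjI allI impI)
  show "cscale a x \<in> Lp p" using x by (intro Lp_cscale trig_closure_Lp)
  fix e :: real assume e: "0 < e"
  define d where "d = e / (cmod a + 1)"
  have d: "0 < d" "cmod a * d < e" using e by (auto simp: d_def field_simps add_pos_nonneg)
  obtain S c where S: "finite S" "Lp_norm p (x - cf (tp S c)) < d" using x d(1) by (rule trig_closureD)
  have "Lp_norm p (cscale a x - cf (tp S (\<lambda>n. a * c n))) = cmod a * Lp_norm p (x - cf (tp S c))"
    using p Lp_norm_cscale[of p a "x - cf (tp S c)"] by (simp add: cscale_diff cscale_cf_tp)
  also have "\<dots> \<le> cmod a * d" using S by (intro mult_left_mono) auto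
  also have "\<dots> < e" by (rule d(2))
  finally show "\<exists>S c. finite S \<and> Lp_norm p (cscale a x - cf (tp S c)) < e" using S(1) by blast
qed

lemma zero_in_trig_closure: "0 \<in> trig_closure p"
proof -
  have "(0::circle_fun) = cf (tp {} (\<lambda>_. 0))" unfolding cf_zero by (simp add: tp_def[abs_def])
  then have "Lp_norm p (0 - cf (tp {} (\<lambda>_. 0))) = 0" by simp
  then have "\<exists>S c. finite S \<and> Lp_norm p (0 - cf (tp S c)) < e" if "0 < e" for e
    using that by (metis finite.emptyI)
  then show ?thesis unfolding trig_closure_def by simp
qed

lemma trig_closure_sum:
  "1 \<le> p \<Longrightarrow> (\<And>i. i \<in> I \<Longrightarrow> f i \<in> trig_closure p) \<Longrightarrow> (\<Sum>i\<in>I. f i) \<in> trig_closure p"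
  by (induction I rule: infinite_finite_induct) (auto intro: trig_closure_add zero_in_trig_closure)

lemma Lp_dominated_convergence:
  fixes f :: "complex \<Rightarrow> complex" and w :: "complex \<Rightarrow> real"
  assumes p: "1 \<le> p" and [measurable]: "f \<in> borel_measurable circle" "\<And>n. g n \<in> borel_measurable circle"
    and w: "w \<in> borel_measurable circle" "cf (\<lambda>t. w t) \<in> Lp p"
    and bound: "\<And>n t. t \<in> sphere 0 1 \<Longrightarrow> cmod (g n t) \<le> w t"
    and lim: "\<And>t. t \<in> sphere 0 1 \<Longrightarrow> (\<lambda>n. g n t) \<longlonglongrightarrow> f t"
  shows "cf f \<in> Lp p" "\<And>n. cf (g n) \<in> Lp p" "(\<lambda>n. Lp_norm p (cf f - cf (g n))) \<longlonglongrightarrow> 0"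
proof -
  note [measurable] = w(1)
  have fw: "cmod (f t) \<le> w t" if "t \<in> sphere 0 1" for t
    using bound[OF that] lim[OF that] by (intro LIMSEQ_le_const2[OF tendsto_norm[OF lim[OF that]]]) auto
  show "cf f \<in> Lp p"
    by (rule cf_Lp_mono(1)[OF _ _ _ _ w(2)]) (use fw p in \<open>auto intro!: AE_I2 intro: order_trans[OF _ abs_ge_self]\<close>)
  show "\<And>n. cf (g n) \<in> Lp p"
    by (rule cf_Lp_mono(1)[OF _ _ _ _ w(2)]) (use bound p in \<open>auto intro!: AE_I2 intro: order_trans[OF _ abs_ge_self]\<close>)
  have "(\<lambda>n. LINT t|circle. cmod (f t - g n t) powr p) \<longlonglongrightarrow> (LINT t|circle. 0)"
  proof (rule integral_dominated_convergence[where w = "\<lambda>t. (2 * w t) powr p"])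
    have w0: "0 \<le> w t" if "t \<in> sphere 0 1" for t using fw[OF that] norm_ge_zero order_trans by blast
    have "integrable circle (\<lambda>t. 2 powr p * (cmod (complex_of_real (w t))) powr p)"
      using w(2) by (simp add: cf_in_Lp_iff)
    then show "integrable circle (\<lambda>t. (2 * w t) powr p)"
      by (subst Bochner_Integration.integrable_cong[OF refl, of _ _ "\<lambda>t. 2 powr p * (cmod (complex_of_real (w t))) powr p"])
         (auto simp: powr_mult w0)
    have "cmod (f t - g n t) \<le> 2 * w t" if "t \<in> sphere 0 1" for n t
      using norm_triangle_ineq4[of "f t" "g n t"] fw[OF that] bound[OF that, of n] by linarith
    then show "\<And>n. AE t in circle. norm (cmod (f t - g n t) powr p) \<le> (2 * w t) powr p"
      using p by (auto intro!: powr_mono2)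
    have "(\<lambda>n. cmod (f t - g n t) powr p) \<longlonglongrightarrow> cmod (f t - f t) powr p" if "t \<in> sphere 0 1" for t
      using p lim[OF that] by (intro tendsto_powr' tendsto_intros) auto
    then show "AE t in circle. (\<lambda>n. cmod (f t - g n t) powr p) \<longlonglongrightarrow> 0" using p by auto
  qed measurable
  then have "(\<lambda>n. (LINT t|circle. cmod (f t - g n t) powr p) powr (1 / p)) \<longlonglongrightarrow> 0 powr (1 / p)"
    using p by (intro tendsto_powr' tendsto_intros) auto
  then show "(\<lambda>n. Lp_norm p (cf f - cf (g n))) \<longlonglongrightarrow> 0"
    using p by (simp add: cf_diff Lp_norm_cf)
qed

lemma trig_closure_dominated:
  fixes f :: "complex \<Rightarrow> complex" and w :: "complex \<Rightarrow> real"
  assumes p: "1 \<le> p" and m: "f \<in> borel_measurable circle" "\<And>n. g n \<in> borel_measurable circle"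
    "w \<in> borel_measurable circle" "cf (\<lambda>t. w t) \<in> Lp p"
    "\<And>n t. t \<in> sphere 0 1 \<Longrightarrow> cmod (g n t) \<le> w t"
    "\<And>t. t \<in> sphere 0 1 \<Longrightarrow> (\<lambda>n. g n t) \<longlonglongrightarrow> f t"
    and cl: "\<And>n. cf (g n) \<in> trig_closure p"
  shows "cf f \<in> trig_closure p"
proof (rule trig_closure_limit[OF p])
  note * = Lp_dominated_convergence[OF p m]
  show "cf f \<in> Lp p" by (rule *(1))
  fix e :: real assume "0 < e"
  then obtain n where "\<bar>Lp_norm p (cf f - cf (g n))\<bar> < e"
    using LIMSEQ_D[OF *(3)] by fastforce
  then show "\<exists>y\<in>trig_closure p. Lp_norm p (cf f - y) < e" using cl by auto
qed

lemma continuous_in_trig_closure: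
  fixes f :: "complex \<Rightarrow> real"
  assumes p: "1 \<le> p" and cont: "continuous_on (sphere 0 1) f"
  shows "cf (\<lambda>t. f t) \<in> trig_closure p"
  unfolding trig_closure_def mem_Collect_eq
proof (intro conjI allI impI)
  have cont': "continuous_on (sphere 0 1) (\<lambda>t. complex_of_real (f t))" using cont by (intro continuous_intros)
  then show "cf (\<lambda>t. f t) \<in> Lp p" using p by (intro continuous_Lp) auto
  fix e :: real assume e: "0 < e"
  obtain S c g where S: "finite S" "\<And>t. t \<in> sphere 0 1 \<Longrightarrow> tp S c t = complex_of_real (g t)"
    "\<And>t. t \<in> sphere 0 1 \<Longrightarrow> \<bar>f t - g t\<bar> < e / 2"
    using real_continuous_trig_approx[OF cont, of "e/2"] e by auto
  have [measurable]: "(\<lambda>t. complex_of_real (f t)) \<in> borel_measurable circle"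
    using cont' by (rule continuous_circle_measurable)
  have "cmod (f t - tp S c t) \<le> e / 2" if "t \<in> sphere 0 1" for t
    unfolding S(2)[OF that] using S(3)[OF that] by (simp flip: of_real_diff)
  then have "Lp_norm p (cf (\<lambda>t. f t - tp S c t)) \<le> \<bar>e / 2\<bar>"
    using p by (intro bounded_Lp) auto
  then show "\<exists>S c. finite S \<and> Lp_norm p (cf (\<lambda>t. f t) - cf (tp S c)) < e"
    using S(1) e by (intro exI[of _ S] exI[of _ c]) (simp add: cf_diff)
qed

text \<open>The continuous functions \<open>max 0 (1 - n dist(t, C))\<close> decrease to the indicator of \<open>C\<close>.\<close>

lemma closed_indicator_in_trig_closure:
  assumes p: "1 \<le> p" and C: "closed C"
  shows "cf (\<lambda>t. of_real (indicator C t)) \<in> trig_closure p"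
proof (cases "C = {}")
  case True
  then show ?thesis using continuous_in_trig_closure[OF p, of "\<lambda>_. 0"] by simp
next
  case False
  define g where "g n t = max 0 (1 - real n * infdist t C)" for n :: nat and t
  have cont: "continuous_on (sphere 0 1) (g n)" for n
    unfolding g_def by (intro continuous_intros)
  have [measurable]: "indicator C \<in> (borel_measurable circle :: (complex \<Rightarrow> real) set)"
    using C by (intro borel_measurable_circleI) auto
  show ?thesis
  proof (rule trig_closure_dominated[OF p, where g = "\<lambda>n t. of_real (g n t)" and w = "\<lambda>_. 1"])
    show "\<And>n. cf (\<lambda>t. of_real (g n t)) \<in> trig_closure p" by (rule continuous_in_trig_closure[OF p cont])
    show "\<And>n. (\<lambda>t. complex_of_real (g n t)) \<in> borel_measurable circle"
      by (intro continuous_circle_measurable continuous_on_of_real cont)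
    show "\<And>n t. cmod (complex_of_real (g n t)) \<le> 1" by (auto simp: g_def infdist_nonneg)
    fix t
    have "(\<lambda>n. g n t) \<longlonglongrightarrow> indicator C t"
    proof (cases "t \<in> C")
      case True
      then show ?thesis by (simp add: g_def)
    next
      case tC: False
      then have d: "0 < infdist t C" using C False by (intro infdist_pos_not_in_closed)
      then obtain N where N: "1 < real N * infdist t C" using ex_less_of_nat_mult by blast
      have "g n t = 0" if "N \<le> n" for n
      proof -
        have "real N * infdist t C \<le> real n * infdist t C" using that d by (intro mult_right_mono) auto
        then show ?thesis using N by (simp add: g_def)
      qed
      then have "eventually (\<lambda>n. g n t = 0) sequentially" unfolding eventually_sequentially by blast
      then show ?thesis using tC by (auto intro: tendsto_eventually)
    qed
    then show "(\<lambda>n. complex_of_real (g n t)) \<longlonglongrightarrow> complex_of_real (indicator C t)" by (rule tendsto_of_real)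
  qed (auto intro: const_Lp[of 1, simplified])
qed

text \<open>The sets with indicator in the closed linear space \<open>trig_closure p\<close> form a Dynkin system, and
  the closed sets are an intersection-stable generator of the Borel sets.\<close>

lemma indicator_in_trig_closure:
  assumes p: "1 \<le> p" and B: "B \<in> sets borel"
  shows "cf (\<lambda>t. of_real (indicator B t)) \<in> trig_closure p"
proof -
  have meas: "(\<lambda>t. complex_of_real (indicator A t)) \<in> borel_measurable circle" if "A \<in> sets borel" for A
    using that by (intro borel_measurable_circleI) auto
  have sb: "sets borel = sigma_sets UNIV (Collect closed :: complex set set)"
    unfolding borel_eq_closed by simp
  have "Int_stable (Collect closed :: complex set set)" by (auto simp: Int_stable_def)
  moreover have "(Collect closed :: complex set set) \<subseteq> Pow UNIV" by simp
  moreover have "B \<in> sigma_sets UNIV (Collect closed)" using B sb by simp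
  ultimately show ?thesis
  proof (induct B rule: sigma_sets_induct_disjoint)
    case (basic A)
    then show ?case using closed_indicator_in_trig_closure[OF p] by simp
  next
    case empty
    then show ?case using closed_indicator_in_trig_closure[OF p, of "{}"] by simp
  next
    case (compl A)
    then have A: "A \<in> sets borel" using sb by simp
    have "cf (\<lambda>_. of_real 1) + cscale (-1) (cf (\<lambda>t. of_real (indicator A t))) \<in> trig_closure p"
      by (intro trig_closure_add trig_closure_cscale continuous_in_trig_closure p compl) auto
    also have "cf (\<lambda>_. of_real 1) + cscale (-1) (cf (\<lambda>t. of_real (indicator A t)))
        = cf (\<lambda>t. of_real (indicator (UNIV - A) t))"
      using meas[OF A] by (auto simp: cscale_cf cf_add indicator_def intro!: arg_cong[where f = cf])
    finally show ?case .
  next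
    case (union A)
    then have A: "A i \<in> sets borel" for i using sb by auto
    have sumeq: "cf (\<lambda>t. \<Sum>i<n. complex_of_real (indicator (A i) t)) \<in> trig_closure p" for n
    proof (induction n)
      case 0
      then show ?case using closed_indicator_in_trig_closure[OF p, of "{}"] by simp
    next
      case (Suc n)
      have "(\<lambda>t. \<Sum>i<n. complex_of_real (indicator (A i) t)) \<in> borel_measurable circle"
        using meas[OF A] by measurable
      with Suc union(3)[of n] show ?case
        using trig_closure_add[OF p, of "cf (\<lambda>t. \<Sum>i<n. complex_of_real (indicator (A i) t))"
            "cf (\<lambda>t. complex_of_real (indicator (A n) t))"] meas[OF A]
        by (simp add: cf_add)
    qed
    have sum: "(\<lambda>n. \<Sum>i<n. complex_of_real (indicator (A i) t)) \<longlonglongrightarrow> of_real (indicator (\<Union>i. A i) t)" for t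
    proof -
      have "(\<Sum>i<n. indicator (A i) t :: real) = indicator (\<Union>i<n. A i) t" for n
        using union(1,2) by (subst indicator_UN_disjoint) (auto simp: disjoint_family_on_def)
      then have "(\<lambda>n. \<Sum>i<n. indicator (A i) t :: real) \<longlonglongrightarrow> indicator (\<Union>i. A i) t"
        using LIMSEQ_indicator_UN[of A t] by simp
      then show ?thesis unfolding of_real_sum[symmetric] by (rule tendsto_of_real)
    qed
    show ?case
    proof (rule trig_closure_dominated[OF p _ _ _ _ _ sum sumeq, where w = "\<lambda>_. 1"])
      show "(\<lambda>t. complex_of_real (indicator (\<Union> (range A)) t)) \<in> borel_measurable circle"
        using A by (intro meas) auto
      show "\<And>n. (\<lambda>t. \<Sum>i<n. complex_of_real (indicator (A i) t)) \<in> borel_measurable circle"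
        using meas[OF A] by measurable
      show "cf (\<lambda>t. complex_of_real 1) \<in> Lp p" by (rule const_Lp)
      fix n :: nat and t
      have "(\<Sum>i<n. complex_of_real (indicator (A i) t)) = of_real (indicator (\<Union>i<n. A i) t)"
        using union(1,2) by (subst indicator_UN_disjoint) (auto simp: disjoint_family_on_def)
      then show "cmod (\<Sum>i<n. complex_of_real (indicator (A i) t)) \<le> 1" by (simp add: indicator_def)
    qed auto
  qed
qed

text \<open>A function in \<open>L\<^sup>p\<close> is the dominated limit of simple functions.\<close>

lemma trig_dense:
  assumes p: "1 \<le> p" and x: "x \<in> Lp p"
  shows "x \<in> trig_closure p"
proof -
  obtain f where f [measurable]: "f \<in> borel_measurable circle" and xf: "x = cf f" by (rule cf_cases)
  have simple: "cf s \<in> trig_closure p" if s: "simple_function circle s" for s :: "complex \<Rightarrow> complex"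
  proof -
    have fin: "finite (s ` sphere 0 1)" using s by (simp add: simple_function_def)
    have setB: "\<exists>B\<in>sets borel. s -` {y} \<inter> sphere 0 1 = sphere 0 1 \<inter> B" if "y \<in> s ` sphere 0 1" for y
    proof -
      have "s -` {y} \<inter> sphere 0 1 \<in> sets circle" using s that by (auto simp: simple_function_def)
      then show ?thesis unfolding sets_circle sets_restrict_space by auto
    qed
    then obtain B where B: "\<And>y. y \<in> s ` sphere 0 1 \<Longrightarrow> B y \<in> sets borel"
      "\<And>y. y \<in> s ` sphere 0 1 \<Longrightarrow> s -` {y} \<inter> sphere 0 1 = sphere 0 1 \<inter> B y" by metis
    have meas: "(\<lambda>t. complex_of_real (indicator (B y) t)) \<in> borel_measurable circle" if "y \<in> s ` sphere 0 1" for y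
      using B(1)[OF that] by (intro borel_measurable_circleI) auto
    have cfsum: "(\<Sum>y\<in>Y. cscale y (cf (\<lambda>t. of_real (indicator (B y) t)))) = cf (\<lambda>t. \<Sum>y\<in>Y. y * of_real (indicator (B y) t))"
      if "finite Y" "Y \<subseteq> s ` sphere 0 1" for Y
      using that
    proof (induction Y rule: finite_induct)
      case (insert y Y)
      have "(\<lambda>t. \<Sum>y\<in>Y. y * complex_of_real (indicator (B y) t)) \<in> borel_measurable circle"
        using insert meas by (intro borel_measurable_sum borel_measurable_times) auto
      with insert show ?case using meas[of y] by (simp add: cscale_cf cf_add)
    qed (simp add: cf_zero)
    have "s t = (\<Sum>y\<in>s ` sphere 0 1. y * of_real (indicator (B y) t))" if "t \<in> sphere 0 1" for t
    proof -
      have "indicator (B y) t = (if y = s t then 1 else 0 :: real)" if "y \<in> s ` sphere 0 1" for y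
      proof -
        have "t \<in> B y \<longleftrightarrow> t \<in> s -` {y}" using B(2)[OF that] \<open>t \<in> sphere 0 1\<close> by blast
        then show ?thesis by (simp add: indicator_def eq_commute)
      qed
      then have "(\<Sum>y\<in>s ` sphere 0 1. y * of_real (indicator (B y) t)) = (\<Sum>y\<in>s ` sphere 0 1. if y = s t then y else 0)"
        by (intro sum.cong) auto
      then show ?thesis using fin that by simp
    qed
    moreover have "(\<lambda>t. \<Sum>y\<in>s ` sphere 0 1. y * complex_of_real (indicator (B y) t)) \<in> borel_measurable circle"
      by (intro borel_measurable_sum borel_measurable_times borel_measurable_const meas)
    ultimately have "cf s = cf (\<lambda>t. \<Sum>y\<in>s ` sphere 0 1. y * of_real (indicator (B y) t))"
      unfolding cf_eq_iff[OF borel_measurable_simple_function[OF s] \<open>(\<lambda>t. \<Sum>y\<in>s ` sphere 0 1. y * complex_of_real (indicator (B y) t)) \<in> borel_measurable circle\<close>]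
      by (intro AE_I2) (simp only: space_circle)
    also have "\<dots> \<in> trig_closure p"
      unfolding cfsum[OF fin order_refl, symmetric]
      by (intro trig_closure_sum trig_closure_cscale indicator_in_trig_closure p B)
    finally show ?thesis .
  qed
  obtain F where F: "\<And>i. simple_function circle (F i)" "\<And>t. t \<in> sphere 0 1 \<Longrightarrow> (\<lambda>i. F i t) \<longlonglongrightarrow> f t"
    "\<And>i t. t \<in> sphere 0 1 \<Longrightarrow> cmod (F i t) \<le> 2 * cmod (f t)"
    using borel_measurable_implies_sequence_metric[OF f, of 0] by (simp only: space_circle dist_0_norm dist_norm diff_zero) metis
  show ?thesis unfolding xf
  proof (rule trig_closure_dominated[OF p f _ _ _ F(3) F(2) simple[OF F(1)]])
    show "F n \<in> borel_measurable circle" for n using F(1) by (rule borel_measurable_simple_function)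
    show "cf (\<lambda>t. complex_of_real (2 * cmod (f t))) \<in> Lp p"
      using x p unfolding xf by (simp add: cf_in_Lp_iff powr_mult)
  qed auto
qed

corollary trig_approx:
  assumes "1 \<le> p" "x \<in> Lp p" "0 < e"
  obtains S c where "finite S" "Lp_norm p (x - cf (tp S c)) < e"
  using trig_closureD[OF trig_dense[OF assms(1,2)] assms(3)] .

section \<open>Fourier coefficients\<close>

lemma Lp_norm_unimodular:
  assumes "f \<in> borel_measurable circle" "g \<in> borel_measurable circle" "\<And>t. t \<in> sphere 0 1 \<Longrightarrow> cmod (f t) = cmod (g t)"
  shows "Lp_norm p (cf f) = Lp_norm p (cf g)" "cf f \<in> Lp p \<longleftrightarrow> cf g \<in> Lp p"
proof -
  show "Lp_norm p (cf f) = Lp_norm p (cf g)"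
    unfolding Lp_norm_cf[OF assms(1)] Lp_norm_cf[OF assms(2)]
    by (intro arg_cong2[where f = "(powr)"] Bochner_Integration.integral_cong refl) (simp add: assms(3))
  show "cf f \<in> Lp p \<longleftrightarrow> cf g \<in> Lp p"
    unfolding cf_in_Lp_iff[OF assms(1)] cf_in_Lp_iff[OF assms(2)]
    by (intro Bochner_Integration.integrable_cong refl) (simp add: assms(3))
qed

lemma norm_powi_circle: "t \<in> sphere 0 1 \<Longrightarrow> cmod (t powi n) = 1"
  by (simp add: norm_power_int)

lemma Lp_hoelder:
  assumes pq: "1 < p" "1 < q" "1 / p + 1 / q = 1" and fg: "f \<in> borel_measurable circle" "g \<in> borel_measurable circle"
    "cf f \<in> Lp p" "cf g \<in> Lp q"
  shows "integrable circle (\<lambda>t. f t * g t)"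
    and "cmod (LINT t|circle. f t * g t) \<le> Lp_norm p (cf f) * Lp_norm q (cf g)"
  using hoelder[OF pq fg(1,2)] fg by (auto simp: cf_in_Lp_iff Lp_norm_cf)

lemma conjugate_exponent:
  assumes "1 < (p::real)" obtains q where "1 < q" "1 / p + 1 / q = 1" "q = p / (p - 1)"
  using assms that[of "p / (p - 1)"] by (simp add: field_simps)

lemma fourier_coeff_bound:
  assumes "1 < p" "x \<in> Lp p"
  shows "cmod (fourier_coeff x n) \<le> Lp_norm p x"
proof -
  obtain f where f: "f \<in> borel_measurable circle" and xf: "x = cf f" by (rule cf_cases)
  obtain q where q: "1 < q" "1 / p + 1 / q = 1" using conjugate_exponent[OF assms(1)] by metis
  have "Lp_norm q (cf (\<lambda>t. t powi (- n))) = Lp_norm q (cf (\<lambda>t. 1))"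
    by (rule Lp_norm_unimodular) (auto simp: norm_powi_circle)
  then have "Lp_norm q (cf (\<lambda>t. t powi (- n))) = 1" using q by (simp add: Lp_norm_const)
  then show ?thesis
    using Lp_hoelder(2)[OF assms(1) q f, of "\<lambda>t. t powi (- n)"] assms(2) q
    by (simp add: xf fourier_coeff_cf[OF f] continuous_Lp continuous_powi_sphere)
qed

lemma fourier_integrable:
  assumes "1 < p" "f \<in> borel_measurable circle" "cf f \<in> Lp p"
  shows "integrable circle (\<lambda>t. f t * t powi n)"
proof -
  obtain q where q: "1 < q" "1 / p + 1 / q = 1" using conjugate_exponent[OF assms(1)] by metis
  show ?thesis
    by (rule Lp_hoelder(1)[OF assms(1) q assms(2) _ assms(3)])
       (use q in \<open>auto intro!: continuous_Lp continuous_powi_sphere\<close>)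
qed

lemma fourier_coeff_add:
  "1 < p \<Longrightarrow> x \<in> Lp p \<Longrightarrow> y \<in> Lp p \<Longrightarrow> fourier_coeff (x + y) n = fourier_coeff x n + fourier_coeff y n"
  by (cases x rule: cf_cases; cases y rule: cf_cases)
     (auto simp: cf_add fourier_coeff_cf ring_distribs fourier_integrable)

lemma fourier_coeff_cscale: "fourier_coeff (cscale c x) n = c * fourier_coeff x n"
  by (cases x rule: cf_cases) (auto simp: cscale_cf fourier_coeff_cf mult.assoc)

lemma fourier_coeff_diff:
  assumes "1 < p" "x \<in> Lp p" "y \<in> Lp p"
  shows "fourier_coeff (x - y) n = fourier_coeff x n - fourier_coeff y n"
  using fourier_coeff_add[of p x "cscale (-1) y" n] assms
  by (simp add: Lp_cscale fourier_coeff_cscale) (simp add: cscale_minus_one)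

lemma pairing_tp:
  assumes "1 < p" "f \<in> borel_measurable circle" "cf f \<in> Lp p"
  shows "(LINT t|circle. f t * tp S c t) = (\<Sum>n\<in>S. c n * fourier_coeff (cf f) (- n))"
proof -
  have "(LINT t|circle. f t * tp S c t) = (LINT t|circle. (\<Sum>n\<in>S. c n * (f t * t powi n)))"
    by (simp add: tp_def sum_distrib_left mult_ac)
  also have "\<dots> = (\<Sum>n\<in>S. c n * (LINT t|circle. f t * t powi n))"
    using fourier_integrable[OF assms] by (subst Bochner_Integration.integral_sum) auto
  finally show ?thesis by (simp add: fourier_coeff_cf[OF assms(2)])
qed

text \<open>Such an \<open>f\<close> is orthogonal to trigonometric polynomials, hence by density in the dual exponent
  to the bounded function \<open>cnj f / \<bar>f\<bar>\<close>, which means that the integral of \<open>\<bar>f\<bar>\<close> vanishes.\<close>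

lemma fourier_unique_zero:
  assumes p: "1 < p" and x: "x \<in> Lp p" and zero: "\<And>n. fourier_coeff x n = 0"
  shows "x = 0"
proof -
  obtain f where f [measurable]: "f \<in> borel_measurable circle" and xf: "x = cf f" by (rule cf_cases)
  obtain q where q: "1 < q" "1 / p + 1 / q = 1" using conjugate_exponent[OF p] by metis
  define h where "h t = cnj (f t) / cmod (f t)" for t
  have "(\<lambda>z. cnj z / complex_of_real (cmod z)) \<in> borel_measurable borel"
    by (intro borel_measurable_divide borel_measurable_continuous_onI continuous_intros)
  from measurable_compose[OF f this] have [measurable]: "h \<in> borel_measurable circle" unfolding h_def .
  have h: "cf h \<in> Lp q"
    using q by (intro bounded_Lp(1)[of _ _ 1]) (auto simp: h_def norm_divide)
  have fh: "f t * h t = cmod (f t)" for t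
    by (cases "f t = 0") (simp_all add: h_def complex_norm_square[symmetric] power2_eq_square)
  have "cmod (LINT t|circle. f t * h t) \<le> Lp_norm p x * e" if "0 < e" for e
  proof -
    obtain S c where S: "finite S" "Lp_norm q (cf h - cf (tp S c)) < e"
      using trig_approx[OF _ h \<open>0 < e\<close>] q by auto
    have tp: "cf (tp S c) \<in> Lp q" using q by (intro tp_Lp) auto
    have "(LINT t|circle. f t * tp S c t) = 0"
      using pairing_tp[OF p f] x zero by (simp add: xf)
    then have "(LINT t|circle. f t * h t) = (LINT t|circle. f t * (h t - tp S c t))"
      using Lp_hoelder(1)[OF p q f _ _ h] Lp_hoelder(1)[OF p q f _ _ tp] x
      by (simp add: xf right_diff_distrib)
    also have "cmod \<dots> \<le> Lp_norm p (cf f) * Lp_norm q (cf (\<lambda>t. h t - tp S c t))"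
      using x h tp q Lp_diff[of q "cf h" "cf (tp S c)"]
      by (intro Lp_hoelder(2)[OF p q f]) (auto simp: xf cf_diff)
    also have "\<dots> \<le> Lp_norm p x * e"
      using S by (intro mult_mono) (auto simp: xf cf_diff)
    finally show ?thesis .
  qed
  note le = this
  have "((\<lambda>e. Lp_norm p x * e) \<longlongrightarrow> Lp_norm p x * 0) (at_right 0)" by (intro tendsto_intros)
  then have "cmod (LINT t|circle. f t * h t) \<le> Lp_norm p x * 0"
    by (intro tendsto_lowerbound[where F = "at_right (0::real)"])
       (auto simp: eventually_at_right_field intro!: exI[of _ 1] le)
  then have "(LINT t|circle. cmod (f t)) = 0"
    using Bochner_Integration.integral_nonneg[of circle "\<lambda>t. cmod (f t)"] by (simp add: fh order_antisym)
  moreover have "integrable circle (\<lambda>t. cmod (f t))"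
    using Lp_imp_integrable[of p f] p x by (simp add: xf)
  ultimately have "AE t in circle. cmod (f t) = 0"
    by (subst (asm) integral_nonneg_eq_0_iff_AE) auto
  then show ?thesis by (simp add: xf cf_zero cf_eq_iff)
qed

section \<open>The theorem of M. Riesz for trigonometric polynomials\<close>

text \<open>With \<open>\<theta>\<close> the argument of \<open>z\<close> the claim is \<open>1 \<le> A cos\<^sup>p \<theta> - B cos (p \<theta>)\<close> for \<open>\<bar>\<theta>\<bar> < \<pi> / 2\<close>.
  For \<open>1 < p \<le> 2\<close> the number \<open>cos (p \<theta>)\<close> is negative for \<open>\<theta>\<close> close to \<open>\<pi> / 2\<close>, where the
  first term is of no help; away from there \<open>cos \<theta>\<close> is bounded below.\<close>

lemma calderon_inequality:
  fixes p :: real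
  assumes p: "1 < p" "p \<le> 2"
  obtains A B where "0 \<le> A" "0 \<le> B"
    "\<And>z. 0 < Re z \<Longrightarrow> cmod z powr p \<le> A * Re z powr p - B * Re (z powr complex_of_real p)"
proof -
  \<comment> \<open>The midpoint of the interval from \<open>\<pi> / (2 p)\<close>, the zero of \<open>cos (p \<theta>)\<close>, to \<open>\<pi> / 2\<close>.\<close>
  define \<alpha> where "\<alpha> = pi * (1 + 1 / p) / 4"
  have \<alpha>: "0 < \<alpha>" "\<alpha> < pi / 2" "pi / 2 < p * \<alpha>" "p * \<alpha> < pi"
  proof -
    show "0 < \<alpha>" using p by (simp add: \<alpha>_def add_pos_pos)
    show "\<alpha> < pi / 2" using p by (simp add: \<alpha>_def field_simps)
    have "p * \<alpha> = pi * (p + 1) / 4" using p by (simp add: \<alpha>_def field_simps)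
    moreover have "pi * 2 < pi * (p + 1)" "pi * (p + 1) < pi * 4" using p by simp_all
    ultimately show "pi / 2 < p * \<alpha>" "p * \<alpha> < pi" by linarith+
  qed
  define B where "B = 1 / (- cos (p * \<alpha>))"
  have neg: "cos (p * \<alpha>) < 0" using \<alpha> cos_monotone_0_pi[of "pi/2" "p * \<alpha>"] by simp
  then have B: "0 < B" by (simp add: B_def)
  have ca: "0 < cos \<alpha>" using \<alpha> by (intro cos_gt_zero) auto
  define A where "A = (1 + B) / cos \<alpha> powr p"
  have A: "0 < A" using B ca by (simp add: A_def)
  have key: "1 \<le> A * cos \<theta> powr p - B * cos (p * \<theta>)" if \<theta>: "0 \<le> \<theta>" "\<theta> < pi / 2" for \<theta>
  proof (cases "\<theta> \<le> \<alpha>")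
    case True
    have "cos \<alpha> \<le> cos \<theta>" using True \<theta> \<alpha> by (intro cos_monotone_0_pi_le) auto
    then have "cos \<alpha> powr p \<le> cos \<theta> powr p" using ca p by (intro powr_mono2) auto
    then have "A * cos \<alpha> powr p \<le> A * cos \<theta> powr p" using A by (intro mult_left_mono) auto
    moreover have "A * cos \<alpha> powr p = 1 + B" using ca by (simp add: A_def)
    moreover have "B * cos (p * \<theta>) \<le> B * 1" using B by (intro mult_left_mono) auto
    ultimately show ?thesis by linarith
  next
    case False
    have "p * \<theta> \<le> 2 * (pi / 2)" using p \<theta> by (intro mult_mono) auto
    then have "cos (p * \<theta>) \<le> cos (p * \<alpha>)"
      using False \<alpha> p by (intro cos_monotone_0_pi_le) auto
    then have "B * cos (p * \<theta>) \<le> B * cos (p * \<alpha>)" using B by (intro mult_left_mono) auto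
    also have "\<dots> = -1" using neg by (simp add: B_def)
    finally have "B * cos (p * \<theta>) \<le> -1" .
    moreover have "0 \<le> A * cos \<theta> powr p" using A by simp
    ultimately show ?thesis by linarith
  qed
  show thesis
  proof
    show "0 \<le> A" "0 \<le> B" using A B by auto
    fix z :: complex assume z: "0 < Re z"
    then have z0: "z \<noteq> 0" by auto
    define \<theta> where "\<theta> = Arg z"
    have Re: "Re z = cmod z * cos \<theta>" using z0 by (simp add: \<theta>_def cos_Arg)
    have abs: "\<bar>\<theta>\<bar> < pi / 2" using z Arg_Re_pos[of z] unfolding \<theta>_def by blast
    have pw: "Re (z powr complex_of_real p) = cmod z powr p * cos (p * \<theta>)"
      using z0 by (simp add: powr_def Re_exp \<theta>_def Arg_eq_Im_Ln)
    have "1 \<le> A * cos \<theta> powr p - B * cos (p * \<theta>)"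
      using key[of "\<bar>\<theta>\<bar>"] abs p by (simp add: abs_if split: if_splits)
    then have "cmod z powr p * 1 \<le> cmod z powr p * (A * cos \<theta> powr p - B * cos (p * \<theta>))"
      by (intro mult_left_mono) auto
    also have "\<dots> = A * Re z powr p - B * Re (z powr complex_of_real p)"
      unfolding pw Re using cos_gt_zero_pi[of \<theta>] abs by (simp add: powr_mult algebra_simps)
    finally show "cmod z powr p \<le> A * Re z powr p - B * Re (z powr complex_of_real p)" by simp
  qed
qed

text \<open>A symmetric frequency range is convenient because the conjugate of a trigonometric polynomial
  then has the same range.\<close>

lemma tp_symmetric_interval:
  assumes "finite S"
  obtains N c' where "tp S c = tp {-int N..int N} c'" "tp {n\<in>S. 0 \<le> n} c = tp {0..int N} c'"
proof -
  define N where "N = nat (\<Sum>n\<in>S. \<bar>n\<bar>)"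
  have "\<bar>n\<bar> \<le> int N" if "n \<in> S" for n
    using member_le_sum[of n S abs] assms that by (simp add: N_def sum_nonneg)
  then have sub: "S \<subseteq> {-int N..int N}" by force
  let ?c = "\<lambda>n. if n \<in> S then c n else 0"
  have 1: "tp S c = tp {-int N..int N} ?c" using sub by (intro tp_eq_superset) auto
  have 2: "tp {n\<in>S. 0 \<le> n} c = tp {0..int N} ?c"
    unfolding tp_def using sub by (intro ext sum.mono_neutral_cong_left) auto
  show thesis using that[OF 1 2] .
qed

lemma real_trig_coeff_symmetric:
  assumes "finite S" "\<And>n. n \<in> S \<Longrightarrow> - n \<in> S" "\<And>t. t \<in> sphere 0 1 \<Longrightarrow> tp S c t = complex_of_real (g t)" "n \<in> S"
  shows "c (- n) = cnj (c n)"
proof -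
  have "c (- n) = (LINT t|circle. tp S c t * t powi n)"
    using fourier_coeff_tp[of S c "- n"] assms by (simp add: fourier_coeff_cf)
  also have "\<dots> = (LINT t|circle. cnj (tp S c t * t powi (- n)))"
    using assms(3) by (intro Bochner_Integration.integral_cong refl) (simp add: cnj_powi_circle)
  also have "\<dots> = cnj (LINT t|circle. tp S c t * t powi (- n))"
    by (rule Bochner_Integration.integral_cnj)
  also have "\<dots> = cnj (c n)"
    using fourier_coeff_tp[of S c n] assms by (simp add: fourier_coeff_cf)
  finally show ?thesis .
qed

text \<open>For a positive \<open>h\<close> with analytic part \<open>P h\<close> the polynomial \<open>F = 2 P h - h\<^sub>0\<close> has real part \<open>h\<close> on
  the circle, hence positive real part on the disc by the maximum principle. So \<open>F\<^sup>p\<close> is holomorphic,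
  its mean is \<open>F(0)\<^sup>p = h\<^sub>0\<^sup>p \<ge> 0\<close>, and Calderon's inequality integrates to
  \<open>\<parallel>F\<parallel>\<^sup>p \<le> A \<parallel>h\<parallel>\<^sup>p\<close>.\<close>

lemma riesz_positive:
  assumes p: "1 < p" "p \<le> 2"
  obtains C where "0 \<le> C"
    "\<And>N c g. (\<And>t. t \<in> sphere 0 1 \<Longrightarrow> tp {-int N..int N} c t = complex_of_real (g t) \<and> 0 < g t) \<Longrightarrow>
       Lp_norm p (cf (tp {0..int N} c)) \<le> C * Lp_norm p (cf (tp {-int N..int N} c))"
proof -
  obtain A B where AB: "0 \<le> A" "0 \<le> B"
    "\<And>z. 0 < Re z \<Longrightarrow> cmod z powr p \<le> A * Re z powr p - B * Re (z powr complex_of_real p)"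
    using calderon_inequality[OF p] by metis
  show thesis
  proof
    show "0 \<le> A powr (1 / p) + 1" by simp
    fix N :: nat and c :: "int \<Rightarrow> complex" and g :: "complex \<Rightarrow> real"
    assume g': "\<And>t. t \<in> sphere 0 1 \<Longrightarrow> tp {-int N..int N} c t = complex_of_real (g t) \<and> 0 < g t"
    let ?S = "{-int N..int N}"
    have g: "tp ?S c t = complex_of_real (g t)" "0 < g t" if "t \<in> sphere 0 1" for t using g'[OF that] by auto
    have sym: "c (- n) = cnj (c n)" if "n \<in> ?S" for n
      using that by (intro real_trig_coeff_symmetric[of ?S c g] g) auto
    define F where "F z = c 0 + (\<Sum>n\<in>{1..int N}. 2 * c n * z ^ nat n)" for z
    have hol: "F holomorphic_on X" for X unfolding F_def by (intro holomorphic_intros)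
    have cont: "continuous_on X F" for X using hol by (rule holomorphic_on_imp_continuous_on)
    have "n \<in> uminus ` {1..int N} \<longleftrightarrow> - int N \<le> n \<and> n \<le> -1" for n
      by (auto intro: image_eqI[of _ _ "- n"])
    then have split: "?S = {0} \<union> {1..int N} \<union> uminus ` {1..int N}" by force
    have F_tp: "F t = 2 * tp {0..int N} c t - c 0" if "t \<in> sphere 0 1" for t
    proof -
      have "{0..int N} = insert 0 {1..int N}" by auto
      then have "tp {0..int N} c t = c 0 + (\<Sum>n\<in>{1..int N}. c n * t ^ nat n)"
        by (simp add: tp_def power_int_def)
      then show ?thesis by (simp add: F_def sum_distrib_left mult.assoc)
    qed
    have ReF: "complex_of_real (Re (F t)) = tp ?S c t" if t: "t \<in> sphere 0 1" for t
    proof -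
      have "tp ?S c t = c 0 + (\<Sum>n\<in>{1..int N}. c n * t powi n) + (\<Sum>n\<in>uminus ` {1..int N}. c n * t powi n)"
        unfolding tp_def split by (subst sum.union_disjoint; (subst sum.union_disjoint)?) auto
      also have "(\<Sum>n\<in>uminus ` {1..int N}. c n * t powi n) = (\<Sum>n\<in>{1..int N}. c (- n) * t powi (- n))"
        by (subst sum.reindex) auto
      also have "\<dots> = (\<Sum>n\<in>{1..int N}. cnj (c n * t powi n))"
        using t sym by (intro sum.cong) (auto simp: cnj_powi_circle)
      also have "c 0 + (\<Sum>n\<in>{1..int N}. c n * t powi n) + (\<Sum>n\<in>{1..int N}. cnj (c n * t powi n))
          = c 0 + (\<Sum>n\<in>{1..int N}. complex_of_real (2 * Re (c n * t powi n)))"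
        by (simp only: complex_add_cnj[symmetric] sum.distrib add.assoc)
      also have "c 0 = complex_of_real (Re (c 0))"
        using sym[of 0] by (simp add: complex_eq_iff)
      also have "complex_of_real (Re (c 0)) + (\<Sum>n\<in>{1..int N}. complex_of_real (2 * Re (c n * t powi n)))
          = complex_of_real (Re (F t))"
        by (simp add: F_def power_int_def complex_eq_iff algebra_simps sum_distrib_left)
      finally show ?thesis by simp
    qed
    have ReFg: "Re (F t) = g t" if "t \<in> sphere 0 1" for t
      using ReF[OF that] g(1)[OF that] by simp
    obtain t0 where t0: "t0 \<in> sphere 0 1" "\<And>t. t \<in> sphere 0 1 \<Longrightarrow> Re (F t0) \<le> Re (F t)"
      using continuous_attains_inf[of "sphere (0::complex) 1" "\<lambda>t. Re (F t)"] continuous_on_Re[OF cont]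
      by (metis compact_sphere sphere_eq_empty not_one_less_zero)
    have pos: "0 < Re (F z)" if "z \<in> cball 0 1" for z
    proof -
      have "Re (- F z) \<le> - Re (F t0)"
      proof (rule maximum_real_frontier[of "\<lambda>z. - F z" "cball 0 1"])
        show "(\<lambda>z. - F z) holomorphic_on interior (cball 0 1)" using hol by (rule holomorphic_on_minus)
        show "continuous_on (closure (cball 0 1)) (\<lambda>z. - F z)" using cont by (rule continuous_on_minus)
        fix z :: complex assume "z \<in> frontier (cball 0 1)"
        then show "Re (- F z) \<le> - Re (F t0)" using t0(2) by simp
      qed (use that in auto)
      then show ?thesis using ReFg[OF t0(1)] g(2)[OF t0(1)] by simp
    qed
    have mean: "(LINT t|circle. F t powr complex_of_real p) = F 0 powr complex_of_real p"
    proof (rule circle_mean_value)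
      have np: "F z \<notin> \<real>\<^sub>\<le>\<^sub>0" if "z \<in> cball 0 1" for z
        using pos[OF that] by (auto simp: complex_nonpos_Reals_iff)
      show "continuous_on (cball 0 1) (\<lambda>t. F t powr complex_of_real p)"
        using p by (intro continuous_on_powr_complex cont continuous_on_const subsetI CollectI disjI1 less_imp_le pos) simp_all
      show "(\<lambda>t. F t powr complex_of_real p) holomorphic_on ball 0 1"
        using np by (intro holomorphic_intros hol) auto
    qed
    have F0: "F 0 = complex_of_real (Re (c 0))"
      using sym[of 0] by (simp add: F_def complex_eq_iff zero_power)
    have F0p: "0 \<le> Re (F 0 powr complex_of_real p)"
      using pos[of 0] unfolding F0 by (simp add: powr_of_real)
    have contp: "continuous_on (sphere 0 1) (\<lambda>t. F t powr complex_of_real p)"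
      using p by (intro continuous_on_powr_complex cont continuous_on_const subsetI CollectI disjI1 less_imp_le pos) simp_all
    have intFp: "integrable circle (\<lambda>t. F t powr complex_of_real p)"
      by (rule continuous_circle_integrable[OF contp])
    have Fm [measurable]: "F \<in> borel_measurable circle" by (rule continuous_circle_measurable[OF cont])
    have FLp: "cf F \<in> Lp p" using p by (intro continuous_Lp cont) auto
    have hLp: "cf (tp ?S c) \<in> Lp p" using p by (intro tp_Lp) auto
    have "Lp_norm p (cf F) powr p = (LINT t|circle. cmod (F t) powr p)"
      using p by (intro Lp_norm_powr_cf) auto
    also have "\<dots> \<le> (LINT t|circle. A * cmod (tp ?S c t) powr p - B * Re (F t powr complex_of_real p))"
    proof (rule integral_mono)
      show "integrable circle (\<lambda>t. cmod (F t) powr p)" using FLp by (simp add: cf_in_Lp_iff)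
      show "integrable circle (\<lambda>t. A * cmod (tp ?S c t) powr p - B * Re (F t powr complex_of_real p))"
        using hLp intFp by (simp add: cf_in_Lp_iff)
      fix t assume "t \<in> space circle"
      then have t: "t \<in> sphere 0 1" by simp
      then have "0 < Re (F t)" by (intro pos) auto
      moreover have "cmod (tp ?S c t) = Re (F t)" using g[OF t] ReFg[OF t] by simp
      ultimately show "cmod (F t) powr p \<le> A * cmod (tp ?S c t) powr p - B * Re (F t powr complex_of_real p)"
        using AB(3) by simp
    qed
    also have "\<dots> = A * (LINT t|circle. cmod (tp ?S c t) powr p) - B * Re (LINT t|circle. F t powr complex_of_real p)"
      using hLp intFp by (simp add: cf_in_Lp_iff)
    also have "\<dots> \<le> A * (LINT t|circle. cmod (tp ?S c t) powr p)"
      using AB(2) F0p by (simp add: mean)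
    also have "\<dots> = A * Lp_norm p (cf (tp ?S c)) powr p"
      using p by (simp add: Lp_norm_powr_cf)
    finally have "(Lp_norm p (cf F) powr p) powr (1 / p) \<le> (A * Lp_norm p (cf (tp ?S c)) powr p) powr (1 / p)"
      using p by (intro powr_mono2) auto
    then have normF: "Lp_norm p (cf F) \<le> A powr (1 / p) * Lp_norm p (cf (tp ?S c))"
      using p AB(1) by (simp add: powr_powr powr_mult)
    have c0: "cmod (c 0) \<le> Lp_norm p (cf (tp ?S c))"
      using fourier_coeff_bound[OF p(1) hLp, of 0] fourier_coeff_tp[of ?S c 0] by simp
    have "cf (tp {0..int N} c) = cscale (1/2) (cf F + cf (\<lambda>_. c 0))"
    proof -
      have "cscale (1/2) (cf F + cf (\<lambda>_. c 0)) = cf (\<lambda>t. 1/2 * (F t + c 0))"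
        by (simp add: cf_add cscale_cf)
      also have "\<dots> = cf (tp {0..int N} c)" by (subst cf_eq_iff) (auto simp: F_tp)
      finally show ?thesis by simp
    qed
    then have "Lp_norm p (cf (tp {0..int N} c)) = 1/2 * Lp_norm p (cf F + cf (\<lambda>_. c 0))"
      using p by (simp add: Lp_norm_cscale)
    also have "\<dots> \<le> 1/2 * (Lp_norm p (cf F) + cmod (c 0))"
      using p Lp_norm_triangle[of p "cf F" "cf (\<lambda>_. c 0)"] FLp const_Lp[of "c 0" p] by (simp add: Lp_norm_const)
    also have "\<dots> \<le> Lp_norm p (cf F) + cmod (c 0)" by simp
    also have "\<dots> \<le> (A powr (1 / p) + 1) * Lp_norm p (cf (tp ?S c))"
      using normF c0 by (simp add: algebra_simps)
    finally show "Lp_norm p (cf (tp {0..int N} c)) \<le> (A powr (1 / p) + 1) * Lp_norm p (cf (tp ?S c))" .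
  qed
qed

lemma powr_le_square:
  fixes x d p :: real
  assumes "1 < p" "p \<le> 2" "0 < d" "0 \<le> x"
  shows "x powr p \<le> d powr p + d powr (p - 2) * x\<^sup>2"
proof (cases "x \<le> d")
  case True
  then have "x powr p \<le> d powr p" using assms by (intro powr_mono2) auto
  then show ?thesis by (simp add: add_increasing2)
next
  case False
  then have "x powr p = x powr (p - 2) * x\<^sup>2"
    using assms by (simp add: powr_diff)
  also have "\<dots> \<le> d powr (p - 2) * x\<^sup>2"
    using False assms by (intro mult_right_mono powr_mono2') auto
  finally show ?thesis by (simp add: add_increasing)
qed

text \<open>Integrate \<open>x\<^sup>p \<le> d\<^sup>p + d\<^sup>p\<^sup>-\<^sup>2 x\<^sup>2\<close>. The constant is crude but enough here.\<close>

lemma Lp_norm_le_of_L2: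
  assumes p: "1 < p" "p \<le> 2" and d: "0 < d" and f: "continuous_on (sphere 0 1) f"
    and L2: "(LINT t|circle. (cmod (f t))\<^sup>2) \<le> d\<^sup>2"
  shows "Lp_norm p (cf f) \<le> 2 * d"
proof -
  have [measurable]: "f \<in> borel_measurable circle" using f by (rule continuous_circle_measurable)
  have "integrable circle (\<lambda>t. complex_of_real ((cmod (f t))\<^sup>2))"
    by (intro continuous_circle_integrable continuous_intros f)
  then have int2: "integrable circle (\<lambda>t. (cmod (f t))\<^sup>2)"
    by (simp only: complex_of_real_integrable_eq)
  have "Lp_norm p (cf f) powr p = (LINT t|circle. cmod (f t) powr p)"
    using p by (intro Lp_norm_powr_cf) auto
  also have "\<dots> \<le> (LINT t|circle. d powr p + d powr (p - 2) * (cmod (f t))\<^sup>2)"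
    using continuous_Lp[OF _ f, of p] p d int2
    by (intro integral_mono powr_le_square) (auto simp: cf_in_Lp_iff)
  also have "\<dots> = d powr p + d powr (p - 2) * (LINT t|circle. (cmod (f t))\<^sup>2)"
    using int2 by simp
  also have "\<dots> \<le> d powr p + d powr (p - 2) * d\<^sup>2"
    using L2 by (intro add_left_mono mult_left_mono) auto
  also have "\<dots> = 2 * d powr p" using d by (simp add: powr_diff)
  also have "\<dots> \<le> 2 powr p * d powr p"
    using p powr_mono[of 1 p "2::real"] by (intro mult_right_mono) auto
  also have "\<dots> = (2 * d) powr p" using d by (simp add: powr_mult)
  finally have le: "Lp_norm p (cf f) powr p \<le> (2 * d) powr p" .
  show ?thesis
  proof (rule ccontr)
    assume "\<not> Lp_norm p (cf f) \<le> 2 * d"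
    then have "(2 * d) powr p < Lp_norm p (cf f) powr p"
      using p d by (intro powr_less_mono2) auto
    with le show False by simp
  qed
qed

text \<open>Split \<open>f\<close> into the positive and negative parts of its real and imaginary parts. These are
  continuous but not polynomial; raised by \<open>e\<close> they are approximated up to \<open>e\<close> by polynomials,
  which are then positive, so that \<open>riesz_positive\<close> applies. The remainder is uniformly small, and
  its analytic part is small in \<open>L\<^sup>2\<close> by Parseval, hence in \<open>L\<^sup>p\<close>, as \<open>p \<le> 2\<close>.\<close>

lemma riesz_small_p:
  assumes p: "1 < p" "p \<le> 2"
  obtains C where "0 \<le> C"
    "\<And>S c. finite S \<Longrightarrow> Lp_norm p (cf (tp {n\<in>S. 0 \<le> n} c)) \<le> C * Lp_norm p (cf (tp S c))"
proof -
  obtain C where C: "0 \<le> C"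
    "\<And>N c g. (\<And>t. t \<in> sphere 0 1 \<Longrightarrow> tp {-int N..int N} c t = complex_of_real (g t) \<and> 0 < g t) \<Longrightarrow>
       Lp_norm p (cf (tp {0..int N} c)) \<le> C * Lp_norm p (cf (tp {-int N..int N} c))"
    using riesz_positive[OF p] by metis
  have posS: "Lp_norm p (cf (tp {n\<in>S. 0 \<le> n} c)) \<le> C * Lp_norm p (cf (tp S c))"
    if fin: "finite S" and g: "\<And>t. t \<in> sphere 0 1 \<Longrightarrow> tp S c t = complex_of_real (g t) \<and> 0 < g t" for S c g
  proof -
    obtain N c' where N: "tp S c = tp {-int N..int N} c'" "tp {n\<in>S. 0 \<le> n} c = tp {0..int N} c'"
      using tp_symmetric_interval[OF fin] by metis
    show ?thesis unfolding N using g unfolding N by (rule C(2))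
  qed
  have main: "Lp_norm p (cf (tp {n\<in>S. 0 \<le> n} c)) \<le> 4 * C * Lp_norm p (cf (tp S c)) + (8 * C + 16) * e"
    if S: "finite S" and e: "0 < e" for S c e
  proof -
    define f where "f = tp S c"
    have contf: "continuous_on (sphere 0 1) f" unfolding f_def by (rule continuous_tp)
    have fLp: "cf f \<in> Lp p" unfolding f_def using p by (intro tp_Lp) auto
    have [measurable]: "f \<in> borel_measurable circle" unfolding f_def by measurable
    \<comment> \<open>The four parts \<open>u j\<close> enter \<open>f\<close> with the factors \<open>1, \<i>, -1, -\<i>\<close>.\<close>
    define a :: "nat \<Rightarrow> complex" where "a j = \<i> ^ j" for j
    define u where "u j t = max 0 (Re (cnj (a j) * f t))" for j t
    have cu: "continuous_on (sphere 0 1) (\<lambda>t. u j t + e)" for j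
      unfolding u_def by (intro continuous_intros contf)
    have "\<exists>S d g. finite S \<and> (\<forall>t\<in>sphere 0 1. tp S d t = complex_of_real (g t) \<and> \<bar>u j t + e - g t\<bar> < e)" for j
      using real_continuous_trig_approx[OF cu[of j] e] by metis
    then obtain T d g where T: "\<And>j. finite (T j)" "\<And>j t. t \<in> sphere 0 1 \<Longrightarrow> tp (T j) (d j) t = complex_of_real (g j t)"
      "\<And>j t. t \<in> sphere 0 1 \<Longrightarrow> \<bar>u j t + e - g j t\<bar> < e" by metis
    have gpos: "0 < g j t" "g j t - u j t < 2 * e" "g j t > u j t" if "t \<in> sphere 0 1" for j t
      using T(3)[OF that, of j] by (auto simp: u_def abs_less_iff)
    \<comment> \<open>All polynomials are rewritten over one frequency set, with zero coefficients added.\<close>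
    define U where "U = S \<union> (\<Union>j<4. T j)"
    have finU: "finite U" using S T(1) by (auto simp: U_def)
    define d' where "d' j n = (if n \<in> T j then d j n else 0)" for j n
    define c' where "c' n = (if n \<in> S then c n else 0)" for n
    define r where "r n = c' n - (\<Sum>j<4. a j * d' j n)" for n
    have tpT: "tp (T j) (d j) = tp U (d' j)" "tp {n\<in>T j. 0 \<le> n} (d j) = tp {n\<in>U. 0 \<le> n} (d' j)" if "j < 4" for j
    proof -
      have sub: "T j \<subseteq> U" using that by (auto simp: U_def)
      show "tp (T j) (d j) = tp U (d' j)" unfolding d'_def using finU sub by (rule tp_eq_superset)
      show "tp {n\<in>T j. 0 \<le> n} (d j) = tp {n\<in>U. 0 \<le> n} (d' j)"
        unfolding tp_def d'_def using finU sub by (intro ext sum.mono_neutral_cong_left) auto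
    qed
    have tpS: "f = tp U c'" "tp {n\<in>S. 0 \<le> n} c = tp {n\<in>U. 0 \<le> n} c'"
    proof -
      have sub: "S \<subseteq> U" by (auto simp: U_def)
      show "f = tp U c'" unfolding f_def c'_def using finU sub by (rule tp_eq_superset)
      show "tp {n\<in>S. 0 \<le> n} c = tp {n\<in>U. 0 \<le> n} c'"
        unfolding tp_def c'_def using finU sub by (intro ext sum.mono_neutral_cong_left) auto
    qed
    have rsum: "tp V r t = tp V c' t - (\<Sum>j<4. a j * tp V (d' j) t)" for V t
      unfolding r_def tp_diff by (simp add: tp_def sum_distrib_left sum_distrib_right mult.assoc sum.swap[of _ V])
    have na [simp]: "cmod (a j) = 1" for j by (simp add: a_def norm_power)
    have fu: "f t = (\<Sum>j<4. a j * complex_of_real (u j t))" for t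
      by (auto simp: u_def a_def eval_nat_numeral complex_eq_iff max_def)
    have small: "cmod (tp U r t) \<le> 8 * e" if t: "t \<in> sphere 0 1" for t
    proof -
      have "(\<Sum>j<4. a j * tp U (d' j) t) = (\<Sum>j<4. a j * complex_of_real (g j t))"
        by (intro sum.cong refl) (simp add: T(2)[OF t, symmetric] tpT(1))
      then have "tp U r t = (\<Sum>j<4. a j * complex_of_real (u j t)) - (\<Sum>j<4. a j * complex_of_real (g j t))"
        unfolding rsum tpS(1)[symmetric] fu[symmetric] by simp
      also have "\<dots> = (\<Sum>j<4. a j * complex_of_real (u j t - g j t))"
        by (simp add: sum_subtractf right_diff_distrib)
      also have "cmod \<dots> \<le> (\<Sum>j<4. cmod (a j * complex_of_real (u j t - g j t)))" by (rule norm_sum)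
      also have "\<dots> \<le> (\<Sum>j<4::nat. 2 * e)"
      proof (rule sum_mono)
        fix j
        have "cmod (a j * complex_of_real (u j t - g j t)) = \<bar>u j t - g j t\<bar>"
          unfolding norm_mult na norm_of_real by simp
        also have "\<dots> \<le> 2 * e" using gpos(2,3)[OF t, of j] by simp
        finally show "cmod (a j * complex_of_real (u j t - g j t)) \<le> 2 * e" .
      qed
      finally show ?thesis by simp
    qed
    have err: "Lp_norm p (cf (tp {n\<in>U. 0 \<le> n} r)) \<le> 2 * (8 * e)"
    proof (rule Lp_norm_le_of_L2[OF p])
      have "(LINT t|circle. (cmod (tp {n\<in>U. 0 \<le> n} r t))\<^sup>2) = (\<Sum>n\<in>{n\<in>U. 0 \<le> n}. (cmod (r n))\<^sup>2)"
        using finU by (intro parseval_tp) auto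
      also have "\<dots> \<le> (\<Sum>n\<in>U. (cmod (r n))\<^sup>2)" using finU by (intro sum_mono2) auto
      also have "\<dots> = (LINT t|circle. (cmod (tp U r t))\<^sup>2)" using parseval_tp[OF finU] by simp
      also have "\<dots> \<le> (LINT t|circle. (8 * e)\<^sup>2)"
      proof (rule integral_mono)
        show "integrable circle (\<lambda>t. (cmod (tp U r t))\<^sup>2)"
          using power_mono[OF small norm_ge_zero, of _ 2]
          by (intro circle.integrable_const_bound[where B = "(8 * e)\<^sup>2"]) (auto intro!: AE_I2)
        show "(cmod (tp U r t))\<^sup>2 \<le> (8 * e)\<^sup>2" if "t \<in> space circle" for t
          using small[of t] that by (intro power_mono) auto
      qed auto
      also have "\<dots> = (8 * e)\<^sup>2" by simp
      finally show "(LINT t|circle. (cmod (tp {n\<in>U. 0 \<le> n} r t))\<^sup>2) \<le> (8 * e)\<^sup>2" .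
    qed (use e in \<open>auto intro: continuous_tp\<close>)
    have qj: "Lp_norm p (cf (tp {n\<in>U. 0 \<le> n} (d' j))) \<le> C * (Lp_norm p (cf f) + 2 * e)" if j: "j < 4" for j
    proof -
      have "Lp_norm p (cf (tp {n\<in>U. 0 \<le> n} (d' j))) \<le> C * Lp_norm p (cf (tp (T j) (d j)))"
        unfolding tpT(2)[OF j, symmetric] using T gpos(1) by (intro posS[of _ _ "g j"]) auto
      also have "Lp_norm p (cf (tp (T j) (d j))) \<le> Lp_norm p (cf (\<lambda>t. complex_of_real (cmod (f t) + 2 * e)))"
      proof (rule cf_Lp_mono(2))
        show "cf (\<lambda>t. complex_of_real (cmod (f t) + 2 * e)) \<in> Lp p"
          using p by (intro continuous_Lp continuous_intros contf) simp
        have "cmod (tp (T j) (d j) t) \<le> cmod (complex_of_real (cmod (f t) + 2 * e))" if t: "t \<in> sphere 0 1" for t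
        proof -
          have "cmod (tp (T j) (d j) t) = g j t" using T(2)[OF t, of j] gpos(1)[OF t, of j] by simp
          also have "\<dots> \<le> u j t + 2 * e" using gpos(2)[OF t, of j] by simp
          also have "u j t \<le> cmod (f t)"
            using abs_Re_le_cmod[of "cnj (a j) * f t"] by (simp add: u_def norm_mult abs_le_iff)
          also have "cmod (f t) + 2 * e = cmod (complex_of_real (cmod (f t) + 2 * e))"
            using e by (simp only: norm_of_real abs_of_nonneg add_nonneg_nonneg norm_ge_zero mult_nonneg_nonneg zero_le_numeral less_imp_le)
          finally show ?thesis by simp
        qed
        then show "AE t in circle. cmod (tp (T j) (d j) t) \<le> cmod (complex_of_real (cmod (f t) + 2 * e))"
          by (intro AE_I2) simp
        show "(\<lambda>t. complex_of_real (cmod (f t) + 2 * e)) \<in> borel_measurable circle"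
          by (intro continuous_circle_measurable continuous_intros contf)
        show "0 < p" using p by simp
      qed (rule tp_measurable)
      also have "cf (\<lambda>t. complex_of_real (cmod (f t) + 2 * e)) = cf (\<lambda>t. complex_of_real (cmod (f t))) + cf (\<lambda>t. complex_of_real (2 * e))"
        by (subst cf_add) (auto intro!: continuous_circle_measurable continuous_intros contf)
      also have "Lp_norm p \<dots> \<le> Lp_norm p (cf (\<lambda>t. complex_of_real (cmod (f t)))) + Lp_norm p (cf (\<lambda>t. complex_of_real (2 * e)))"
        using p const_Lp[of "complex_of_real (2 * e)" p]
        by (auto intro!: Lp_norm_triangle continuous_Lp continuous_intros contf)
      also have "Lp_norm p (cf (\<lambda>t. complex_of_real (cmod (f t)))) = Lp_norm p (cf f)"
        by (rule Lp_norm_unimodular(1)) auto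
      also have "Lp_norm p (cf (\<lambda>t. complex_of_real (2 * e))) = 2 * e"
        using p e by (subst Lp_norm_const) auto
      finally show ?thesis using C(1) by (simp add: mult_left_mono)
    qed
    have decomp: "cf (tp {n\<in>U. 0 \<le> n} c') = cf (tp {n\<in>U. 0 \<le> n} r) + (\<Sum>j<4. cscale (a j) (cf (tp {n\<in>U. 0 \<le> n} (d' j))))"
      by (simp add: eval_nat_numeral cscale_cf cf_add rsum add.assoc)
    have "Lp_norm p (cf (tp {n\<in>U. 0 \<le> n} c'))
        \<le> Lp_norm p (cf (tp {n\<in>U. 0 \<le> n} r)) + Lp_norm p (\<Sum>j<4. cscale (a j) (cf (tp {n\<in>U. 0 \<le> n} (d' j))))"
      unfolding decomp using p by (intro Lp_norm_triangle Lp_sum Lp_cscale tp_Lp) auto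
    also have "\<dots> \<le> 2 * (8 * e) + (\<Sum>j<4. Lp_norm p (cscale (a j) (cf (tp {n\<in>U. 0 \<le> n} (d' j)))))"
      using p by (intro add_mono err Lp_norm_sum Lp_cscale tp_Lp) auto
    also have "\<dots> \<le> 2 * (8 * e) + (\<Sum>j<4::nat. C * (Lp_norm p (cf f) + 2 * e))"
      using p qj by (intro add_left_mono sum_mono) (simp add: Lp_norm_cscale)
    also have "\<dots> = 4 * C * Lp_norm p (cf f) + (8 * C + 16) * e" by (simp add: algebra_simps)
    finally show ?thesis unfolding tpS(2) f_def .
  qed
  show thesis
  proof
    show "0 \<le> 4 * C" using C by simp
    fix S :: "int set" and c :: "int \<Rightarrow> complex" assume S: "finite S"
    let ?K = "8 * C + 16"
    show "Lp_norm p (cf (tp {n\<in>S. 0 \<le> n} c)) \<le> 4 * C * Lp_norm p (cf (tp S c))"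
    proof (rule field_le_epsilon)
      fix e :: real assume "0 < e"
      then show "Lp_norm p (cf (tp {n\<in>S. 0 \<le> n} c)) \<le> 4 * C * Lp_norm p (cf (tp S c)) + e"
        using main[OF S, of "e / ?K" c] C(1) by (simp add: add_nonneg_pos)
    qed
  qed
qed

lemma pairing_cnj_tp:
  assumes "finite S" "finite T"
  shows "(LINT t|circle. tp S c t * cnj (tp T d t)) = (\<Sum>n\<in>S \<inter> T. c n * cnj (d n))"
proof -
  have "(LINT t|circle. tp S c t * cnj (tp T d t)) = (LINT t|circle. (\<Sum>n\<in>T. cnj (d n) * (tp S c t * t powi (- n))))"
    by (intro Bochner_Integration.integral_cong refl)
       (auto simp: tp_def[of T] cnj_powi_circle sum_distrib_left mult_ac)
  also have "\<dots> = (\<Sum>n\<in>T. cnj (d n) * fourier_coeff (cf (tp S c)) n)"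
    by (subst Bochner_Integration.integral_sum)
       (auto simp: fourier_coeff_cf intro!: continuous_circle_integrable continuous_intros)
  also have "\<dots> = (\<Sum>n\<in>T. if n \<in> S then c n * cnj (d n) else 0)"
    by (intro sum.cong refl) (simp add: fourier_coeff_tp[OF assms(1)] mult.commute)
  also have "\<dots> = (\<Sum>n\<in>T \<inter> S. c n * cnj (d n))"
    using assms(2) by (simp add: sum.inter_restrict)
  finally show ?thesis by (simp add: Int_commute)
qed

text \<open>Duality with the exponent \<open>q < 2\<close>. For \<open>h = P f\<close> put \<open>G = h \<bar>h\<bar>\<^sup>p\<^sup>-\<^sup>2\<close>, so that
  \<open>\<integral> h cnj G = \<parallel>h\<parallel>\<^sup>p\<close> and \<open>\<parallel>G\<parallel>\<^sub>q = \<parallel>h\<parallel>\<^sup>p\<^sup>-\<^sup>1\<close>. If \<open>G\<close> is replaced by a trigonometric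
  polynomial \<open>Q\<close> close to it, the projection can be moved to the other side:
  \<open>\<integral> P f cnj Q = \<integral> f cnj (P Q)\<close>, which is at most \<open>C \<parallel>f\<parallel>\<^sub>p \<parallel>Q\<parallel>\<^sub>q\<close>.\<close>

lemma riesz_large_p:
  assumes p: "2 < p"
  obtains C where "0 \<le> C"
    "\<And>S c. finite S \<Longrightarrow> Lp_norm p (cf (tp {n\<in>S. 0 \<le> n} c)) \<le> C * Lp_norm p (cf (tp S c))"
proof -
  have p1: "1 < p" using p by simp
  obtain q where q: "1 < q" "1 / p + 1 / q = 1" "q = p / (p - 1)" using conjugate_exponent[OF p1] by metis
  have q2: "q \<le> 2" unfolding q(3) using p by (simp add: field_simps)
  obtain C where C: "0 \<le> C"
    "\<And>S c. finite S \<Longrightarrow> Lp_norm q (cf (tp {n\<in>S. 0 \<le> n} c)) \<le> C * Lp_norm q (cf (tp S c))"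
    using riesz_small_p[OF q(1) q2] by metis
  show thesis
  proof
    show "0 \<le> C" by (rule C(1))
    fix S :: "int set" and c :: "int \<Rightarrow> complex" assume S: "finite S"
    define f where "f = tp S c"
    define h where "h = tp {n\<in>S. 0 \<le> n} c"
    have fLp: "cf f \<in> Lp p" "cf h \<in> Lp p" using p by (auto simp: f_def h_def intro: tp_Lp)
    have fm [measurable]: "f \<in> borel_measurable circle" "h \<in> borel_measurable circle" by (auto simp: f_def h_def)
    define G where "G t = h t * complex_of_real (cmod (h t) powr (p - 2))" for t
    have ch: "continuous_on (sphere 0 1) h" unfolding h_def by (rule continuous_tp)
    have "continuous_on (sphere 0 1) G"
      unfolding G_def using p by (intro continuous_intros ch continuous_on_powr') auto
    then have Gm [measurable]: "G \<in> borel_measurable circle" and GLq: "cf G \<in> Lp q"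
      using q by (auto intro: continuous_circle_measurable continuous_Lp)
    have nG: "cmod (G t) = cmod (h t) powr (p - 1)" for t
    proof (cases "h t = 0")
      case False
      have "cmod (G t) = cmod (h t) * cmod (h t) powr ((p - 1) - 1)" by (simp add: G_def norm_mult)
      also have "\<dots> = cmod (h t) powr (p - 1)"
        using False unfolding powr_diff[of _ "p - 1" 1] by simp
      finally show ?thesis .
    qed (simp add: G_def)
    have hG: "h t * cnj (G t) = complex_of_real (cmod (h t) powr p)" for t
    proof (cases "h t = 0")
      case False
      have "h t * cnj (G t) = (h t * cnj (h t)) * complex_of_real (cmod (h t) powr (p - 2))"
        by (simp add: G_def)
      also have "\<dots> = complex_of_real ((cmod (h t))\<^sup>2 * cmod (h t) powr (p - 2))"
        by (simp add: complex_norm_square[symmetric])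
      also have "(cmod (h t))\<^sup>2 * cmod (h t) powr (p - 2) = cmod (h t) powr p"
        using False by (simp add: powr_diff)
      finally show ?thesis .
    qed (simp add: G_def)
    define I where "I = (LINT t|circle. cmod (h t) powr p)"
    have I0: "0 \<le> I" unfolding I_def by simp
    have normh: "Lp_norm p (cf h) = I powr (1 / p)" by (simp add: Lp_norm_cf I_def)
    have normG: "Lp_norm q (cf G) = I powr (1 / q)"
      using p by (simp add: Lp_norm_cf I_def nG powr_powr q(3))
    have cnjLq: "cf (\<lambda>t. cnj (g t)) \<in> Lp q" "Lp_norm q (cf (\<lambda>t. cnj (g t))) = Lp_norm q (cf g)"
      "(\<lambda>t. cnj (g t)) \<in> borel_measurable circle"
      if "g \<in> borel_measurable circle" "cf g \<in> Lp q" for g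
    proof -
      have "cnj \<in> borel_measurable borel" by (intro borel_measurable_continuous_onI continuous_intros)
      then show m: "(\<lambda>t. cnj (g t)) \<in> borel_measurable circle" using that(1) measurable_compose by blast
      show "cf (\<lambda>t. cnj (g t)) \<in> Lp q" "Lp_norm q (cf (\<lambda>t. cnj (g t))) = Lp_norm q (cf g)"
        using Lp_norm_unimodular[OF m that(1)] that(2) by auto
    qed
    have dual: "I \<le> C * Lp_norm p (cf f) * Lp_norm q (cf G) + (C * Lp_norm p (cf f) + Lp_norm p (cf h)) * e"
      if e: "0 < e" for e
    proof -
      obtain T d where T: "finite T" "Lp_norm q (cf G - cf (tp T d)) < e"
        using trig_approx[OF _ GLq e] q(1) by auto
      define Q where "Q = tp T d"
      have QLq: "cf Q \<in> Lp q" "Q \<in> borel_measurable circle" using q by (auto simp: Q_def intro: tp_Lp)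
      define Q' where "Q' = tp {n\<in>T. 0 \<le> n} d"
      have Q'Lq: "cf Q' \<in> Lp q" "Q' \<in> borel_measurable circle" using q by (auto simp: Q'_def intro: tp_Lp)
      note [measurable] = QLq(2) Q'Lq(2)
      define D where "D t = G t - Q t" for t
      have DLq: "cf D \<in> Lp q" "Lp_norm q (cf D) < e" "D \<in> borel_measurable circle"
        using Lp_diff[of q "cf G" "cf Q"] GLq QLq q T by (auto simp: cf_diff D_def[abs_def] Q_def)
      have "complex_of_real I = (LINT t|circle. h t * cnj (G t))"
        by (simp add: hG I_def)
      also have "\<dots> = (LINT t|circle. h t * cnj (Q t) + h t * cnj (D t))"
        by (intro Bochner_Integration.integral_cong refl) (simp add: D_def algebra_simps)
      also have "\<dots> = (LINT t|circle. h t * cnj (Q t)) + (LINT t|circle. h t * cnj (D t))"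
        using Lp_hoelder(1)[OF p1 q(1,2) fm(2) cnjLq(3)[OF QLq(2,1)] fLp(2) cnjLq(1)[OF QLq(2,1)]]
          Lp_hoelder(1)[OF p1 q(1,2) fm(2) cnjLq(3)[OF DLq(3,1)] fLp(2) cnjLq(1)[OF DLq(3,1)]]
        by (rule Bochner_Integration.integral_add)
      also have "(LINT t|circle. h t * cnj (Q t)) = (LINT t|circle. f t * cnj (Q' t))"
      proof -
        have "{n\<in>S. 0 \<le> n} \<inter> T = S \<inter> {n\<in>T. 0 \<le> n}" by auto
        then show ?thesis using S T(1) by (simp add: h_def f_def Q_def Q'_def pairing_cnj_tp)
      qed
      finally have "cmod (complex_of_real I)
          \<le> cmod (LINT t|circle. f t * cnj (Q' t)) + cmod (LINT t|circle. h t * cnj (D t))"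
        using norm_triangle_ineq by metis
      also have "\<dots> \<le> Lp_norm p (cf f) * Lp_norm q (cf Q') + Lp_norm p (cf h) * Lp_norm q (cf D)"
        using Lp_hoelder(2)[OF p1 q(1,2) fm(1) cnjLq(3)[OF Q'Lq(2,1)] fLp(1) cnjLq(1)[OF Q'Lq(2,1)]]
          Lp_hoelder(2)[OF p1 q(1,2) fm(2) cnjLq(3)[OF DLq(3,1)] fLp(2) cnjLq(1)[OF DLq(3,1)]]
        unfolding cnjLq(2)[OF Q'Lq(2,1)] cnjLq(2)[OF DLq(3,1)] by (rule add_mono)
      also have "\<dots> \<le> Lp_norm p (cf f) * (C * (Lp_norm q (cf G) + e)) + Lp_norm p (cf h) * e"
      proof (intro add_mono mult_left_mono)
        have "Lp_norm q (cf Q') \<le> C * Lp_norm q (cf Q)" unfolding Q'_def Q_def by (rule C(2)[OF T(1)])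
        also have "Lp_norm q (cf Q) = Lp_norm q (cf G - cf D)"
          by (simp add: D_def[abs_def] cf_diff)
        also have "\<dots> \<le> Lp_norm q (cf G) + Lp_norm q (cf D)" using q GLq DLq by (intro Lp_norm_diff_le) auto
        finally show "Lp_norm q (cf Q') \<le> C * (Lp_norm q (cf G) + e)"
          using C(1) DLq(2) by (smt (verit, best) mult_left_mono)
      qed (use DLq in auto)
      finally show ?thesis using I0 by (simp add: algebra_simps)
    qed
    have "I \<le> C * Lp_norm p (cf f) * Lp_norm q (cf G)"
    proof (rule field_le_epsilon)
      fix e :: real assume e: "0 < e"
      let ?K = "C * Lp_norm p (cf f) + Lp_norm p (cf h) + 1"
      have K: "0 < ?K" using C(1) by (simp add: add_nonneg_pos)
      have "I \<le> C * Lp_norm p (cf f) * Lp_norm q (cf G) + (?K - 1) * (e / ?K)"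
        using dual[of "e / ?K"] e K by simp
      also have "(?K - 1) * (e / ?K) \<le> ?K * (e / ?K)" using e K by (intro mult_right_mono) auto
      also have "\<dots> = e" using K by simp
      finally show "I \<le> C * Lp_norm p (cf f) * Lp_norm q (cf G) + e" by simp
    qed
    then have le: "I \<le> C * Lp_norm p (cf f) * I powr (1 / q)" by (simp add: normG)
    have "I powr (1 / p) \<le> C * Lp_norm p (cf f)"
    proof (cases "I = 0")
      case False
      then have Ipos: "0 < I" using I0 by simp
      have "I powr (1 / p) * I powr (1 / q) = I powr 1" using q(2) by (simp add: powr_add[symmetric])
      also have "\<dots> \<le> C * Lp_norm p (cf f) * I powr (1 / q)" using le Ipos by simp
      finally show ?thesis using Ipos by simp
    qed (use C in simp)
    then show "Lp_norm p (cf (tp {n\<in>S. 0 \<le> n} c)) \<le> C * Lp_norm p (cf (tp S c))"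
      using normh by (simp add: f_def h_def)
  qed
qed

theorem riesz_trig:
  assumes "1 < p"
  obtains C where "0 \<le> C"
    "\<And>S c. finite S \<Longrightarrow> Lp_norm p (cf (tp {n\<in>S. 0 \<le> n} c)) \<le> C * Lp_norm p (cf (tp S c))"
proof (cases "p \<le> 2")
  case True
  show thesis using riesz_small_p[OF assms True] that by metis
next
  case False
  then have "2 < p" by simp
  then show thesis using riesz_large_p that by metis
qed

section \<open>Completeness of \<open>L\<^sup>p\<close>\<close>

lemma Lp_fatou:
  assumes p: "1 \<le> p" and [measurable]: "u \<in> borel_measurable circle" "\<And>l. v l \<in> borel_measurable circle"
    and lim: "AE t in circle. (\<lambda>l. v l t) \<longlonglongrightarrow> u t"
    and bound: "\<And>l. cf (v l) \<in> Lp p" "\<And>l. Lp_norm p (cf (v l)) \<le> e"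
  shows "cf u \<in> Lp p" "Lp_norm p (cf u) \<le> e"
proof -
  have e: "0 \<le> e" using bound(2)[of 0] Lp_norm_nonneg order_trans by blast
  have "(\<integral>\<^sup>+t. ennreal (cmod (u t) powr p) \<partial>circle) = (\<integral>\<^sup>+t. liminf (\<lambda>l. ennreal (cmod (v l t) powr p)) \<partial>circle)"
  proof (rule nn_integral_cong_AE)
    show "AE t in circle. ennreal (cmod (u t) powr p) = liminf (\<lambda>l. ennreal (cmod (v l t) powr p))"
      using lim
    proof eventually_elim
      case (elim t)
      have "(\<lambda>l. cmod (v l t) powr p) \<longlonglongrightarrow> cmod (u t) powr p"
        using p elim by (intro tendsto_powr' tendsto_intros) auto
      then have "(\<lambda>l. ennreal (cmod (v l t) powr p)) \<longlonglongrightarrow> ennreal (cmod (u t) powr p)"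
        by (rule tendsto_ennrealI)
      then show ?case using lim_imp_Liminf[OF sequentially_bot] by metis
    qed
  qed
  also have "\<dots> \<le> liminf (\<lambda>l. \<integral>\<^sup>+t. ennreal (cmod (v l t) powr p) \<partial>circle)"
    by (rule nn_integral_liminf) measurable
  also have "\<dots> \<le> liminf (\<lambda>l. ennreal (e powr p))"
  proof (rule Liminf_mono, rule always_eventually, rule allI)
    fix l
    have "(\<integral>\<^sup>+t. ennreal (cmod (v l t) powr p) \<partial>circle) = ennreal (LINT t|circle. cmod (v l t) powr p)"
      using bound(1)[of l] by (intro nn_integral_eq_integral) (auto simp: cf_in_Lp_iff)
    also have "(LINT t|circle. cmod (v l t) powr p) = Lp_norm p (cf (v l)) powr p"
      using p by (simp add: Lp_norm_powr_cf)
    also have "\<dots> \<le> e powr p" using bound(2)[of l] p by (intro powr_mono2) auto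
    finally show "(\<integral>\<^sup>+t. ennreal (cmod (v l t) powr p) \<partial>circle) \<le> ennreal (e powr p)" by (simp add: ennreal_leI)
  qed
  also have "\<dots> = ennreal (e powr p)" by (simp add: Liminf_const)
  finally have le: "(\<integral>\<^sup>+t. ennreal (cmod (u t) powr p) \<partial>circle) \<le> ennreal (e powr p)" .
  then have int: "integrable circle (\<lambda>t. cmod (u t) powr p)"
    by (intro integrableI_nonneg) (auto intro: le_less_trans)
  then show "cf u \<in> Lp p" by (simp add: cf_in_Lp_iff)
  have "ennreal (LINT t|circle. cmod (u t) powr p) \<le> ennreal (e powr p)"
    using le int by (subst (asm) nn_integral_eq_integral) auto
  then have "(LINT t|circle. cmod (u t) powr p) \<le> e powr p" by simp
  then have "(LINT t|circle. cmod (u t) powr p) powr (1 / p) \<le> (e powr p) powr (1 / p)"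
    using p by (intro powr_mono2) auto
  then show "Lp_norm p (cf u) \<le> e"
    using p e by (simp add: Lp_norm_cf powr_powr)
qed

text \<open>The differences decay like \<open>4\<^sup>-\<^sup>k\<close> in norm, so the \<open>p\<close>-th powers of \<open>2\<^sup>k \<bar>f\<^sub>k\<^sub>+\<^sub>1 - f\<^sub>k\<bar>\<close> still have
  summable integrals. Almost everywhere these numbers tend to zero, and the differences are dominated by
  \<open>2\<^sup>-\<^sup>k\<close>.\<close>

lemma fast_Cauchy_converges_AE:
  assumes p: "1 \<le> p" and [measurable]: "\<And>k. f k \<in> borel_measurable circle"
    and Lp: "\<And>k. cf (f k) \<in> Lp p"
    and fast: "\<And>k. Lp_norm p (cf (f (Suc k)) - cf (f k)) \<le> (1/4) ^ k"
  shows "AE t in circle. convergent (\<lambda>k. f k t)"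
proof -
  define d where "d k t = (2 ^ k * cmod (f (Suc k) t - f k t)) powr p" for k t
  have [measurable]: "d k \<in> borel_measurable circle" for k unfolding d_def by measurable
  have int: "(\<integral>\<^sup>+t. ennreal (d k t) \<partial>circle) \<le> ennreal ((1/2) ^ k)" for k
  proof -
    have diffLp: "cf (\<lambda>t. f (Suc k) t - f k t) \<in> Lp p"
      using Lp_diff[OF p Lp[of "Suc k"] Lp[of k]] by (simp add: cf_diff)
    have deq: "d k t = (2 ^ k) powr p * cmod (f (Suc k) t - f k t) powr p" for t
      by (simp add: d_def powr_mult)
    have "(\<integral>\<^sup>+t. ennreal (d k t) \<partial>circle) = ennreal (LINT t|circle. d k t)"
      using diffLp unfolding deq by (intro nn_integral_eq_integral) (auto simp: cf_in_Lp_iff)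
    also have "(LINT t|circle. d k t) = (2 ^ k) powr p * Lp_norm p (cf (f (Suc k)) - cf (f k)) powr p"
      using p unfolding deq by (simp add: cf_diff Lp_norm_powr_cf)
    also have "\<dots> \<le> (2 ^ k) powr p * ((1/4) ^ k) powr p"
      using p fast by (intro mult_left_mono powr_mono2) auto
    also have "\<dots> = ((1/2) ^ k) powr p"
      by (simp add: powr_mult[symmetric] power_mult_distrib[symmetric])
    also have "\<dots> \<le> ((1/2) ^ k) powr 1"
      using p by (intro powr_mono') (auto simp: power_le_one)
    finally show ?thesis by (simp add: ennreal_leI)
  qed
  have "(\<integral>\<^sup>+t. (\<Sum>k. ennreal (d k t)) \<partial>circle) = (\<Sum>k. \<integral>\<^sup>+t. ennreal (d k t) \<partial>circle)"
    by (rule nn_integral_suminf) measurable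
  also have "\<dots> \<le> (\<Sum>k. ennreal ((1/2) ^ k))"
    by (intro suminf_le int) auto
  also have "\<dots> = ennreal (\<Sum>k. (1/2) ^ k)"
    by (intro suminf_ennreal2) (auto simp: summable_geometric)
  finally have "(\<integral>\<^sup>+t. (\<Sum>k. ennreal (d k t)) \<partial>circle) \<noteq> \<infinity>"
    by (auto simp: top_unique)
  then have "AE t in circle. (\<Sum>k. ennreal (d k t)) \<noteq> \<infinity>"
    by (intro nn_integral_noteq_infinite) auto
  then show ?thesis
  proof eventually_elim
    case (elim t)
    then have "summable (\<lambda>k. d k t)"
      by (intro summable_suminf_not_top) (auto simp: d_def)
    then have "(\<lambda>k. d k t) \<longlonglongrightarrow> 0" by (rule summable_LIMSEQ_zero)
    then have "eventually (\<lambda>k. d k t < 1) sequentially"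
      by (rule order_tendstoD) simp
    then have ev: "eventually (\<lambda>k. norm (f (Suc k) t - f k t) \<le> (1/2) ^ k) sequentially"
    proof eventually_elim
      case (elim k)
      have "2 ^ k * cmod (f (Suc k) t - f k t) < 1"
      proof (rule ccontr)
        assume "\<not> ?thesis"
        then have "1 \<le> d k t" unfolding d_def using p by (intro ge_one_powr_ge_zero) auto
        with elim show False by simp
      qed
      then show ?case by (simp add: power_divide field_simps)
    qed
    have "summable (\<lambda>k. f (Suc k) t - f k t)"
      by (rule summable_comparison_test_ev[OF ev]) (auto simp: summable_geometric)
    then have "convergent (\<lambda>n. \<Sum>k<n. f (Suc k) t - f k t)" by (simp add: summable_iff_convergent)
    then have "convergent (\<lambda>n. (f n t - f 0 t) + f 0 t)"
      using sum_lessThan_telescope[of "\<lambda>k. f k t"] by (intro convergent_add convergent_const) simp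
    then show ?case by simp
  qed
qed

text \<open>A rapidly converging subsequence has an almost everywhere limit, and Fatou's lemma shows
  that the whole sequence converges to it in norm.\<close>

theorem Lp_complete:
  assumes p: "1 \<le> p" and x: "\<And>n. x n \<in> Lp p"
    and Cauchy: "\<And>e. 0 < e \<Longrightarrow> \<exists>N. \<forall>m\<ge>N. \<forall>n\<ge>N. Lp_norm p (x m - x n) \<le> e"
  obtains y where "y \<in> Lp p" "(\<lambda>n. Lp_norm p (x n - y)) \<longlonglongrightarrow> 0"
proof -
  have "\<exists>f. f \<in> borel_measurable circle \<and> x n = cf f" for n using cf_cases[of "x n"] by metis
  then obtain h where h [measurable]: "\<And>n. h n \<in> borel_measurable circle" and xh: "\<And>n. x n = cf (h n)" by metis
  obtain N where N: "\<And>k m n. N k \<le> m \<Longrightarrow> N k \<le> n \<Longrightarrow> Lp_norm p (x m - x n) \<le> (1/4) ^ k"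
    using Cauchy[of "(1/4) ^ k" for k] by (metis zero_less_divide_1_iff zero_less_numeral zero_less_power)
  define r where "r k = (\<Sum>i\<le>k. N i) + k" for k :: nat
  have rN: "N k \<le> r k" "N k \<le> r (Suc k)" "k \<le> r k" for k
    using member_le_sum[of k "{..k}" N] by (auto simp: r_def)
  define f where "f k = h (r k)" for k
  have [measurable]: "f k \<in> borel_measurable circle" for k by (simp add: f_def)
  have conv: "AE t in circle. convergent (\<lambda>k. f k t)"
  proof (rule fast_Cauchy_converges_AE[OF p])
    show "cf (f k) \<in> Lp p" for k using x[of "r k"] by (simp add: f_def xh)
    show "Lp_norm p (cf (f (Suc k)) - cf (f k)) \<le> (1/4) ^ k" for k
      using N[OF rN(2) rN(1), of k] by (simp add: f_def xh)
  qed measurable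
  define u where "u t = lim (\<lambda>k. f k t)" for t
  have [measurable]: "u \<in> borel_measurable circle" unfolding u_def by measurable
  have lim: "AE t in circle. (\<lambda>k. f k t) \<longlonglongrightarrow> u t"
    using conv by eventually_elim (simp add: u_def convergent_LIMSEQ_iff)
  have tail: "cf (\<lambda>t. h n t - u t) \<in> Lp p \<and> Lp_norm p (cf (\<lambda>t. h n t - u t)) \<le> e"
    if M: "\<forall>m\<ge>M. \<forall>n\<ge>M. Lp_norm p (x m - x n) \<le> e" "M \<le> n" for n M e
  proof -
    have diff: "cf (\<lambda>t. h n t - f (l + M) t) = x n - x (r (l + M))" for l
      by (simp add: f_def xh cf_diff)
    have "M \<le> r (l + M)" for l using rN(3)[of "l + M"] by simp
    then have "Lp_norm p (cf (\<lambda>t. h n t - f (l + M) t)) \<le> e" for l using M by (simp add: diff)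
    moreover have "cf (\<lambda>t. h n t - f (l + M) t) \<in> Lp p" for l unfolding diff by (intro Lp_diff p x)
    moreover have "AE t in circle. (\<lambda>l. h n t - f (l + M) t) \<longlonglongrightarrow> h n t - u t"
      using lim by eventually_elim (intro tendsto_intros LIMSEQ_ignore_initial_segment)
    ultimately show ?thesis
      using Lp_fatou[OF p, of "\<lambda>t. h n t - u t" "\<lambda>l t. h n t - f (l + M) t" e] by auto
  qed
  show thesis
  proof
    obtain M where M: "\<forall>m\<ge>M. \<forall>n\<ge>M. Lp_norm p (x m - x n) \<le> 1" using Cauchy[of 1] by auto
    have "x M - cf (\<lambda>t. h M t - u t) \<in> Lp p"
      using tail[OF M order_refl] by (intro Lp_diff p x) auto
    then show "cf u \<in> Lp p" by (simp add: xh cf_diff)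
    show "(\<lambda>n. Lp_norm p (x n - cf u)) \<longlonglongrightarrow> 0"
    proof (rule LIMSEQ_I)
      fix e :: real assume "0 < e"
      then obtain M where M: "\<forall>m\<ge>M. \<forall>n\<ge>M. Lp_norm p (x m - x n) \<le> e/2" using Cauchy[of "e/2"] by auto
      have "norm (Lp_norm p (x n - cf u) - 0) < e" if "M \<le> n" for n
        using tail[OF M that] \<open>0 < e\<close> by (simp add: xh cf_diff)
      then show "\<exists>M. \<forall>n\<ge>M. norm (Lp_norm p (x n - cf u) - 0) < e" by blast
    qed
  qed
qed

section \<open>The Riesz projection\<close>

lemma Hp_Lp: "x \<in> Hp p \<Longrightarrow> x \<in> Lp p" by (simp add: Hp_def)

lemma Hp_add: "1 < p \<Longrightarrow> x \<in> Hp p \<Longrightarrow> y \<in> Hp p \<Longrightarrow> x + y \<in> Hp p"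
  by (auto simp: Hp_def Lp_add fourier_coeff_add)
lemma Hp_diff: "1 < p \<Longrightarrow> x \<in> Hp p \<Longrightarrow> y \<in> Hp p \<Longrightarrow> x - y \<in> Hp p"
  by (auto simp: Hp_def Lp_diff fourier_coeff_diff)
lemma Hp_cscale: "x \<in> Hp p \<Longrightarrow> cscale c x \<in> Hp p"
  by (auto simp: Hp_def Lp_cscale fourier_coeff_cscale)
lemma Hp_zero: "0 \<in> Hp p"
  using fourier_coeff_cscale[of 0 0] by (simp add: Hp_def)

lemma Lp_norm_triangle_le: "1 \<le> p \<Longrightarrow> x \<in> Lp p \<Longrightarrow> y \<in> Lp p \<Longrightarrow> Lp_norm p x \<le> Lp_norm p (x - y) + Lp_norm p y"
  using Lp_norm_triangle[of p "x - y" y] by (simp add: Lp_diff)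

lemma riesz_eqI:
  assumes "1 < p" "g \<in> Hp p" "\<And>n. 0 \<le> n \<Longrightarrow> fourier_coeff g n = fourier_coeff x n"
  shows "riesz p x = g"
  unfolding riesz_def
proof (rule the_equality)
  show "g \<in> Hp p \<and> (\<forall>n\<ge>0. fourier_coeff g n = fourier_coeff x n)" using assms by auto
  fix g' assume g': "g' \<in> Hp p \<and> (\<forall>n\<ge>0. fourier_coeff g' n = fourier_coeff x n)"
  have "fourier_coeff (g' - g) n = 0" for n
    using assms g' fourier_coeff_diff[of p g' g n] by (cases "0 \<le> n") (auto simp: Hp_def)
  then have "g' - g = 0"
    using assms(1) Hp_diff[of p g' g] assms(2) g' by (intro fourier_unique_zero[of p]) (auto dest: Hp_Lp)
  then show "g' = g" by simp
qed

text \<open>Approximate \<open>x\<close> by trigonometric polynomials \<open>q\<^sub>n\<close>. Their analytic parts form a Cauchy sequence by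
  \<open>riesz_trig\<close>; Fourier coefficients are continuous, so its limit has the right ones.\<close>

lemma riesz_exists:
  assumes p: "1 < p"
  obtains C where "0 \<le> C"
    "\<And>x. x \<in> Lp p \<Longrightarrow> \<exists>g\<in>Hp p. (\<forall>n\<ge>0. fourier_coeff g n = fourier_coeff x n) \<and> Lp_norm p g \<le> C * Lp_norm p x"
proof -
  obtain C where C: "0 \<le> C"
    "\<And>S c. finite S \<Longrightarrow> Lp_norm p (cf (tp {n\<in>S. 0 \<le> n} c)) \<le> C * Lp_norm p (cf (tp S c))"
    using riesz_trig[OF p] by metis
  have p1: "1 \<le> p" using p by simp
  show thesis
  proof
    show "0 \<le> C" by (rule C(1))
    fix x assume x: "x \<in> Lp p"
    have "\<exists>S c. finite S \<and> Lp_norm p (x - cf (tp S c)) < inverse (real (Suc n))" for n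
      using trig_approx[OF p1 x, of "inverse (real (Suc n))"] by (metis inverse_positive_iff_positive of_nat_0_less_iff zero_less_Suc)
    then obtain S c where S: "\<And>n. finite (S n)" "\<And>n. Lp_norm p (x - cf (tp (S n) (c n))) < inverse (real (Suc n))"
      by metis
    define q where "q n = cf (tp (S n) (c n))" for n
    define g where "g n = cf (tp {m\<in>S n. 0 \<le> m} (c n))" for n
    have Lp: "q n \<in> Lp p" "g n \<in> Lp p" for n using p by (auto simp: q_def g_def intro: tp_Lp)
    have q0: "(\<lambda>n. Lp_norm p (x - q n)) \<longlonglongrightarrow> 0"
      using S(2) by (intro tendsto_sandwich[OF _ _ tendsto_const LIMSEQ_inverse_real_of_nat])
        (auto simp: q_def less_imp_le)
    have gdiff: "Lp_norm p (g m - g n) \<le> C * Lp_norm p (q m - q n)" for m n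
    proof -
      let ?U = "S m \<union> S n"
      let ?c = "\<lambda>j. (if j \<in> S m then c m j else 0) - (if j \<in> S n then c n j else 0)"
      have U: "tp (S k) (c k) = tp ?U (\<lambda>j. if j \<in> S k then c k j else 0)" if "k = m \<or> k = n" for k
        using S(1) that by (intro tp_eq_superset) auto
      have U': "tp {j\<in>S k. 0 \<le> j} (c k) = tp {j\<in>?U. 0 \<le> j} (\<lambda>j. if j \<in> S k then c k j else 0)" if "k = m \<or> k = n" for k
        unfolding tp_def using S(1) that by (intro ext sum.mono_neutral_cong_left) auto
      have "q m - q n = cf (tp ?U ?c)"
        unfolding q_def U[of m, simplified] U[of n, simplified] by (simp add: cf_diff tp_diff[abs_def])
      moreover have "g m - g n = cf (tp {j\<in>?U. 0 \<le> j} ?c)"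
        unfolding g_def U'[of m, simplified] U'[of n, simplified] by (simp add: cf_diff tp_diff[abs_def])
      ultimately show ?thesis using C(2)[of ?U ?c] S(1) by simp
    qed
    have "\<exists>N. \<forall>m\<ge>N. \<forall>n\<ge>N. Lp_norm p (g m - g n) \<le> e" if e: "0 < e" for e
    proof -
      define K where "K = (C + 1) * 2"
      have K: "0 < K" using C(1) by (simp add: K_def)
      define d where "d = e / K"
      have "K * d = e" using K by (simp add: d_def)
      moreover have "0 < d" using e K by (simp add: d_def)
      ultimately have d: "0 < d" "(C + 1) * (2 * d) = e" by (simp_all add: K_def algebra_simps)
      obtain N where N: "\<And>n. N \<le> n \<Longrightarrow> Lp_norm p (x - q n) < d"
        using LIMSEQ_D[OF q0 d(1)] by auto
      have "Lp_norm p (g m - g n) \<le> e" if "N \<le> m" "N \<le> n" for m n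
      proof -
        have "Lp_norm p (q m - q n) \<le> Lp_norm p (q m - x) + Lp_norm p (x - q n)"
          by (rule Lp_norm_triangle_diff[OF p1 Lp(1) x Lp(1)])
        also have "Lp_norm p (q m - x) = Lp_norm p (x - q m)" using p by (intro Lp_norm_minus_commute) auto
        finally have "Lp_norm p (q m - q n) \<le> 2 * d" using N[OF that(1)] N[OF that(2)] by simp
        then have "C * Lp_norm p (q m - q n) \<le> (C + 1) * (2 * d)" using C(1) by (intro mult_mono) auto
        also have "\<dots> = e" by (rule d(2))
        finally show ?thesis using gdiff[of m n] by linarith
      qed
      then show ?thesis by blast
    qed
    then obtain y where y: "y \<in> Lp p" "(\<lambda>n. Lp_norm p (g n - y)) \<longlonglongrightarrow> 0"
      by (rule Lp_complete[OF p1 Lp(2)])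
    have coeff: "fourier_coeff y m = (if 0 \<le> m then fourier_coeff x m else 0)" for m
    proof -
      have 1: "(\<lambda>n. fourier_coeff (g n) m) \<longlonglongrightarrow> fourier_coeff y m"
      proof (rule Lim_null_comparison[THEN LIM_zero_cancel])
        show "eventually (\<lambda>n. norm (fourier_coeff (g n) m - fourier_coeff y m) \<le> Lp_norm p (g n - y)) sequentially"
          using fourier_coeff_bound[OF p Lp_diff[OF p1 Lp(2) y(1)]] fourier_coeff_diff[OF p Lp(2) y(1)] by simp
      qed (rule y)
      have 2: "(\<lambda>n. fourier_coeff (q n) m) \<longlonglongrightarrow> fourier_coeff x m"
      proof (rule Lim_null_comparison[THEN LIM_zero_cancel])
        show "eventually (\<lambda>n. norm (fourier_coeff (q n) m - fourier_coeff x m) \<le> Lp_norm p (x - q n)) sequentially"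
          using fourier_coeff_bound[OF p Lp_diff[OF p1 x Lp(1)]] fourier_coeff_diff[OF p x Lp(1)]
          by (simp add: norm_minus_commute)
      qed (rule q0)
      have gq: "fourier_coeff (g n) m = (if 0 \<le> m then fourier_coeff (q n) m else 0)" for n
        unfolding g_def q_def using S(1) by (simp add: fourier_coeff_tp)
      show ?thesis
      proof (cases "0 \<le> m")
        case True
        then show ?thesis using 1 2 LIMSEQ_unique by (simp add: gq)
      next
        case False
        then show ?thesis using 1 by (simp add: gq LIMSEQ_const_iff)
      qed
    qed
    have "Lp_norm p y \<le> C * Lp_norm p x"
    proof (rule LIMSEQ_le_const)
      show "(\<lambda>n. Lp_norm p (g n - y) + C * (Lp_norm p (x - q n) + Lp_norm p x)) \<longlonglongrightarrow> C * Lp_norm p x"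
        using tendsto_add[OF y(2) tendsto_mult[OF tendsto_const[of C] tendsto_add[OF q0 tendsto_const[of "Lp_norm p x"]]]] by simp
      have "Lp_norm p y \<le> Lp_norm p (g n - y) + C * (Lp_norm p (x - q n) + Lp_norm p x)" for n
      proof -
        have "Lp_norm p y \<le> Lp_norm p (y - g n) + Lp_norm p (g n)" by (intro Lp_norm_triangle_le p1 Lp y)
        also have "Lp_norm p (y - g n) = Lp_norm p (g n - y)" using p by (intro Lp_norm_minus_commute) auto
        also have "Lp_norm p (g n) \<le> C * Lp_norm p (q n)" unfolding g_def q_def by (rule C(2)[OF S(1)])
        also have "Lp_norm p (q n) \<le> Lp_norm p (q n - x) + Lp_norm p x" by (intro Lp_norm_triangle_le p1 Lp x)
        also have "Lp_norm p (q n - x) = Lp_norm p (x - q n)" using p by (intro Lp_norm_minus_commute) auto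
        finally show ?thesis using C(1) by (simp add: mult_left_mono)
      qed
      then show "\<exists>N. \<forall>n\<ge>N. Lp_norm p y \<le> Lp_norm p (g n - y) + C * (Lp_norm p (x - q n) + Lp_norm p x)" by blast
    qed
    then show "\<exists>g\<in>Hp p. (\<forall>n\<ge>0. fourier_coeff g n = fourier_coeff x n) \<and> Lp_norm p g \<le> C * Lp_norm p x"
      using coeff y(1) by (intro bexI[of _ y]) (auto simp: Hp_def)
  qed
qed

lemma riesz_Hp:
  assumes p: "1 < p" and x: "x \<in> Lp p"
  shows "riesz p x \<in> Hp p" "0 \<le> n \<Longrightarrow> fourier_coeff (riesz p x) n = fourier_coeff x n"
proof -
  obtain g where g: "g \<in> Hp p" "\<forall>n\<ge>0. fourier_coeff g n = fourier_coeff x n"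
    using riesz_exists[OF p] x by metis
  then have "riesz p x = g" by (intro riesz_eqI p) auto
  then show "riesz p x \<in> Hp p" "0 \<le> n \<Longrightarrow> fourier_coeff (riesz p x) n = fourier_coeff x n" using g by auto
qed

lemma riesz_bounded:
  assumes p: "1 < p"
  obtains C where "0 \<le> C" "\<And>x. x \<in> Lp p \<Longrightarrow> Lp_norm p (riesz p x) \<le> C * Lp_norm p x"
proof -
  obtain C where C: "0 \<le> C"
    "\<And>x. x \<in> Lp p \<Longrightarrow> \<exists>g\<in>Hp p. (\<forall>n\<ge>0. fourier_coeff g n = fourier_coeff x n) \<and> Lp_norm p g \<le> C * Lp_norm p x"
    using riesz_exists[OF p] by metis
  have "Lp_norm p (riesz p x) \<le> C * Lp_norm p x" if x: "x \<in> Lp p" for x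
  proof -
    obtain g where g: "g \<in> Hp p" "\<forall>n\<ge>0. fourier_coeff g n = fourier_coeff x n" "Lp_norm p g \<le> C * Lp_norm p x"
      using C(2)[OF x] by metis
    then have "riesz p x = g" by (intro riesz_eqI p) auto
    then show ?thesis using g by simp
  qed
  then show thesis using that C(1) by metis
qed

lemma riesz_add:
  assumes p: "1 < p" and xy: "x \<in> Lp p" "y \<in> Lp p"
  shows "riesz p (x + y) = riesz p x + riesz p y"
  using assms riesz_Hp[OF p xy(1)] riesz_Hp[OF p xy(2)]
  by (intro riesz_eqI Hp_add) (auto simp: fourier_coeff_add Hp_Lp)

lemma riesz_cscale:
  assumes p: "1 < p" and x: "x \<in> Lp p"
  shows "riesz p (cscale c x) = cscale c (riesz p x)"
  using assms riesz_Hp[OF p x]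
  by (intro riesz_eqI Hp_cscale) (auto simp: fourier_coeff_cscale)

section \<open>Operator norms\<close>

lemma op_norm_least:
  assumes "0 \<in> X" "\<And>x. x \<in> X \<Longrightarrow> Lp_norm p x \<le> 1 \<Longrightarrow> Lp_norm p (T x) \<le> B"
  shows "op_norm p X T \<le> B"
  unfolding op_norm_def by (rule cSUP_least) (use assms in auto)

text \<open>\<open>op_norm\<close> is a supremum of reals and says something only for operators bounded on the unit
  ball; \<open>B\<close> is any such bound.\<close>

lemma op_norm_bound:
  assumes p: "1 \<le> p" and X: "X \<subseteq> Lp p" "\<And>c x. x \<in> X \<Longrightarrow> cscale c x \<in> X"
    and T: "\<And>c x. x \<in> X \<Longrightarrow> T (cscale c x) = cscale c (T x)"
    and B: "\<And>x. x \<in> X \<Longrightarrow> Lp_norm p x \<le> 1 \<Longrightarrow> Lp_norm p (T x) \<le> B"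
    and x: "x \<in> X"
  shows "Lp_norm p (T x) \<le> op_norm p X T * Lp_norm p x"
proof (cases "Lp_norm p x = 0")
  case True
  then have "x = 0" using Lp_norm_eq_zero_iff[OF p] X(1) x by auto
  then have "T x = 0" using T[OF x, of 0] by simp
  then show ?thesis using True by simp
next
  case False
  let ?n = "Lp_norm p x"
  have n: "0 < ?n" using False Lp_norm_nonneg[of p x] by linarith
  define y where "y = cscale (1 / ?n) x"
  have y: "y \<in> X" "Lp_norm p y = 1" using X(2)[OF x] n p by (auto simp: y_def Lp_norm_cscale norm_divide)
  have "Lp_norm p (T y) \<le> op_norm p X T"
    unfolding op_norm_def
    by (rule cSUP_upper) (use y B in \<open>auto intro!: bdd_aboveI2\<close>)
  moreover have "Lp_norm p (T y) = Lp_norm p (T x) / ?n"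
    using n p by (simp add: y_def T[OF x] Lp_norm_cscale norm_divide)
  ultimately show ?thesis using n by (simp add: field_simps)
qed

lemma op_norm_nonneg:
  assumes "0 \<in> X" and B: "\<And>x. x \<in> X \<Longrightarrow> Lp_norm p x \<le> 1 \<Longrightarrow> Lp_norm p (T x) \<le> B"
  shows "0 \<le> op_norm p X T"
proof -
  have "Lp_norm p (T 0) \<le> op_norm p X T"
    unfolding op_norm_def
    by (rule cSUP_upper) (use assms in \<open>auto intro!: bdd_aboveI2\<close>)
  then show ?thesis using Lp_norm_nonneg order_trans by blast
qed

lemma riesz_op_norm:
  assumes p: "1 < p"
  shows "x \<in> Lp p \<Longrightarrow> Lp_norm p (riesz p x) \<le> op_norm p (Lp p) (riesz p) * Lp_norm p x"
    and "0 \<le> op_norm p (Lp p) (riesz p)"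
proof -
  obtain C where C: "0 \<le> C" "\<And>x. x \<in> Lp p \<Longrightarrow> Lp_norm p (riesz p x) \<le> C * Lp_norm p x"
    using riesz_bounded[OF p] by metis
  have ball: "Lp_norm p (riesz p x) \<le> C" if "x \<in> Lp p" "Lp_norm p x \<le> 1" for x
  proof -
    have "C * Lp_norm p x \<le> C * 1" using that C(1) by (intro mult_left_mono) auto
    then show ?thesis using C(2)[OF that(1)] by simp
  qed
  show "x \<in> Lp p \<Longrightarrow> Lp_norm p (riesz p x) \<le> op_norm p (Lp p) (riesz p) * Lp_norm p x"
    using p by (intro op_norm_bound[of p _ _ C]) (auto simp: Lp_cscale riesz_cscale ball)
  show "0 \<le> op_norm p (Lp p) (riesz p)" by (rule op_norm_nonneg[OF Lp_zero ball])
qed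

section \<open>Multiplication by powers of the independent variable\<close>

definition tpow :: "int \<Rightarrow> circle_fun" where "tpow n = cf (\<lambda>t. t powi n)"

lemma
  shows Lp_norm_tpow: "Lp_norm p (tpow n * x) = Lp_norm p x"
    and Lp_tpow: "tpow n * x \<in> Lp p \<longleftrightarrow> x \<in> Lp p"
proof -
  obtain f where f [measurable]: "f \<in> borel_measurable circle" and xf: "x = cf f" by (rule cf_cases)
  have "tpow n * x = cf (\<lambda>t. t powi n * f t)" by (simp add: tpow_def xf cf_mult)
  moreover have "cmod (t powi n * f t) = cmod (f t)" if "t \<in> sphere 0 1" for t
    using norm_powi_circle[OF that, of n] by (simp add: norm_mult)
  ultimately show "Lp_norm p (tpow n * x) = Lp_norm p x" "tpow n * x \<in> Lp p \<longleftrightarrow> x \<in> Lp p"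
    using Lp_norm_unimodular[of "\<lambda>t. t powi n * f t" f p] by (simp_all add: xf)
qed

lemma fourier_coeff_tpow: "fourier_coeff (tpow n * x) m = fourier_coeff x (m - n)"
proof -
  obtain f where f [measurable]: "f \<in> borel_measurable circle" and xf: "x = cf f" by (rule cf_cases)
  have "fourier_coeff (tpow n * x) m = (LINT t|circle. (t powi n * f t) * t powi (- m))"
    by (simp add: tpow_def xf cf_mult fourier_coeff_cf)
  also have "\<dots> = (LINT t|circle. f t * t powi (- (m - n)))"
  proof (intro Bochner_Integration.integral_cong refl)
    fix t assume "t \<in> space circle"
    then have "t powi n * t powi (- m) = t powi (- (m - n))"
      using powi_add_circle[of t n "- m"] by simp
    then show "(t powi n * f t) * t powi (- m) = f t * t powi (- (m - n))"
      by (metis mult.assoc mult.commute)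
  qed
  finally show ?thesis by (simp add: xf fourier_coeff_cf)
qed

lemma tp_degree:
  assumes "finite S" obtains N :: nat where "\<And>n. N < nat \<bar>n\<bar> \<Longrightarrow> fourier_coeff (cf (tp S c)) n = 0"
proof -
  define N where "N = nat (\<Sum>n\<in>S. \<bar>n\<bar>)"
  have "\<bar>n\<bar> \<le> int N" if "n \<in> S" for n
    using member_le_sum[of n S abs] assms that by (simp add: N_def sum_nonneg)
  then have "fourier_coeff (cf (tp S c)) n = 0" if "N < nat \<bar>n\<bar>" for n
    using that assms by (force simp: fourier_coeff_tp)
  then show thesis using that by metis
qed

lemma tpow_trig_in_Hp:
  assumes "1 < p" "finite S" "\<And>n. N < nat \<bar>n\<bar> \<Longrightarrow> fourier_coeff (cf (tp S c)) n = 0" "N \<le> n"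
  shows "tpow (int n) * cf (tp S c) \<in> Hp p"
  using assms by (auto simp: Hp_def Lp_tpow tp_Lp fourier_coeff_tpow)

text \<open>For a trigonometric polynomial \<open>x\<close> both expressions vanish as soon as \<open>n\<close> exceeds its degree: all
  frequencies of \<open>t\<^sup>n x\<close> are nonnegative, those of \<open>t\<^sup>-\<^sup>n x\<close> are negative. The general case follows by
  density, as \<open>P\<close> is bounded and multiplication by \<open>t\<^sup>n\<close> is isometric.\<close>

lemma riesz_tpow_limit:
  assumes p: "1 < p" and x: "x \<in> Lp p"
  shows "(\<lambda>n. Lp_norm p (riesz p (tpow (int n) * x) - tpow (int n) * x)) \<longlonglongrightarrow> 0"
    and "(\<lambda>n. Lp_norm p (riesz p (tpow (- int n) * x))) \<longlonglongrightarrow> 0"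
proof -
  have p1: "1 \<le> p" using p by simp
  obtain C where C: "0 \<le> C" "\<And>x. x \<in> Lp p \<Longrightarrow> Lp_norm p (riesz p x) \<le> C * Lp_norm p x"
    using riesz_bounded[OF p] by metis
  have key: "\<exists>N. \<forall>n\<ge>N. Lp_norm p (riesz p (tpow (int n) * x) - tpow (int n) * x) < e
      \<and> Lp_norm p (riesz p (tpow (- int n) * x)) < e" if e: "0 < e" for e
  proof -
    define d where "d = e / (C + 1)"
    have d: "0 < d" "(C + 1) * d = e" using e C(1) by (auto simp: d_def)
    obtain S c where S: "finite S" "Lp_norm p (x - cf (tp S c)) < d" using trig_approx[OF p1 x d(1)] .
    define q where "q = cf (tp S c)"
    have q: "q \<in> Lp p" using p by (auto simp: q_def intro: tp_Lp)
    obtain N where N: "\<And>n. N < nat \<bar>n\<bar> \<Longrightarrow> fourier_coeff q n = 0" using tp_degree[OF S(1)] unfolding q_def by metis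
    have "Lp_norm p (riesz p (tpow (int n) * x) - tpow (int n) * x) < e
      \<and> Lp_norm p (riesz p (tpow (- int n) * x)) < e" if n: "Suc N \<le> n" for n
    proof -
      define y where "y = x - q"
      have y: "y \<in> Lp p" "Lp_norm p y < d" using Lp_diff[OF p1 x q] S(2) by (auto simp: y_def q_def)
      have xy: "tpow m * x = tpow m * y + tpow m * q" for m by (simp add: y_def algebra_simps)
      have ty: "tpow m * y \<in> Lp p" "tpow m * q \<in> Lp p" for m using y q by (auto simp: Lp_tpow)
      have rb: "Lp_norm p (riesz p (tpow m * y)) \<le> C * d" for m
        using C(2)[OF ty(1)[of m]] y(2) C(1) mult_left_mono[of "Lp_norm p y" d C]
        by (simp add: Lp_norm_tpow)
      have "riesz p (tpow (int n) * q) = tpow (int n) * q"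
        using tpow_trig_in_Hp[OF p S(1), of N c n] N n by (intro riesz_eqI p) (auto simp: q_def)
      then have "riesz p (tpow (int n) * x) - tpow (int n) * x = riesz p (tpow (int n) * y) - tpow (int n) * y"
        by (simp add: xy riesz_add[OF p ty])
      also have "Lp_norm p \<dots> \<le> Lp_norm p (riesz p (tpow (int n) * y)) + Lp_norm p (tpow (int n) * y)"
        by (intro Lp_norm_diff_le p1 Hp_Lp riesz_Hp p ty)
      also have "\<dots> < C * d + d" using rb[of "int n"] y(2) by (simp add: Lp_norm_tpow)
      also have "\<dots> = e" using d(2) by (simp add: algebra_simps)
      finally have 1: "Lp_norm p (riesz p (tpow (int n) * x) - tpow (int n) * x) < e" .
      have "riesz p (tpow (- int n) * q) = 0"
      proof (rule riesz_eqI[OF p Hp_zero])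
        fix m :: int assume "0 \<le> m"
        then have "N < nat \<bar>m + int n\<bar>" using n by simp
        then show "fourier_coeff 0 m = fourier_coeff (tpow (- int n) * q) m"
          using fourier_coeff_cscale[of 0 0 m] by (simp add: fourier_coeff_tpow N)
      qed
      then have "riesz p (tpow (- int n) * x) = riesz p (tpow (- int n) * y)"
        by (simp add: xy riesz_add[OF p ty])
      then have "Lp_norm p (riesz p (tpow (- int n) * x)) \<le> C * d" using rb by simp
      also have "\<dots> < e" using d by (simp add: algebra_simps)
      finally show ?thesis using 1 by simp
    qed
    then show ?thesis by blast
  qed
  show "(\<lambda>n. Lp_norm p (riesz p (tpow (int n) * x) - tpow (int n) * x)) \<longlonglongrightarrow> 0"
    by (rule LIMSEQ_I) (use key in \<open>simp, meson\<close>)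
  show "(\<lambda>n. Lp_norm p (riesz p (tpow (- int n) * x))) \<longlonglongrightarrow> 0"
    by (rule LIMSEQ_I) (use key in \<open>simp, meson\<close>)
qed

section \<open>Compact operators\<close>

text \<open>The average of \<open>N\<close> distinct monomials has modulus at most \<open>1\<close> and \<open>L\<^sup>2\<close>-norm \<open>N\<^sup>-\<^sup>1\<^sup>/\<^sup>2\<close>. For
  \<open>p \<le> 2\<close> the second fact suffices, for \<open>p > 2\<close> the first one reduces the exponent \<open>p\<close> to \<open>2\<close>.\<close>

lemma monomial_average_small:
  assumes p: "1 < p" and e: "0 < e"
  obtains N :: nat where "0 < N"
    "\<And>S. finite S \<Longrightarrow> card S = N \<Longrightarrow> Lp_norm p (cf (tp S (\<lambda>_. 1 / of_nat N))) < e"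
proof -
  obtain N :: nat where N: "4 / e\<^sup>2 + 1 / e powr p < real N" using reals_Archimedean2 by blast
  have pos: "0 < 4 / e\<^sup>2" "0 < 1 / e powr p" using e by auto
  then have N0: "0 < real N" and N1: "4 / e\<^sup>2 < real N" and N2: "1 / e powr p < real N" using N by linarith+
  show thesis
  proof
    show "0 < N" using N0 by simp
    fix S :: "int set" assume S: "finite S" "card S = N"
    define h where "h = tp S (\<lambda>_. 1 / of_nat N)"
    have ch: "continuous_on (sphere 0 1) h" unfolding h_def by (rule continuous_tp)
    have [measurable]: "h \<in> borel_measurable circle" by (rule continuous_circle_measurable[OF ch])
    have L2: "(LINT t|circle. (cmod (h t))\<^sup>2) = 1 / real N"
      unfolding h_def parseval_tp[OF S(1)] using N0 S(2)
      by (simp add: norm_divide power_divide) (simp add: power2_eq_square)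
    have h1: "cmod (h t) \<le> 1" if t: "t \<in> sphere 0 1" for t
    proof -
      have "cmod (h t) \<le> (\<Sum>n\<in>S. cmod (1 / of_nat N * t powi n))" unfolding h_def tp_def by (rule norm_sum)
      also have "\<dots> = (\<Sum>n\<in>S. 1 / real N)"
        using norm_powi_circle[OF t] by (intro sum.cong refl) (simp add: norm_mult norm_divide)
      also have "\<dots> = 1" using S N0 by simp
      finally show ?thesis .
    qed
    show "Lp_norm p (cf (tp S (\<lambda>_. 1 / of_nat N))) < e"
    proof (cases "p \<le> 2")
      case True
      have "Lp_norm p (cf h) \<le> 2 * sqrt (1 / real N)"
        using N0 L2 by (intro Lp_norm_le_of_L2 p True ch) auto
      also have "\<dots> = sqrt (4 / real N)" by (simp add: real_sqrt_divide)
      also have "\<dots> < sqrt (e\<^sup>2)" using N1 N0 e by (intro real_sqrt_less_mono) (simp add: field_simps)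
      also have "\<dots> = e" using e by simp
      finally show ?thesis by (simp add: h_def)
    next
      case False
      have hLp: "cf h \<in> Lp p" "cf h \<in> Lp 2" using p ch by (auto intro: continuous_Lp)
      have "Lp_norm p (cf h) powr p = (LINT t|circle. cmod (h t) powr p)"
        using p by (intro Lp_norm_powr_cf) auto
      also have "\<dots> \<le> (LINT t|circle. cmod (h t) powr 2)"
      proof (rule integral_mono)
        show "cmod (h t) powr p \<le> cmod (h t) powr 2" if "t \<in> space circle" for t
          using False h1[of t] that by (intro powr_mono') auto
      qed (use hLp in \<open>auto simp: cf_in_Lp_iff\<close>)
      also have "\<dots> = (LINT t|circle. (cmod (h t))\<^sup>2)" by (simp add: powr_numeral)
      also have "\<dots> < e powr p" unfolding L2 using N2 N0 e by (simp add: field_simps)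
      finally have less: "Lp_norm p (cf h) powr p < e powr p" .
      show ?thesis
      proof (rule ccontr)
        assume "\<not> ?thesis"
        then have "e powr p \<le> Lp_norm p (cf h) powr p" using e p by (intro powr_mono2) (auto simp: h_def)
        with less show False by simp
      qed
    qed
  qed
qed

lemma Hp_metric:
  assumes p: "1 < p"
  shows "Metric_space (Hp p) (\<lambda>f g. Lp_norm p (f - g))"
proof
  have p1: "1 \<le> p" using p by simp
  fix x y z
  show "0 \<le> Lp_norm p (x - y)" by simp
  show "Lp_norm p (x - y) = Lp_norm p (y - x)" using p by (intro Lp_norm_minus_commute) auto
  show "x \<in> Hp p \<Longrightarrow> y \<in> Hp p \<Longrightarrow> Lp_norm p (x - y) = 0 \<longleftrightarrow> x = y"
    using Lp_norm_eq_zero_iff[OF p1 Hp_Lp[OF Hp_diff[OF p]], of x y] by simp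
  show "x \<in> Hp p \<Longrightarrow> y \<in> Hp p \<Longrightarrow> z \<in> Hp p \<Longrightarrow> Lp_norm p (x - z) \<le> Lp_norm p (x - y) + Lp_norm p (y - z)"
    by (intro Lp_norm_triangle_diff p1 Hp_Lp)
qed

lemma compact_operator_linear:
  assumes "compact_operator p K"
  shows "x \<in> Hp p \<Longrightarrow> K x \<in> Hp p"
    and "x \<in> Hp p \<Longrightarrow> y \<in> Hp p \<Longrightarrow> K (x + y) = K x + K y"
    and "x \<in> Hp p \<Longrightarrow> K (cscale c x) = cscale c (K x)"
  using assms unfolding compact_operator_def linear_on_Hp_def by auto

lemma compact_operator_sequence:
  fixes x :: "nat \<Rightarrow> circle_fun"
  assumes p: "1 < p" and K: "compact_operator p K" and x: "\<And>n. x n \<in> Hp p" "\<And>n. Lp_norm p (x n) \<le> 1"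
  obtains l s where "l \<in> Hp p" "strict_mono s" "(\<lambda>k. Lp_norm p (K (x (s k)) - l)) \<longlonglongrightarrow> 0"
proof -
  interpret H: Metric_space "Hp p" "\<lambda>f g. Lp_norm p (f - g)" by (rule Hp_metric[OF p])
  let ?I = "K ` {f \<in> Hp p. Lp_norm p f \<le> 1}"
  have comp: "compactin H.mtopology (H.mtopology closure_of ?I)"
    using K by (simp add: compact_operator_def Hp_topology_def)
  have "?I \<subseteq> H.mtopology closure_of ?I"
    using compact_operator_linear(1)[OF K] by (intro closure_of_subset) auto
  then have range: "range (\<lambda>n. K (x n)) \<subseteq> H.mtopology closure_of ?I" using x by blast
  have "\<forall>\<sigma>::nat \<Rightarrow> circle_fun. range \<sigma> \<subseteq> H.mtopology closure_of ?I \<longrightarrow>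
      (\<exists>l s. l \<in> H.mtopology closure_of ?I \<and> strict_mono s \<and> limitin H.mtopology (\<sigma> \<circ> s) l sequentially)"
    using comp unfolding H.compactin_sequentially by (rule conjunct2)
  from this[THEN spec, THEN mp, OF range]
  obtain l s where ls: "strict_mono s" "limitin H.mtopology ((\<lambda>n. K (x n)) \<circ> s) l sequentially"
    by (elim exE conjE)
  then have "l \<in> Hp p" "(\<lambda>k. Lp_norm p (K (x (s k)) - l)) \<longlonglongrightarrow> 0"
    unfolding H.limitin_metric_dist_null o_def by blast+
  with ls(1) that show thesis by blast
qed

lemma compact_operator_bounded:
  assumes p: "1 < p" and K: "compact_operator p K"
  obtains M where "0 \<le> M" "\<And>x. x \<in> Hp p \<Longrightarrow> Lp_norm p (K x) \<le> M * Lp_norm p x"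
proof -
  interpret H: Metric_space "Hp p" "\<lambda>f g. Lp_norm p (f - g)" by (rule Hp_metric[OF p])
  let ?I = "K ` {f \<in> Hp p. Lp_norm p f \<le> 1}"
  have comp: "compactin H.mtopology (H.mtopology closure_of ?I)"
    using K by (simp add: compact_operator_def Hp_topology_def)
  have sub: "?I \<subseteq> H.mtopology closure_of ?I"
    using compact_operator_linear(1)[OF K] by (intro closure_of_subset) auto
  obtain c B where c: "H.mtopology closure_of ?I \<subseteq> H.mcball c B"
    using H.compactin_imp_mbounded[OF comp] unfolding H.mbounded_def by blast
  define M where "M = \<bar>B\<bar> + Lp_norm p c"
  have ball: "Lp_norm p (K x) \<le> M" if x: "x \<in> Hp p" "Lp_norm p x \<le> 1" for x
  proof -
    have "K x \<in> H.mcball c B" using sub c x by blast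
    then have "c \<in> Hp p" "K x \<in> Hp p" "Lp_norm p (c - K x) \<le> B" by auto
    moreover from this have "Lp_norm p (K x) \<le> Lp_norm p (K x - c) + Lp_norm p c"
      using p by (intro Lp_norm_triangle_le Hp_Lp) auto
    ultimately show ?thesis using Lp_norm_minus_commute[of p "K x" c] p by (simp add: M_def)
  qed
  have M0: "0 \<le> op_norm p (Hp p) K" using ball by (intro op_norm_nonneg[OF Hp_zero]) auto
  have "Lp_norm p (K x) \<le> op_norm p (Hp p) K * Lp_norm p x" if "x \<in> Hp p" for x
    using p that ball by (intro op_norm_bound[of p _ _ M])
      (auto simp: Hp_Lp Hp_cscale compact_operator_linear[OF K])
  with M0 that show thesis by blast
qed

lemma tpow_average:
  assumes "finite I" "inj_on r I"
  shows "cscale a (\<Sum>i\<in>I. tpow (r i) * x) = cf (tp (r ` I) (\<lambda>_. a)) * x"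
proof -
  have "cscale a (\<Sum>i\<in>I. tpow (r i)) = cf (tp (r ` I) (\<lambda>_. a))"
    using assms
  proof (induction I rule: finite_induct)
    case empty
    show ?case unfolding image_empty by (simp add: tp_def[abs_def] cf_zero[symmetric])
  next
    case (insert i I)
    have "tp (r ` insert i I) (\<lambda>_. a) = (\<lambda>t. a * t powi r i + tp (r ` I) (\<lambda>_. a) t)"
      using insert by (auto simp: tp_def sum.insert_if)
    then have "cf (tp (r ` insert i I) (\<lambda>_. a)) = cscale a (tpow (r i)) + cf (tp (r ` I) (\<lambda>_. a))"
      by (simp add: tpow_def cscale_cf cf_add)
    then show ?case using insert by (simp add: cscale_add)
  qed
  then show ?thesis
    by (metis sum_distrib_right mult_cscale mult.commute)
qed

text \<open>The functions \<open>t\<^sup>n q\<close> tend to zero weakly, but the dual space can be avoided. If the images stay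
  away from zero along a sequence, a subsequence of them converges to some \<open>l \<noteq> 0\<close>, and so
  averages of images are close to \<open>l\<close>. They are images of averages of the functions \<open>t\<^sup>n q\<close>, which
  are small in norm by \<open>monomial_average_small\<close>; so \<open>l\<close> would have to be small.\<close>

lemma compact_operator_vanishes:
  assumes p: "1 < p" and K: "compact_operator p K" and S: "finite S"
  shows "(\<lambda>n. Lp_norm p (K (tpow (int n) * cf (tp S c)))) \<longlonglongrightarrow> 0"
proof (rule ccontr)
  have p1: "1 \<le> p" using p by simp
  define q where "q = cf (tp S c)"
  have qLp: "q \<in> Lp p" using p by (auto simp: q_def intro: tp_Lp)
  obtain N0 where N0: "\<And>n. N0 < nat \<bar>n\<bar> \<Longrightarrow> fourier_coeff q n = 0" using tp_degree[OF S] unfolding q_def by metis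
  have hp: "tpow (int n) * q \<in> Hp p" if "N0 \<le> n" for n
    using tpow_trig_in_Hp[OF p S N0[unfolded q_def] that] by (simp add: q_def)
  assume "\<not> ?thesis"
  then obtain \<delta> where \<delta>: "0 < \<delta>" "\<And>n0. \<exists>n\<ge>n0. \<delta> \<le> Lp_norm p (K (tpow (int n) * q))"
    unfolding lim_sequentially q_def by (auto simp: not_less)
  then have "\<exists>r :: nat \<Rightarrow> nat. \<forall>k. (N0 \<le> r k \<and> \<delta> \<le> Lp_norm p (K (tpow (int (r k)) * q))) \<and> r k < r (Suc k)"
  proof -
    have "\<exists>n. N0 \<le> n \<and> \<delta> \<le> Lp_norm p (K (tpow (int n) * q))" using \<delta>(2)[of N0] by auto
    moreover have "\<exists>n'. (N0 \<le> n' \<and> \<delta> \<le> Lp_norm p (K (tpow (int n') * q))) \<and> n < n'" for n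
      using \<delta>(2)[of "max N0 (Suc n)"] by (auto simp: Suc_le_eq)
    ultimately show ?thesis
      by (rule dependent_nat_choice[of "\<lambda>_ n. N0 \<le> n \<and> \<delta> \<le> Lp_norm p (K (tpow (int n) * q))" "\<lambda>_. (<)"])
  qed
  then obtain r :: "nat \<Rightarrow> nat" where r: "\<And>k. N0 \<le> r k" "\<And>k. \<delta> \<le> Lp_norm p (K (tpow (int (r k)) * q))"
    "strict_mono r" unfolding strict_mono_Suc_iff by blast
  define B where "B = Lp_norm p q + 1"
  have B: "0 < B" by (simp add: B_def add_nonneg_pos)
  \<comment> \<open>Scaled into the unit ball, on which compactness of \<open>K\<close> is expressed.\<close>
  define x where "x k = cscale (1 / B) (tpow (int (r k)) * q)" for k
  have xH: "x k \<in> Hp p" for k unfolding x_def by (intro Hp_cscale hp r)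
  have x1: "Lp_norm p (x k) \<le> 1" for k
    using p B by (simp add: x_def Lp_norm_cscale Lp_norm_tpow norm_divide) (simp add: B_def)
  obtain l s where l: "l \<in> Hp p" "strict_mono s" "(\<lambda>k. Lp_norm p (K (x (s k)) - l)) \<longlonglongrightarrow> 0"
    by (rule compact_operator_sequence[OF p K, of x, OF xH x1])
  have Kx: "\<delta> / B \<le> Lp_norm p (K (x k))" for k
    using r(2)[of k] B p by (simp add: x_def compact_operator_linear(3)[OF K hp[OF r(1)]] Lp_norm_cscale norm_divide divide_right_mono)
  define \<eta> where "\<eta> = \<delta> / B"
  have \<eta>: "0 < \<eta>" using \<delta> B by (simp add: \<eta>_def)
  obtain k0 where k0: "\<And>k. k0 \<le> k \<Longrightarrow> Lp_norm p (K (x (s k)) - l) < \<eta> / 3"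
    using LIMSEQ_D[OF l(3), of "\<eta> / 3"] \<eta> by auto
  define \<rho> where "\<rho> k = r (s (k + k0))" for k
  have inj\<rho>: "inj \<rho>" unfolding \<rho>_def
    using r(3) l(2) by (intro injI) (simp add: strict_mono_eq)
  obtain M where M: "0 \<le> M" "\<And>x. x \<in> Hp p \<Longrightarrow> Lp_norm p (K x) \<le> M * Lp_norm p x"
    using compact_operator_bounded[OF p K] by metis
  obtain b where b: "\<And>t. t \<in> sphere 0 1 \<Longrightarrow> cmod (tp S c t) \<le> b"
    using continuous_circle_bounded[OF continuous_tp] by metis
  have b0: "0 \<le> b" using b[of 1] norm_ge_zero[of "tp S c 1"] by (simp del: norm_ge_zero)
  \<comment> \<open>Chosen such that the average \<open>z\<close> below satisfies \<open>\<parallel>K z\<parallel> \<le> \<eta> / 3\<close>.\<close>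
  define \<epsilon> where "\<epsilon> = \<eta> * B / (3 * (M + 1) * (b + 1))"
  have den: "0 < 3 * (M + 1) * (b + 1)" using M(1) b0 by simp
  have \<epsilon>: "0 < \<epsilon>" using \<eta> B den by (simp add: \<epsilon>_def)
  obtain N :: nat where N: "0 < N" "\<And>S. finite S \<Longrightarrow> card S = N \<Longrightarrow> Lp_norm p (cf (tp S (\<lambda>_. 1 / of_nat N))) < \<epsilon>"
    using monomial_average_small[OF p \<epsilon>] by metis
  define T where "T = (\<lambda>k. int (\<rho> k)) ` {..<N}"
  have injint: "inj_on (\<lambda>k. int (\<rho> k)) {..<N}" using inj\<rho> by (auto simp: inj_on_def)
  have T: "finite T" "card T = N" using card_image[OF injint] by (auto simp: T_def)
  define z where "z = cscale (1 / of_nat N) (\<Sum>k<N. x (s (k + k0)))"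
  have zH: "(\<Sum>k<n. x (s (k + k0))) \<in> Hp p" for n
    by (induction n) (auto intro: Hp_zero Hp_add[OF p] xH)
  have z_eq: "z = cscale (1 / B) (cf (tp T (\<lambda>_. 1 / of_nat N)) * q)"
  proof -
    have "z = cscale (1 / B) (cscale (1 / of_nat N) (\<Sum>k<N. tpow (int (\<rho> k)) * q))"
      by (simp add: z_def x_def \<rho>_def cscale_sum[symmetric] cscale_cscale mult.commute)
    then show ?thesis unfolding T_def using tpow_average[OF _ injint] by simp
  qed
  have "Lp_norm p (cf (tp T (\<lambda>_. 1 / of_nat N)) * q) \<le> Lp_norm p (cscale (of_real b) (cf (tp T (\<lambda>_. 1 / of_nat N))))"
  proof -
    have "Lp_norm p (cf (\<lambda>t. tp T (\<lambda>_. 1 / of_nat N) t * tp S c t)) \<le> Lp_norm p (cf (\<lambda>t. of_real b * tp T (\<lambda>_. 1 / of_nat N) t))"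
    proof (rule cf_Lp_mono(2))
      show "AE t in circle. cmod (tp T (\<lambda>_. 1 / of_nat N) t * tp S c t) \<le> cmod (of_real b * tp T (\<lambda>_. 1 / of_nat N) t)"
      proof (rule AE_I2)
        fix t assume "t \<in> space circle"
        then show "cmod (tp T (\<lambda>_. 1 / of_nat N) t * tp S c t) \<le> cmod (of_real b * tp T (\<lambda>_. 1 / of_nat N) t)"
          using b[of t] b0 mult_right_mono[of "cmod (tp S c t)" b "cmod (tp T (\<lambda>_. 1 / of_nat N) t)"]
          by (simp add: norm_mult mult.commute)
      qed
      show "cf (\<lambda>t. of_real b * tp T (\<lambda>_. 1 / of_nat N) t) \<in> Lp p"
        using p by (intro continuous_Lp continuous_intros) auto
      show "0 < p" using p by simp
    qed measurable
    then show ?thesis by (simp add: q_def cf_mult cscale_cf)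
  qed
  also have "\<dots> \<le> b * \<epsilon>"
    using N(2)[OF T] p b0 by (simp add: Lp_norm_cscale mult_left_mono)
  finally have "Lp_norm p z \<le> b * \<epsilon> / B"
    using p B by (simp add: z_eq Lp_norm_cscale norm_divide divide_right_mono)
  then have "Lp_norm p (K z) \<le> M * (b * \<epsilon> / B)"
    using M Hp_cscale[OF zH[of N], of "1 / of_nat N"] mult_left_mono order_trans unfolding z_def by metis
  also have "\<dots> \<le> (M + 1) * ((b + 1) * \<epsilon> / B)"
    using M(1) b0 \<epsilon> B by (intro mult_mono divide_right_mono mult_right_mono) auto
  also have "\<dots> = \<eta> / 3"
  proof -
    have "M + 1 \<noteq> 0" "b + 1 \<noteq> 0" "B \<noteq> 0" using M(1) b0 B by auto
    then show ?thesis by (simp add: \<epsilon>_def divide_simps)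
  qed
  finally have Kz: "Lp_norm p (K z) \<le> \<eta> / 3" .
  have Ksum: "K (\<Sum>k<n. x (s (k + k0))) = (\<Sum>k<n. K (x (s (k + k0))))" for n
  proof (induction n)
    case 0
    show ?case using compact_operator_linear(3)[OF K Hp_zero, of 0] by simp
  qed (simp add: compact_operator_linear(2)[OF K zH xH])
  have "K z - l = cscale (1 / of_nat N) (\<Sum>k<N. K (x (s (k + k0))) - l)"
  proof -
    have "cscale (1 / of_nat N) (\<Sum>k<N. l) = l"
    proof -
      have "(\<Sum>k<n. l) = cscale (of_nat n) l" for n
        by (induction n) (simp_all add: cscale_add_left add.commute del: sum_constant)
      then show ?thesis using N(1) by (simp only: cscale_cscale) simp
    qed
    then show ?thesis
      by (simp only: z_def compact_operator_linear(3)[OF K zH] Ksum sum_subtractf cscale_diff)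
  qed
  then have "Lp_norm p (K z - l) = 1 / real N * Lp_norm p (\<Sum>k<N. K (x (s (k + k0))) - l)"
    using p by (simp add: Lp_norm_cscale norm_divide)
  also have "\<dots> \<le> 1 / real N * (\<Sum>k<N. Lp_norm p (K (x (s (k + k0))) - l))"
    by (intro mult_left_mono Lp_norm_sum p1 Hp_Lp Hp_diff p l compact_operator_linear(1)[OF K] xH) auto
  also have "\<dots> \<le> 1 / real N * (\<Sum>k<N. \<eta> / 3)"
    using less_imp_le[OF k0[of "k + k0" for k]] by (intro mult_left_mono sum_mono) auto
  also have "\<dots> = \<eta> / 3" using N(1) by simp
  finally have Kzl: "Lp_norm p (K z - l) \<le> \<eta> / 3" .
  have KzH: "K z \<in> Hp p" unfolding z_def by (intro compact_operator_linear(1)[OF K] Hp_cscale zH)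
  have "\<eta> \<le> Lp_norm p (K (x (s k0)))" using Kx unfolding \<eta>_def .
  also have "\<dots> \<le> Lp_norm p (K (x (s k0)) - l) + Lp_norm p l"
    by (intro Lp_norm_triangle_le p1 Hp_Lp l compact_operator_linear(1)[OF K] xH)
  also have "\<dots> < \<eta> / 3 + Lp_norm p l" using k0[of k0] by simp
  also have "Lp_norm p l \<le> Lp_norm p (l - K z) + Lp_norm p (K z)"
    by (intro Lp_norm_triangle_le p1 Hp_Lp l KzH)
  also have "Lp_norm p (l - K z) = Lp_norm p (K z - l)" using p by (intro Lp_norm_minus_commute) auto
  finally show False using Kz Kzl by simp
qed

section \<open>Toeplitz plus Hankel operators\<close>

text \<open>Up to the unimodular factor \<open>cnj t\<close>, the flip is composition with the measure preserving map
  \<open>cnj\<close>.\<close>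

lemma flip_Lp: "flip x \<in> Lp p \<longleftrightarrow> x \<in> Lp p" and Lp_norm_flip: "Lp_norm p (flip x) = Lp_norm p x"
proof -
  obtain f where f [measurable]: "f \<in> borel_measurable circle" and xf: "x = cf f" by (rule cf_cases)
  have fc: "(\<lambda>t. f (cnj t)) \<in> borel_measurable circle"
    using measurable_compose[OF cnj_measurable_circle f] .
  have cnjm: "cnj \<in> borel_measurable circle"
    by (intro borel_measurable_circleI borel_measurable_continuous_onI continuous_intros)
  have m: "(\<lambda>t. cnj t * f (cnj t)) \<in> borel_measurable circle"
    by (rule borel_measurable_times[OF cnjm fc])
  have g: "(\<lambda>t. cmod (f t) powr p) \<in> borel_measurable circle" by measurable
  have "integrable circle (\<lambda>t. cmod (f t) powr p) = integrable (distr circle circle cnj) (\<lambda>t. cmod (f t) powr p)"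
    by (simp add: distr_circle_cnj)
  also have "\<dots> = integrable circle (\<lambda>t. cmod (f (cnj t)) powr p)"
    by (rule integrable_distr_eq[OF cnj_measurable_circle g])
  finally have int: "integrable circle (\<lambda>t. cmod (f t) powr p) = integrable circle (\<lambda>t. cmod (f (cnj t)) powr p)" .
  have "(LINT t|circle. cmod (f t) powr p) = (LINT t|distr circle circle cnj. cmod (f t) powr p)"
    by (simp add: distr_circle_cnj)
  also have "\<dots> = (LINT t|circle. cmod (f (cnj t)) powr p)"
    by (rule integral_distr[OF cnj_measurable_circle g])
  finally have eq: "Lp_norm p (cf (\<lambda>t. f (cnj t))) = Lp_norm p (cf f)"
    by (simp add: Lp_norm_cf[OF f] Lp_norm_cf[OF fc])
  have Lp: "cf (\<lambda>t. f (cnj t)) \<in> Lp p \<longleftrightarrow> cf f \<in> Lp p"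
    by (simp add: cf_in_Lp_iff[OF f] cf_in_Lp_iff[OF fc] int)
  have "cmod (cnj t * f (cnj t)) = cmod (f (cnj t))" if "t \<in> sphere 0 1" for t
    using that by (simp add: norm_mult)
  from Lp_norm_unimodular[OF m fc this, of p] Lp eq
  show "flip x \<in> Lp p \<longleftrightarrow> x \<in> Lp p" "Lp_norm p (flip x) = Lp_norm p x"
    by (simp_all add: xf flip_cf[OF f])
qed

text \<open>This is why the Hankel part loses its mass at high frequencies: the flip turns \<open>t\<^sup>n\<close> into
  \<open>t\<^sup>-\<^sup>n\<close>, and \<open>P\<close> annihilates \<open>t\<^sup>-\<^sup>n x\<close> in the limit.\<close>

lemma flip_tpow: "flip (tpow n * x) = tpow (- n) * flip x"
proof -
  obtain f where f [measurable]: "f \<in> borel_measurable circle" and xf: "x = cf f" by (rule cf_cases)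
  have fc: "(\<lambda>t. f (cnj t)) \<in> borel_measurable circle"
    using measurable_compose[OF cnj_measurable_circle f] .
  have cnjm: "cnj \<in> borel_measurable circle"
    by (intro borel_measurable_circleI borel_measurable_continuous_onI continuous_intros)
  have m: "(\<lambda>t. cnj t * f (cnj t)) \<in> borel_measurable circle"
    by (rule borel_measurable_times[OF cnjm fc])
  have "flip (tpow n * x) = cf (\<lambda>t. cnj t * (cnj t powi n * f (cnj t)))"
    by (simp add: xf tpow_def cf_mult flip_cf)
  also have "\<dots> = cf (\<lambda>t. t powi (- n) * (cnj t * f (cnj t)))"
  proof (subst cf_eq_iff)
    have "(\<lambda>t::complex. cnj t powi n) \<in> borel_measurable circle"
      by (intro continuous_circle_measurable continuous_intros) auto
    then show "(\<lambda>t. cnj t * (cnj t powi n * f (cnj t))) \<in> borel_measurable circle"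
      by (intro borel_measurable_times cnjm fc)
    show "(\<lambda>t. t powi (- n) * (cnj t * f (cnj t))) \<in> borel_measurable circle"
      by (intro borel_measurable_times powi_measurable_circle cnjm fc)
    show "AE t in circle. cnj t * (cnj t powi n * f (cnj t)) = t powi (- n) * (cnj t * f (cnj t))"
    proof (rule AE_I2)
      fix t assume "t \<in> space circle"
      then have "cnj t powi n = t powi (- n)" by (intro cnj_powi_circle) simp
      then show "cnj t * (cnj t powi n * f (cnj t)) = t powi (- n) * (cnj t * f (cnj t))"
        by (simp only: mult.left_commute)
    qed
  qed
  also have "\<dots> = tpow (- n) * flip x"
    unfolding tpow_def xf flip_cf[OF f] by (rule cf_mult[OF powi_measurable_circle m, symmetric])
  finally show ?thesis .
qed

lemma flip_cscale: "flip (cscale c x) = cscale c (flip x)"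
proof -
  obtain f where f: "f \<in> borel_measurable circle" and xf: "x = cf f" by (rule cf_cases)
  have cnjm: "cnj \<in> borel_measurable circle"
    by (intro borel_measurable_circleI borel_measurable_continuous_onI continuous_intros)
  have m: "(\<lambda>t. cnj t * f (cnj t)) \<in> borel_measurable circle"
    by (rule borel_measurable_times[OF cnjm measurable_compose[OF cnj_measurable_circle f]])
  show ?thesis
    unfolding xf cscale_cf[OF f] flip_cf[OF f] cscale_cf[OF m]
    by (subst flip_cf) (auto simp: algebra_simps intro!: borel_measurable_times borel_measurable_const f)
qed

lemma toeplitz_linear:
  assumes p: "1 < p" and a: "a \<in> Linf" and x: "x \<in> Lp p"
  shows "toeplitz p a x \<in> Hp p"
    and "toeplitz p a (cscale c x) = cscale c (toeplitz p a x)"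
    and "Lp_norm p (toeplitz p a x) \<le> op_norm p (Lp p) (riesz p) * Linf_norm a * Lp_norm p x"
proof -
  have ax: "a * x \<in> Lp p" "Lp_norm p (a * x) \<le> Linf_norm a * Lp_norm p x" using Linf_mult_Lp[of p a x] p a x by auto
  show "toeplitz p a x \<in> Hp p" unfolding toeplitz_def by (rule riesz_Hp(1)[OF p ax(1)])
  show "toeplitz p a (cscale c x) = cscale c (toeplitz p a x)"
    unfolding toeplitz_def mult_cscale by (rule riesz_cscale[OF p ax(1)])
  have "Lp_norm p (toeplitz p a x) \<le> op_norm p (Lp p) (riesz p) * Lp_norm p (a * x)"
    unfolding toeplitz_def by (rule riesz_op_norm(1)[OF p ax(1)])
  also have "\<dots> \<le> op_norm p (Lp p) (riesz p) * (Linf_norm a * Lp_norm p x)"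
    by (intro mult_left_mono ax riesz_op_norm(2) p)
  finally show "Lp_norm p (toeplitz p a x) \<le> op_norm p (Lp p) (riesz p) * Linf_norm a * Lp_norm p x" by (simp add: mult.assoc)
qed

lemma hankel_linear:
  assumes p: "1 < p" and b: "b \<in> Linf" and x: "x \<in> Lp p"
  shows "hankel p b x \<in> Hp p"
    and "hankel p b (cscale c x) = cscale c (hankel p b x)"
    and "Lp_norm p (hankel p b x) \<le> op_norm p (Lp p) (riesz p) * Linf_norm b * Lp_norm p x"
  using toeplitz_linear[OF p b, of "flip x"] x
  by (simp_all add: hankel_def toeplitz_def flip_Lp Lp_norm_flip flip_cscale)

text \<open>If \<open>M < N < \<parallel>a\<parallel>\<^sub>\<infinity>\<close>, the indicator function of the set where \<open>\<bar>a\<bar> > N\<close> is not zero in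
  \<open>L\<^sup>p\<close>, and multiplication by \<open>a\<close> stretches it at least by the factor \<open>N\<close>.\<close>

lemma Linf_norm_le_of_multiplier:
  assumes p: "1 < p" and a: "a \<in> Linf" and M: "\<And>x. x \<in> Lp p \<Longrightarrow> Lp_norm p (a * x) \<le> M * Lp_norm p x"
  shows "Linf_norm a \<le> M"
proof (rule ccontr)
  assume less: "\<not> Linf_norm a \<le> M"
  obtain f where f [measurable]: "f \<in> borel_measurable circle" and af: "a = cf f" by (rule cf_cases)
  have M0: "0 \<le> M"
    using order_trans[OF Lp_norm_nonneg M[OF const_Lp[of 1]]] Lp_norm_const[of p 1] p by simp
  define N where "N = (M + Linf_norm a) / 2"
  have N: "M < N" "N < Linf_norm a" "0 < N" using less M0 by (auto simp: N_def)
  define E where "E = {t \<in> space circle. ereal (cmod (f t)) > ereal N}"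
  have Em [measurable]: "E \<in> sets circle" unfolding E_def by measurable
  have "ereal N < esssup circle (\<lambda>t. ereal (cmod (f t)))"
    using Linf_norm_AE(3)[OF f a[unfolded af]] N(2) by (simp add: ess_bound_cf[OF f] af)
  then have "0 < emeasure circle E" unfolding E_def by (intro esssup_pos_measure) measurable
  then have E0: "0 < measure circle E" by (simp add: circle.emeasure_eq_measure)
  let ?i = "\<lambda>t. complex_of_real (indicator E t)"
  have im [measurable]: "?i \<in> borel_measurable circle" by measurable
  have iLp: "cf ?i \<in> Lp p" using p by (intro bounded_Lp(1)[of _ _ 1]) (auto simp: indicator_def)
  have inorm: "0 < Lp_norm p (cf ?i)"
  proof -
    have "(LINT t|circle. cmod (?i t) powr p) = (LINT t|circle. indicator E t)"
      using p by (intro Bochner_Integration.integral_cong refl) (auto simp: indicator_def)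
    moreover have "E \<inter> sphere 0 1 = E" by (auto simp: E_def)
    ultimately show ?thesis using E0 by (simp add: Lp_norm_cf)
  qed
  have "N * Lp_norm p (cf ?i) = Lp_norm p (cscale (of_real N) (cf ?i))"
    using p N(3) by (simp add: Lp_norm_cscale)
  also have "\<dots> \<le> Lp_norm p (a * cf ?i)"
    unfolding af cf_mult[OF f im] cscale_cf[OF im]
  proof (rule cf_Lp_mono(2))
    show "AE t in circle. cmod (of_real N * ?i t) \<le> cmod (f t * ?i t)"
      using N(3) by (intro AE_I2) (auto simp: indicator_def E_def)
    show "cf (\<lambda>t. f t * ?i t) \<in> Lp p"
      using Linf_mult_Lp(1)[OF _ a iLp] p by (simp add: af cf_mult)
    show "0 < p" using p by simp
  qed measurable
  also have "\<dots> \<le> M * Lp_norm p (cf ?i)" by (rule M[OF iLp])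
  finally show False using N(1) inorm by simp
qed

theorem theorem17:
  fixes p :: real and a b :: circle_fun and K :: "circle_fun \<Rightarrow> circle_fun"
  assumes "1 < p" and "a \<in> Linf" and "b \<in> Linf" and "compact_operator p K"
  defines "c \<equiv> op_norm p (Lp p) (riesz p)"
    and "A \<equiv> \<lambda>f. toeplitz p a f + hankel p b f"
  shows "max (Linf_norm a) (1 / (1 + c) * op_norm p (Hp p) (\<lambda>f. hankel p b f + K f))
           \<le> op_norm p (Hp p) (\<lambda>f. A f + K f) \<and>
         op_norm p (Hp p) (\<lambda>f. A f + K f)
           \<le> c * Linf_norm a + op_norm p (Hp p) (\<lambda>f. hankel p b f + K f)"
proof -
  note p = assms(1) and a = assms(2) and b = assms(3) and K = assms(4)
  have p1: "1 \<le> p" using p by simp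
  have c0: "0 \<le> c" unfolding c_def by (rule riesz_op_norm(2)[OF p])
  have a0: "0 \<le> Linf_norm a" by (rule Linf_norm_nonneg[OF a])
  define B where "B = (\<lambda>f. hankel p b f + K f)"
  define D where "D = (\<lambda>f. A f + K f)"
  have D_eq: "D x = toeplitz p a x + B x" for x by (simp add: D_def A_def B_def add.assoc)
  note T = toeplitz_linear[OF p a Hp_Lp, folded c_def]
  note H = hankel_linear[OF p b Hp_Lp, folded c_def]
  note Kl = compact_operator_linear[OF K]
  obtain M where M: "0 \<le> M" "\<And>x. x \<in> Hp p \<Longrightarrow> Lp_norm p (K x) \<le> M * Lp_norm p x"
    using compact_operator_bounded[OF p K] by metis
  have BH: "B x \<in> Hp p" if "x \<in> Hp p" for x
    unfolding B_def using that by (intro Hp_add p H(1) Kl(1))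
  have Bc: "B (cscale s x) = cscale s (B x)" if "x \<in> Hp p" for s x
    unfolding B_def using that by (simp add: H(2) Kl(3) cscale_add)
  have DH: "D x \<in> Hp p" if "x \<in> Hp p" for x
    unfolding D_eq using that by (intro Hp_add p T(1) BH)
  have Dc: "D (cscale s x) = cscale s (D x)" if "x \<in> Hp p" for s x
    unfolding D_eq using that by (simp add: T(2) Bc cscale_add)
  have Bball: "Lp_norm p (B x) \<le> c * Linf_norm b + M" if x: "x \<in> Hp p" "Lp_norm p x \<le> 1" for x
  proof -
    have "Lp_norm p (B x) \<le> Lp_norm p (hankel p b x) + Lp_norm p (K x)"
      unfolding B_def using x by (intro Lp_norm_triangle p1 Hp_Lp H(1) Kl(1))
    also have "\<dots> \<le> c * Linf_norm b * Lp_norm p x + M * Lp_norm p x"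
      using x by (intro add_mono H(3) M(2))
    also have "\<dots> \<le> c * Linf_norm b * 1 + M * 1"
      using x c0 Linf_norm_nonneg[OF b] M(1) by (intro add_mono mult_left_mono mult_nonneg_nonneg)
    finally show ?thesis by simp
  qed
  have Tball: "Lp_norm p (toeplitz p a x) \<le> c * Linf_norm a" if x: "x \<in> Hp p" "Lp_norm p x \<le> 1" for x
  proof -
    have "c * Linf_norm a * Lp_norm p x \<le> c * Linf_norm a * 1"
      using x c0 a0 by (intro mult_left_mono mult_nonneg_nonneg)
    then show ?thesis using T(3)[OF x(1)] by simp
  qed
  have DTB: "Lp_norm p (D x) \<le> Lp_norm p (toeplitz p a x) + Lp_norm p (B x)" if "x \<in> Hp p" for x
    unfolding D_eq using that by (intro Lp_norm_triangle p1 Hp_Lp T(1) BH)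
  have Dball: "Lp_norm p (D x) \<le> c * Linf_norm a + (c * Linf_norm b + M)" if x: "x \<in> Hp p" "Lp_norm p x \<le> 1" for x
    using DTB[OF x(1)] Tball[OF x] Bball[OF x] by linarith
  have Hsub: "Hp p \<subseteq> Lp p" using Hp_Lp by blast
  let ?B = "op_norm p (Hp p) B" and ?D = "op_norm p (Hp p) D"
  have Bn: "Lp_norm p (B x) \<le> ?B * Lp_norm p x" if "x \<in> Hp p" for x
    by (rule op_norm_bound[OF p1 Hsub Hp_cscale Bc Bball that])
  have Dn: "Lp_norm p (D x) \<le> ?D * Lp_norm p x" if "x \<in> Hp p" for x
    by (rule op_norm_bound[OF p1 Hsub Hp_cscale Dc Dball that])
  have B0: "0 \<le> ?B" by (rule op_norm_nonneg[OF Hp_zero Bball])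
  have D0: "0 \<le> ?D" by (rule op_norm_nonneg[OF Hp_zero Dball])

  have upper: "?D \<le> c * Linf_norm a + ?B"
  proof (rule op_norm_least[OF Hp_zero])
    fix x assume x: "x \<in> Hp p" "Lp_norm p x \<le> 1"
    have "?B * Lp_norm p x \<le> ?B * 1" using x B0 by (intro mult_left_mono)
    then show "Lp_norm p (D x) \<le> c * Linf_norm a + ?B"
      using DTB[OF x(1)] Tball[OF x] Bn[OF x(1)] by linarith
  qed

  have trig_case: "Lp_norm p (a * cf (tp S d)) \<le> ?D * Lp_norm p (cf (tp S d))" if S: "finite S" for S d
  proof -
    define q where "q = cf (tp S d)"
    have q: "q \<in> Lp p" using p by (auto simp: q_def intro: tp_Lp)
    have aq: "a * q \<in> Lp p" using p by (intro Linf_mult_Lp a q) auto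
    have bq: "b * flip q \<in> Lp p" using p q by (intro Linf_mult_Lp b) (auto simp: flip_Lp)
    define u where "u n = tpow (int n) * q" for n
    \<comment> \<open>A bound for the excess of \<open>\<parallel>a q\<parallel>\<close> over \<open>\<parallel>D (t\<^sup>n q)\<parallel>\<close>, as soon as \<open>t\<^sup>n q\<close> is in \<open>H\<^sup>p\<close>.\<close>
    define e where "e n = Lp_norm p (riesz p (tpow (int n) * (a * q)) - tpow (int n) * (a * q))
        + (Lp_norm p (riesz p (tpow (- int n) * (b * flip q))) + Lp_norm p (K (u n)))" for n
    have "e \<longlonglongrightarrow> 0 + (0 + 0)"
      unfolding e_def u_def q_def
      by (intro tendsto_add riesz_tpow_limit[OF p aq[unfolded q_def]] riesz_tpow_limit[OF p bq[unfolded q_def]]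
            compact_operator_vanishes[OF p K S])
    then have lim: "(\<lambda>n. ?D * Lp_norm p q + e n) \<longlonglongrightarrow> ?D * Lp_norm p q + 0"
      by (intro tendsto_add tendsto_const) simp
    obtain N where N: "\<And>n. N < nat \<bar>n\<bar> \<Longrightarrow> fourier_coeff q n = 0" using tp_degree[OF S] unfolding q_def by metis
    have "Lp_norm p (a * q) \<le> ?D * Lp_norm p q + e n" if n: "N \<le> n" for n
    proof -
      have uH: "u n \<in> Hp p" unfolding u_def q_def by (rule tpow_trig_in_Hp[OF p S N[unfolded q_def] n])
      let ?t = "tpow (int n) * (a * q)" and ?h = "riesz p (tpow (- int n) * (b * flip q))"
      have tL: "?t \<in> Lp p" and bL: "tpow (- int n) * (b * flip q) \<in> Lp p" using aq bq by (auto simp: Lp_tpow)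
      have toep: "toeplitz p a (u n) = riesz p ?t"
        by (simp add: toeplitz_def u_def mult.left_commute)
      have hank: "hankel p b (u n) = ?h"
        by (simp add: hankel_def u_def flip_tpow mult.left_commute)
      have rH: "riesz p ?t \<in> Hp p" "?h \<in> Hp p" using riesz_Hp(1)[OF p tL] riesz_Hp(1)[OF p bL] by auto
      have "riesz p ?t = D (u n) - (?h + K (u n))"
        by (simp add: D_def A_def toep hank algebra_simps)
      then have "Lp_norm p (riesz p ?t) \<le> Lp_norm p (D (u n)) + Lp_norm p (?h + K (u n))"
        using Lp_norm_diff_le[OF p1 Hp_Lp[OF DH[OF uH]] Hp_Lp[OF Hp_add[OF p rH(2) Kl(1)[OF uH]]]] by simp
      also have "\<dots> \<le> ?D * Lp_norm p (u n) + (Lp_norm p ?h + Lp_norm p (K (u n)))"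
        by (intro add_mono Dn uH Lp_norm_triangle p1 Hp_Lp rH Kl(1))
      finally have r: "Lp_norm p (riesz p ?t) \<le> ?D * Lp_norm p q + (Lp_norm p ?h + Lp_norm p (K (u n)))"
        by (simp add: u_def Lp_norm_tpow)
      have "Lp_norm p (a * q) = Lp_norm p ?t" by (simp add: Lp_norm_tpow)
      also have "\<dots> \<le> Lp_norm p (?t - riesz p ?t) + Lp_norm p (riesz p ?t)"
        by (intro Lp_norm_triangle_le p1 tL Hp_Lp rH)
      also have "Lp_norm p (?t - riesz p ?t) = Lp_norm p (riesz p ?t - ?t)" using p by (intro Lp_norm_minus_commute) auto
      finally show ?thesis using r unfolding e_def by linarith
    qed
    then have "Lp_norm p (a * q) \<le> ?D * Lp_norm p q + 0" by (intro LIMSEQ_le_const[OF lim]) blast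
    then show ?thesis by (simp add: q_def)
  qed

  have mult: "Lp_norm p (a * x) \<le> ?D * Lp_norm p x" if x: "x \<in> Lp p" for x
  proof (rule field_le_epsilon)
    fix e :: real assume e: "0 < e"
    define k where "k = Linf_norm a + ?D + 1"
    have k: "0 < k" using a0 D0 by (simp add: k_def)
    have ek: "0 < e / k" using e k by simp
    obtain S d where S: "finite S" "Lp_norm p (x - cf (tp S d)) < e / k" using trig_approx[OF p1 x ek] .
    define q where "q = cf (tp S d)"
    have q: "q \<in> Lp p" using p by (auto simp: q_def intro: tp_Lp)
    have xq: "x - q \<in> Lp p" "q - x \<in> Lp p" by (intro Lp_diff p1 x q)+
    have aL: "a * x \<in> Lp p" "a * q \<in> Lp p" using p by (auto intro: Linf_mult_Lp a x q)
    have "Lp_norm p q \<le> Lp_norm p (q - x) + Lp_norm p x" by (intro Lp_norm_triangle_le p1 q x)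
    then have "?D * Lp_norm p q \<le> ?D * (Lp_norm p (x - q) + Lp_norm p x)"
      using p D0 by (intro mult_left_mono) (simp_all add: Lp_norm_minus_commute)
    with trig_case[OF S(1), of d]
    have qD: "Lp_norm p (a * q) \<le> ?D * (Lp_norm p (x - q) + Lp_norm p x)" by (simp add: q_def)
    have "Lp_norm p (a * x) \<le> Lp_norm p (a * x - a * q) + Lp_norm p (a * q)"
      by (intro Lp_norm_triangle_le p1 aL)
    also have "a * x - a * q = a * (x - q)" by (simp add: algebra_simps)
    also have "Lp_norm p (a * (x - q)) \<le> Linf_norm a * Lp_norm p (x - q)" using p by (intro Linf_mult_Lp a xq) auto
    also note qD
    finally have "Lp_norm p (a * x) \<le> (Linf_norm a + ?D) * Lp_norm p (x - q) + ?D * Lp_norm p x"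
      by (simp add: algebra_simps)
    also have "(Linf_norm a + ?D) * Lp_norm p (x - q) \<le> k * (e / k)"
      using S(2) a0 D0 by (intro mult_mono) (auto simp: k_def q_def)
    finally show "Lp_norm p (a * x) \<le> ?D * Lp_norm p x + e" using k by simp
  qed
  have aD: "Linf_norm a \<le> ?D" by (rule Linf_norm_le_of_multiplier[OF p a mult])

  have "?B \<le> (1 + c) * ?D"
  proof (rule op_norm_least[OF Hp_zero])
    fix x assume x: "x \<in> Hp p" "Lp_norm p x \<le> 1"
    have "B x = D x - toeplitz p a x" by (simp add: D_eq)
    then have "Lp_norm p (B x) \<le> Lp_norm p (D x) + Lp_norm p (toeplitz p a x)"
      using Lp_norm_diff_le[OF p1 Hp_Lp[OF DH[OF x(1)]] Hp_Lp[OF T(1)[OF x(1)]]] by simp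
    also have "\<dots> \<le> ?D * 1 + c * ?D"
    proof (rule add_mono)
      show "Lp_norm p (D x) \<le> ?D * 1" using Dn[OF x(1)] mult_left_mono[OF x(2) D0] by linarith
      show "Lp_norm p (toeplitz p a x) \<le> c * ?D" using Tball[OF x] mult_left_mono[OF aD c0] by linarith
    qed
    finally show "Lp_norm p (B x) \<le> (1 + c) * ?D" by (simp add: algebra_simps)
  qed
  then have "1 / (1 + c) * ?B \<le> ?D" using c0 by (simp add: field_simps)
  then show ?thesis using aD upper unfolding B_def D_def by simp
qed

end
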